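(* Let $T,N\in\mathbb N$, $\ell_1,\dots,\ell_T>0$, and let $\boldsymbol\pi_{T,D}=\pi_T^{\otimes D}$ be as in the context. Assume that for every $t\in[T]$: $\bar w_t=\log G_t+\log m_t$ is twice continuously differentiable; $\partial_t^2\bar w_t$, $\partial_t^2\bar w_{t+1}$ and $\partial_t\partial_{t+1}\bar w_{t+1}$ are Lipschitz-continuous and bounded; and $\pi_T(|\partial_t\bar w_t|^4)<\infty$, $\pi_T(|\partial_t\bar w_{t+1}|^4)<\infty$ (with $\bar w_{T+1}\equiv0$). Then, for each version of the i-RW-CSMC algorithm (with or without backward sampling, with or without forced move) and any $t\in[T]$, $$\lim_{D\to\infty}\bigl|\overline{\mathrm{ESJD}}{}^N_{T,D}(t)-\ell_t\,\bar\alpha^N_T(t)\bigr|=0,$$ where $\overline{\mathrm{ESJD}}{}^N_{T,D}(t)=\mathbb E\bigl[\|\mathbf X'_t-\mathbf X_t\|_2^2\bigr]$ with $\mathbf X_{1:T}\sim\boldsymbol\pi_{T,D}$ and $\mathbf X'_{1:T}$ the new state produced by one i-RW-CSMC update started from $\mathbf X_{1:T}$, and $\bar\alpha^N_T(t)$ is the probability of $\{K_t\ne0\}$ under the corresponding limiting law $\overline{\mathbb P}^N_T$.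
   Context: Notation: $[n]=\{1,\dots,n\}$, $[n]_0=\{0,\dots,n\}$; $\partial_t$ is the derivative with respect to $x_t$; $\pi_T(\varphi)=\int\varphi\,\pi_T$; $\|\cdot\|_2$ is the Euclidean norm; $\mathbf 1_N$ is the all-ones vector, $I_N$ the identity. Quantities with time index $0$ are ignored. Model. $M_1$ is a probability measure on $\mathbb R$ with Lebesgue density $m_1$; for $t\ge2$, $M_t$ is a Markov kernel on $\mathbb R$ with transition density $m_t(x,y)$; $G_t:\mathbb R\to(0,\infty)$ is measurable. $\pi_T(x_{1:T})\propto m_1(x_1)G_1(x_1)\prod_{t=2}^T m_t(x_{t-1},x_t)G_t(x_t)$ is a probability density on $\mathbb R^T$. $\bar w_t(x_{t-1},x_t)=\log G_t(x_t)+\log m_t(x_{t-1},x_t)$ (a function of $x_1$ only if $t=1$), $\bar w_{T+1}\equiv0$. For $D\in\mathbb N$ and $\mathbf x_t=(x_{t,1},\dots,x_{t,D})\in\mathbb R^D$: $\mathbf m_t(\mathbf x_{t-1},\mathbf x_t)=\prod_d m_t(x_{t-1,d},x_{t,d})$, $\mathbf G_t(\mathbf x_t)=\prod_d G_t(x_{t,d})$, and the target $\boldsymbol\pi_{T,D}$ on $(\mathbb R^D)^T$ has density $\prod_{d=1}^D\pi_T(x_{1,d},\dots,x_{T,d})$. Selection functions. For $h^{1:N}\in\mathbb R^N$, $h^0:=0$: $\Psi^n(\{h^m\}_{m=1}^N)=\frac{e^{h^n}}{1+\sum_{m=1}^N e^{h^m}}$ for $n\in[N]_0$; $\Phi^n(\{h^m\}_{m=1}^N)=\frac{e^{h^n}}{1-1\wedge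 e^{h^n}+\sum_{m=1}^N e^{h^m}}$ for $n\in[N]$, $\Phi^0=1-\sum_{n=1}^N\Phi^n$. Let $\Sigma=\tfrac12(I_N+\mathbf 1_N\mathbf 1_N^{\mathsf T})$. One i-RW-CSMC update from $\mathbf x_{1:T}$. Particles: $\mathbf Z_t^0=\mathbf x_t$; independently over $(t,d)$ sample $U_{t,d}^{1:N}\sim\mathrm N(0,\Sigma)$ and set $Z_{t,d}^n=x_{t,d}+\sqrt{\ell_t/D}\,U_{t,d}^n$, $\mathbf Z_t^n=(Z_{t,d}^n)_{d\in[D]}$, $n\in[N]$. Ancestors: for $t=1,\dots,T-1$ set $A_t^0=0$ and, conditionally independently for $n\in[N]$, sample $A_t^n=l\in[N]_0$ with probability proportional to $\omega_t^l:=\mathbf m_t(\mathbf Z_{t-1}^{A_{t-1}^l},\mathbf Z_t^l)\mathbf G_t(\mathbf Z_t^l)$. Define $\omega_T^l$ in the same way and sample $K_T=k\in[N]_0$ with probability $\Psi^k(\{\log\omega_T^m-\log\omega_T^0\}_{m=1}^N)=\omega_T^k/\sum_{m=0}^N\omega_T^m$ (forced move: replace $\Psi^k$ by $\Phi^k$). For $t=T-1,\dots,1$: without backward sampling set $K_t=A_t^{K_{t+1}}$; with backward sampling sample $K_t=k\in[N]_0$ with probability proportional to $\omega_t^k\,\mathbf m_{t+1}(\mathbf Z_t^k,\mathbf Z_{t+1}^{K_{t+1}})$. New state: $(\mathbf Z_1^{K_1},\dots,\mathbf Z_T^{K_T})$. (The resulting Markov kernel leaves $\boldsymbol\pi_{T,D}$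 invariant.) Limiting law $\overline{\mathbb P}^N_T$. (1) Independently over $t\in[T]$ sample the Gaussian vector $(V_t,W_t)$, $V_t=V_t^{1:N}$, $W_t=W_t^{1:N}$, with means $\mathbb E V_t=\tfrac12\ell_t\pi_T(\partial_t^2\bar w_t)\mathbf 1_N$, $\mathbb E W_t=\tfrac12\ell_t\pi_T(\partial_t^2\bar w_{t+1})\mathbf 1_N$ and covariances $\mathrm{var}(V_t)=\ell_t\pi_T([\partial_t\bar w_t]^2)\Sigma$, $\mathrm{var}(W_t)=\ell_t\pi_T([\partial_t\bar w_{t+1}]^2)\Sigma$, $\mathrm{cov}(V_t,W_t)=\ell_t\pi_T([\partial_t\bar w_t][\partial_t\bar w_{t+1}])\Sigma$; put $V_t^0=W_t^0=0$ and $W_0^n=0$. (2) For $t=1,\dots,T-1$ set $A_t^0=0$ and, conditionally independently for $n\in[N]$, sample $A_t^n=l\in[N]_0$ with probability $\Psi^l(\{V_t^m+W_{t-1}^{A_{t-1}^m}\}_{m=1}^N)$. (3) Sample $K_T=k$ with probability $\Psi^k(\{V_T^m+W_{T-1}^{A_{T-1}^m}\}_{m=1}^N)$ (forced move: $\Phi^k$ instead). (4) For $t=T-1,\dots,1$: without backward sampling $K_t=A_t^{K_{t+1}}$; with backward sampling sample $K_t=k\in[N]_0$ with probability $\Psi^k(\{V_t^m+W_t^m+W_{t-1}^{A_{t-1}^m}\}_{m=1}^N)$. *)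

theory Defs
  imports "HOL-Probability.Probability" "HOL-Probability.Product_PMF"
begin

text \<open>
  Conventions. Times are \<open>t = 1, \<dots>, T\<close>, particle indices \<open>n = 0, \<dots>, N\<close> and coordinates
  \<open>d = 1, \<dots>, D\<close>, all of type \<open>nat\<close>. The initial density is encoded as \<open>m 1 x y = m1 y\<close>, i.e.\ the
  first argument of \<open>m 1\<close> is a dummy; hence the dummy coordinate \<open>x 0\<close>, the dummy particles at time 0 and
  the dummy ancestor indices at time 0 that occur in the formulas below never have any effect.
\<close>


section \<open>Calculus\<close>

definition C2 :: "('a::real_normed_vector \<Rightarrow> 'b::real_normed_vector) \<Rightarrow> bool" where
  "C2 f \<longleftrightarrow> (\<exists>(f' :: 'a \<Rightarrow> 'a \<Rightarrow>\<^sub>L 'b) (f'' :: 'a \<Rightarrow> 'a \<Rightarrow>\<^sub>L ('a \<Rightarrow>\<^sub>L 'b)).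
     (\<forall>z. (f has_derivative blinfun_apply (f' z)) (at z)) \<and>
     (\<forall>z. (f' has_derivative blinfun_apply (f'' z)) (at z)) \<and>
     continuous_on UNIV f'')"

definition deriv_fst :: "(real \<Rightarrow> real \<Rightarrow> real) \<Rightarrow> real \<Rightarrow> real \<Rightarrow> real" where
  "deriv_fst f x y = deriv (\<lambda>u. f u y) x"

definition deriv_snd :: "(real \<Rightarrow> real \<Rightarrow> real) \<Rightarrow> real \<Rightarrow> real \<Rightarrow> real" where
  "deriv_snd f x y = deriv (\<lambda>v. f x v) y"

definition lipschitz_bounded :: "(real \<Rightarrow> real \<Rightarrow> real) \<Rightarrow> bool" where
  "lipschitz_bounded f \<longleftrightarrow>
     (\<exists>L. L-lipschitz_on UNIV (\<lambda>(x, y). f x y)) \<and> bounded (range (\<lambda>(x, y). f x y))"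


section \<open>The target distribution\<close>

definition fk_density ::
  "nat \<Rightarrow> (nat \<Rightarrow> real \<Rightarrow> real \<Rightarrow> real) \<Rightarrow> (nat \<Rightarrow> real \<Rightarrow> real) \<Rightarrow> (nat \<Rightarrow> real) \<Rightarrow> real" where
  "fk_density T m G x = (\<Prod>t\<in>{1..T}. m t (x (t - 1)) (x t) * G t (x t))"

text \<open>If the unnormalised density is not integrable, then its Bochner integral is 0 and \<open>target\<close> is
  the null measure; so \<open>prob_space (target T m G)\<close> includes that normalisation is possible.\<close>

definition target ::
  "nat \<Rightarrow> (nat \<Rightarrow> real \<Rightarrow> real \<Rightarrow> real) \<Rightarrow> (nat \<Rightarrow> real \<Rightarrow> real) \<Rightarrow> (nat \<Rightarrow> real) measure" where
  "target T m G = density (\<Pi>\<^sub>M t\<in>{1..T}. lborel)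
     (\<lambda>x. ennreal (fk_density T m G x / (\<integral>x. fk_density T m G x \<partial>(\<Pi>\<^sub>M t\<in>{1..T}. lborel))))"

text \<open>The \<open>D\<close>-fold product of the target; its elements \<open>x\<close> are indexed as \<open>x d t\<close>.\<close>

definition target_prod ::
  "nat \<Rightarrow> nat \<Rightarrow> (nat \<Rightarrow> real \<Rightarrow> real \<Rightarrow> real) \<Rightarrow> (nat \<Rightarrow> real \<Rightarrow> real) \<Rightarrow>
   (nat \<Rightarrow> nat \<Rightarrow> real) measure" where
  "target_prod T D m G = (\<Pi>\<^sub>M d\<in>{1..D}. target T m G)"

definition log_weight ::
  "nat \<Rightarrow> (nat \<Rightarrow> real \<Rightarrow> real \<Rightarrow> real) \<Rightarrow> (nat \<Rightarrow> real \<Rightarrow> real) \<Rightarrow> nat \<Rightarrow> real \<Rightarrow> real \<Rightarrow> real" where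
  "log_weight T m G t x y = (if t \<le> T then ln (G t y) + ln (m t x y) else 0)"


section \<open>Gaussian vectors and selection functions\<close>

text \<open>The law of \<open>\<mu> + A \<xi>\<close>, where \<open>\<xi>\<close> has independent standard normal entries and \<open>A\<close> is a square
  matrix with \<open>A A\<^sup>T = C\<close>. Such an \<open>A\<close> exists if \<open>C\<close> is positive semidefinite (possibly singular), and the law
  does not depend on the choice of \<open>A\<close>.\<close>

definition gaussian_law ::
  "'i set \<Rightarrow> ('i \<Rightarrow> real) \<Rightarrow> ('i \<Rightarrow> 'i \<Rightarrow> real) \<Rightarrow> ('i \<Rightarrow> real) measure" where
  "gaussian_law I \<mu> C =
     (let A = (SOME A. \<forall>i\<in>I. \<forall>j\<in>I. (\<Sum>k\<in>I. A i k * A j k) = C i j)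
      in distr (\<Pi>\<^sub>M k\<in>I. std_normal_distribution) (\<Pi>\<^sub>M i\<in>I. borel)
           (\<lambda>\<xi>. \<lambda>i\<in>I. \<mu> i + (\<Sum>k\<in>I. A i k * \<xi> k)))"

definition Sigma_cov :: "nat \<Rightarrow> nat \<Rightarrow> real" where
  "Sigma_cov i j = (1 / 2) * ((if i = j then 1 else 0) + 1)"

definition select_Psi :: "nat \<Rightarrow> (nat \<Rightarrow> real) \<Rightarrow> nat \<Rightarrow> real" where
  "select_Psi N h n = exp (if n = 0 then 0 else h n) / (1 + (\<Sum>j\<in>{1..N}. exp (h j)))"

definition select_Phi :: "nat \<Rightarrow> (nat \<Rightarrow> real) \<Rightarrow> nat \<Rightarrow> real" where
  "select_Phi N h n =
     (let phi = (\<lambda>n. exp (h n) / (1 - min 1 (exp (h n)) + (\<Sum>j\<in>{1..N}. exp (h j))))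
      in if n = 0 then 1 - (\<Sum>j\<in>{1..N}. phi j) else phi n)"

definition select_final :: "bool \<Rightarrow> nat \<Rightarrow> (nat \<Rightarrow> real) \<Rightarrow> nat \<Rightarrow> real" where
  "select_final forced N h = (if forced then select_Phi N h else select_Psi N h)"

definition categorical :: "nat \<Rightarrow> (nat \<Rightarrow> real) \<Rightarrow> nat pmf" where
  "categorical N w = embed_pmf (\<lambda>l. if l \<le> N then w l / (\<Sum>j\<le>N. w j) else 0)"


section \<open>Ancestor indices and traced-back lineage\<close>

text \<open>Both the algorithm and its limit draw ancestor indices \<open>A t n\<close>, forward in time, and then the selected
  indices \<open>K t\<close>, backward in time; they differ only in the (possibly unnormalised) selection weights:
  \<open>p t A l\<close> for \<open>A\<^sub>t\<^sup>n = l\<close> (reading \<open>A\<close> at time \<open>t - 1\<close> only), \<open>q A k\<close> for \<open>K\<^sub>T = k\<close>, and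
  \<open>b t A k' k\<close> for \<open>K\<^sub>t = k\<close> given \<open>K\<^sub>t\<^sub>+\<^sub>1 = k'\<close> in the backward-sampling version. The default
  value 0 in \<open>Pi_pmf\<close> implements \<open>A\<^sub>t\<^sup>0 = 0\<close>.\<close>

primrec ancestor_law ::
  "nat \<Rightarrow> (nat \<Rightarrow> (nat \<Rightarrow> nat \<Rightarrow> nat) \<Rightarrow> nat \<Rightarrow> real) \<Rightarrow> nat \<Rightarrow> (nat \<Rightarrow> nat \<Rightarrow> nat) pmf" where
  "ancestor_law N p 0 = return_pmf (\<lambda>_ _. 0)"
| "ancestor_law N p (Suc t) = bind_pmf (ancestor_law N p t)
     (\<lambda>A. map_pmf (\<lambda>a. A(Suc t := a)) (Pi_pmf {1..N} 0 (\<lambda>n. categorical N (p (Suc t) A))))"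

text \<open>\<open>lineage_law \<dots> j\<close> has drawn \<open>K\<^sub>T, \<dots>, K\<^sub>T\<^sub>-\<^sub>j\<close>.\<close>

primrec lineage_law ::
  "nat \<Rightarrow> nat \<Rightarrow> bool \<Rightarrow> ((nat \<Rightarrow> nat \<Rightarrow> nat) \<Rightarrow> nat \<Rightarrow> real) \<Rightarrow>
   (nat \<Rightarrow> (nat \<Rightarrow> nat \<Rightarrow> nat) \<Rightarrow> nat \<Rightarrow> nat \<Rightarrow> real) \<Rightarrow> (nat \<Rightarrow> nat \<Rightarrow> nat) \<Rightarrow> nat \<Rightarrow> (nat \<Rightarrow> nat) pmf" where
  "lineage_law T N backward q b A 0 = map_pmf (\<lambda>k. (\<lambda>_. 0)(T := k)) (categorical N (q A))"
| "lineage_law T N backward q b A (Suc j) = bind_pmf (lineage_law T N backward q b A j)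
     (\<lambda>K. map_pmf (\<lambda>k. K(T - Suc j := k))
        (if backward then categorical N (b (T - Suc j) A (K (T - j)))
         else return_pmf (A (T - Suc j) (K (T - j)))))"

definition selection_law ::
  "nat \<Rightarrow> nat \<Rightarrow> bool \<Rightarrow> (nat \<Rightarrow> (nat \<Rightarrow> nat \<Rightarrow> nat) \<Rightarrow> nat \<Rightarrow> real) \<Rightarrow> ((nat \<Rightarrow> nat \<Rightarrow> nat) \<Rightarrow> nat \<Rightarrow> real) \<Rightarrow>
   (nat \<Rightarrow> (nat \<Rightarrow> nat \<Rightarrow> nat) \<Rightarrow> nat \<Rightarrow> nat \<Rightarrow> real) \<Rightarrow> (nat \<Rightarrow> nat) pmf" where
  "selection_law T N backward p q b =
     bind_pmf (ancestor_law N p (T - 1)) (\<lambda>A. lineage_law T N backward q b A (T - 1))"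


section \<open>The i-RW-CSMC update\<close>

text \<open>The proposal noise \<open>u\<close> is indexed as \<open>u (t, d) n\<close>, the particles \<open>z\<close> as \<open>z t n d\<close>.\<close>

definition noise_law :: "nat \<Rightarrow> nat \<Rightarrow> nat \<Rightarrow> (nat \<times> nat \<Rightarrow> nat \<Rightarrow> real) measure" where
  "noise_law T D N = (\<Pi>\<^sub>M td\<in>{1..T} \<times> {1..D}. gaussian_law {1..N} (\<lambda>_. 0) Sigma_cov)"

definition particles ::
  "nat \<Rightarrow> (nat \<Rightarrow> real) \<Rightarrow> (nat \<Rightarrow> nat \<Rightarrow> real) \<Rightarrow> (nat \<times> nat \<Rightarrow> nat \<Rightarrow> real) \<Rightarrow> nat \<Rightarrow> nat \<Rightarrow> nat \<Rightarrow> real" where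
  "particles D ell x u t n d =
     (if n = 0 then x d t else x d t + sqrt (ell t / real D) * u (t, d) n)"

definition mutation_prod ::
  "nat \<Rightarrow> (nat \<Rightarrow> real \<Rightarrow> real \<Rightarrow> real) \<Rightarrow> nat \<Rightarrow> (nat \<Rightarrow> real) \<Rightarrow> (nat \<Rightarrow> real) \<Rightarrow> real" where
  "mutation_prod D m t x y = (\<Prod>d\<in>{1..D}. m t (x d) (y d))"

definition potential_prod :: "nat \<Rightarrow> (nat \<Rightarrow> real \<Rightarrow> real) \<Rightarrow> nat \<Rightarrow> (nat \<Rightarrow> real) \<Rightarrow> real" where
  "potential_prod D G t x = (\<Prod>d\<in>{1..D}. G t (x d))"

definition particle_weight ::
  "nat \<Rightarrow> (nat \<Rightarrow> real \<Rightarrow> real \<Rightarrow> real) \<Rightarrow> (nat \<Rightarrow> real \<Rightarrow> real) \<Rightarrow> (nat \<Rightarrow> nat \<Rightarrow> nat \<Rightarrow> real) \<Rightarrow>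
   nat \<Rightarrow> (nat \<Rightarrow> nat \<Rightarrow> nat) \<Rightarrow> nat \<Rightarrow> real" where
  "particle_weight D m G z t A l =
     mutation_prod D m t (z (t - 1) (A (t - 1) l)) (z t l) * potential_prod D G t (z t l)"

text \<open>The conditional law of the selected indices \<open>K\<close> given the particles \<open>z\<close>.\<close>

definition csmc_selection ::
  "nat \<Rightarrow> nat \<Rightarrow> nat \<Rightarrow> bool \<Rightarrow> bool \<Rightarrow> (nat \<Rightarrow> real \<Rightarrow> real \<Rightarrow> real) \<Rightarrow> (nat \<Rightarrow> real \<Rightarrow> real) \<Rightarrow>
   (nat \<Rightarrow> nat \<Rightarrow> nat \<Rightarrow> real) \<Rightarrow> (nat \<Rightarrow> nat) pmf" where
  "csmc_selection T D N backward forced m G z = selection_law T N backward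
     (particle_weight D m G z)
     (\<lambda>A. select_final forced N
        (\<lambda>n. ln (particle_weight D m G z T A n) - ln (particle_weight D m G z T A 0)))
     (\<lambda>t A k' k. particle_weight D m G z t A k * mutation_prod D m (t + 1) (z t k) (z (t + 1) k'))"

text \<open>Expectation over the stationary state, the proposal noise and, conditionally on these, the selected
  indices; the new state at time \<open>s\<close> is \<open>z s (K s)\<close>.\<close>

definition ESJD ::
  "nat \<Rightarrow> nat \<Rightarrow> nat \<Rightarrow> bool \<Rightarrow> bool \<Rightarrow> (nat \<Rightarrow> real \<Rightarrow> real \<Rightarrow> real) \<Rightarrow> (nat \<Rightarrow> real \<Rightarrow> real) \<Rightarrow>
   (nat \<Rightarrow> real) \<Rightarrow> nat \<Rightarrow> real" where
  "ESJD T D N backward forced m G ell s =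
     (\<integral>(x, u).
        (let z = particles D ell x u
         in measure_pmf.expectation (csmc_selection T D N backward forced m G z)
              (\<lambda>K. (L2_set (\<lambda>d. z s (K s) d - x d s) {1..D})\<^sup>2))
      \<partial>(target_prod T D m G \<Otimes>\<^sub>M noise_law T D N))"


section \<open>The limiting law\<close>

text \<open>\<open>Inl n\<close> indexes \<open>V\<^sub>t\<^sup>n\<close> and \<open>Inr n\<close> indexes \<open>W\<^sub>t\<^sup>n\<close>.\<close>

definition limit_mean ::
  "nat \<Rightarrow> (nat \<Rightarrow> real \<Rightarrow> real \<Rightarrow> real) \<Rightarrow> (nat \<Rightarrow> real \<Rightarrow> real) \<Rightarrow> (nat \<Rightarrow> real) \<Rightarrow> nat \<Rightarrow> nat + nat \<Rightarrow> real" where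
  "limit_mean T m G ell t i =
     (let w = log_weight T m G in case i of
        Inl n \<Rightarrow> (1 / 2) * ell t *
          (\<integral>x. deriv_snd (deriv_snd (w t)) (x (t - 1)) (x t) \<partial>target T m G)
      | Inr n \<Rightarrow> (1 / 2) * ell t *
          (\<integral>x. deriv_fst (deriv_fst (w (t + 1))) (x t) (x (t + 1)) \<partial>target T m G))"

definition limit_cov ::
  "nat \<Rightarrow> (nat \<Rightarrow> real \<Rightarrow> real \<Rightarrow> real) \<Rightarrow> (nat \<Rightarrow> real \<Rightarrow> real) \<Rightarrow> (nat \<Rightarrow> real) \<Rightarrow> nat \<Rightarrow>
   nat + nat \<Rightarrow> nat + nat \<Rightarrow> real" where
  "limit_cov T m G ell t i j =
     (let w = log_weight T m G;
          dv = (\<lambda>x. deriv_snd (w t) (x (t - 1)) (x t));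
          dw = (\<lambda>x. deriv_fst (w (t + 1)) (x t) (x (t + 1)))
      in case (i, j) of
        (Inl n, Inl n') \<Rightarrow> ell t * (\<integral>x. (dv x)\<^sup>2 \<partial>target T m G) * Sigma_cov n n'
      | (Inr n, Inr n') \<Rightarrow> ell t * (\<integral>x. (dw x)\<^sup>2 \<partial>target T m G) * Sigma_cov n n'
      | (Inl n, Inr n') \<Rightarrow> ell t * (\<integral>x. dv x * dw x \<partial>target T m G) * Sigma_cov n n'
      | (Inr n, Inl n') \<Rightarrow> ell t * (\<integral>x. dv x * dw x \<partial>target T m G) * Sigma_cov n n')"

definition limit_noise_law ::
  "nat \<Rightarrow> nat \<Rightarrow> (nat \<Rightarrow> real \<Rightarrow> real \<Rightarrow> real) \<Rightarrow> (nat \<Rightarrow> real \<Rightarrow> real) \<Rightarrow> (nat \<Rightarrow> real) \<Rightarrow>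
   (nat \<Rightarrow> nat + nat \<Rightarrow> real) measure" where
  "limit_noise_law T N m G ell =
     (\<Pi>\<^sub>M t\<in>{1..T}. gaussian_law ({1..N} <+> {1..N}) (limit_mean T m G ell t) (limit_cov T m G ell t))"

definition limit_V :: "(nat \<Rightarrow> nat + nat \<Rightarrow> real) \<Rightarrow> nat \<Rightarrow> nat \<Rightarrow> real" where
  "limit_V g t n = (if n = 0 then 0 else g t (Inl n))"

definition limit_W :: "(nat \<Rightarrow> nat + nat \<Rightarrow> real) \<Rightarrow> nat \<Rightarrow> nat \<Rightarrow> real" where
  "limit_W g t n = (if n = 0 \<or> t = 0 then 0 else g t (Inr n))"

definition limit_selection ::
  "nat \<Rightarrow> nat \<Rightarrow> bool \<Rightarrow> bool \<Rightarrow> (nat \<Rightarrow> nat + nat \<Rightarrow> real) \<Rightarrow> (nat \<Rightarrow> nat) pmf" where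
  "limit_selection T N backward forced g =
     (let V = limit_V g; W = limit_W g in selection_law T N backward
        (\<lambda>t A. select_Psi N (\<lambda>n. V t n + W (t - 1) (A (t - 1) n)))
        (\<lambda>A. select_final forced N (\<lambda>n. V T n + W (T - 1) (A (T - 1) n)))
        (\<lambda>t A k'. select_Psi N (\<lambda>n. V t n + W t n + W (t - 1) (A (t - 1) n))))"

definition limit_acceptance ::
  "nat \<Rightarrow> nat \<Rightarrow> bool \<Rightarrow> bool \<Rightarrow> (nat \<Rightarrow> real \<Rightarrow> real \<Rightarrow> real) \<Rightarrow> (nat \<Rightarrow> real \<Rightarrow> real) \<Rightarrow>
   (nat \<Rightarrow> real) \<Rightarrow> nat \<Rightarrow> real" where
  "limit_acceptance T N backward forced m G ell s =
     (\<integral>g. measure_pmf.prob (limit_selection T N backward forced g) {K. K s \<noteq> 0}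
      \<partial>limit_noise_law T N m G ell)"

end

theory Submission
  imports Defs
begin

text \<open>
  Given the current state, the first-order part of every log-weight increment is a linear function of
  Gaussian noise, so its conditional characteristic function is explicit and only involves an empirical
  covariance over the coordinates. A second-order Taylor expansion shows that the increments differ from
  their first-order parts by the limiting means, up to errors that vanish in \<open>L\<^sup>1\<close>; the cross terms vanish
  since the noises at different times are independent and centred. The weak law of large numbers for the empirical
  covariance then gives convergence of the joint characteristic functions, and no central limit theorem is needed.
  Given the increments, the selection probabilities are bounded continuous functions of finitely many of
  them, so they converge in mean. Finally the squared jump at time \<open>s\<close> of a particle \<open>k \<noteq> 0\<close> is
  \<open>\<ell>\<^sub>s\<close> times an empirical second moment of the noise, which tends to 1 in \<open>L\<^sup>1\<close>.
\<close>

section \<open>Convergence in law of finite families from characteristic functions\<close>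

text \<open>Algorithm and limit are both written as one selection law driven by a family of reals
  indexed by (t, a, l). The pair (0, 0) is the reference, so common factors cancel, and the limiting
  family is V_t^l + W_(t-1)^a. What remains is joint convergence in law of this finite family, since
  every draw depends continuously on it. One draw compares many ratios at once, so marginals do not
  suffice. The continuity theorem in several dimensions comes from Stone-Weierstrass for the algebra
  of trigonometric polynomials, with tightness supplied by the one-dimensional theorem.

  Errors are measured in L1 because this mode survives multiplication by a bounded factor; that
  settles the dependence between the selected index and the size of its jump. As \<open>cis\<close>
  is 1-Lipschitz, L1 errors also suffice for characteristic functions. The L1 bounds come from
  second moments of averages over coordinates. The average that decides the conditional variance
  involves products of two scores, and this is where the fourth moments enter.\<close>

inductive_set trig_polys :: "'i set \<Rightarrow> (('i \<Rightarrow> real) \<Rightarrow> complex) set" for I where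
  cis: "(\<lambda>h. c * cis (\<Sum>i\<in>I. \<theta> i * h i)) \<in> trig_polys I"
| add: "f \<in> trig_polys I \<Longrightarrow> g \<in> trig_polys I \<Longrightarrow> (\<lambda>h. f h + g h) \<in> trig_polys I"

text \<open>Frequencies add under multiplication. Closure under products makes this class an
  algebra, as Stone-Weierstrass requires.\<close>

lemma trig_polys_mult:
  assumes "f \<in> trig_polys I" "g \<in> trig_polys I"
  shows "(\<lambda>h. f h * g h) \<in> trig_polys I"
  using assms(1)
proof induction
  case (cis c \<theta>)
  show ?case using assms(2)
  proof induction
    case (cis c' \<theta>')
    have "(\<lambda>h. c * cis (\<Sum>i\<in>I. \<theta> i * h i) * (c' * cis (\<Sum>i\<in>I. \<theta>' i * h i)))
        = (\<lambda>h. (c * c') * cis (\<Sum>i\<in>I. (\<theta> i + \<theta>' i) * h i))"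
      by (auto simp: cis_mult[symmetric] sum.distrib distrib_right)
    then show ?case by (simp only: trig_polys.cis)
  next
    case (add f g)
    then show ?case by (simp add: distrib_left trig_polys.add)
  qed
next
  case (add f f')
  then show ?case by (simp add: distrib_right trig_polys.add)
qed

lemma trig_polys_const: "(\<lambda>_. c) \<in> trig_polys I"
  using trig_polys.cis[of c "\<lambda>_. 0" I] by simp

lemma trig_polys_sin:
  assumes "finite I" "i \<in> I"
  shows "(\<lambda>h. complex_of_real (sin (h i / r))) \<in> trig_polys I"
proof -
  have "complex_of_real (sin x) = 1 / (2 * \<i>) * cis x + - 1 / (2 * \<i>) * cis (- x)" for x
    by (simp add: complex_eq_iff)
  moreover have "(\<Sum>j\<in>I. (if j = i then 1 / r else 0) * h j) = h i / r"
    "(\<Sum>j\<in>I. (if j = i then - (1 / r) else 0) * h j) = - (h i / r)" for h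
    using assms by (simp_all add: if_distrib[where f="\<lambda>x. x * _"] cong: if_cong)
  ultimately show ?thesis
    using trig_polys.add[OF trig_polys.cis[of "1 / (2 * \<i>)" "\<lambda>j. if j = i then 1 / r else 0" I]
        trig_polys.cis[of "- 1 / (2 * \<i>)" "\<lambda>j. if j = i then - (1 / r) else 0" I]]
    by simp
qed

text \<open>Such an expectation is a finite linear combination of values of the characteristic
  function, so convergence is inherited term by term.\<close>

lemma trig_polys_expectation_tendsto:
  fixes X :: "nat \<Rightarrow> 'a \<Rightarrow> 'i \<Rightarrow> real" and Y :: "'b \<Rightarrow> 'i \<Rightarrow> real"
  assumes prob: "\<And>n. prob_space (M n)" "prob_space M'"
    and [measurable]: "\<And>n i. (\<lambda>w. X n w i) \<in> borel_measurable (M n)"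
      "\<And>i. (\<lambda>w. Y w i) \<in> borel_measurable M'"
    and char: "\<And>\<theta>. (\<lambda>n. LINT w|M n. cis (\<Sum>i\<in>I. \<theta> i * X n w i))
      \<longlonglongrightarrow> (LINT w|M'. cis (\<Sum>i\<in>I. \<theta> i * Y w i))"
    and p: "p \<in> trig_polys I"
  shows "(\<forall>n. integrable (M n) (\<lambda>w. p (X n w))) \<and> integrable M' (\<lambda>w. p (Y w)) \<and>
    (\<lambda>n. LINT w|M n. p (X n w)) \<longlonglongrightarrow> (LINT w|M'. p (Y w))"
  using p
proof induction
  case (cis c \<theta>)
  interpret M: prob_space "M n" for n by (rule prob)
  interpret M': prob_space M' by (rule prob)
  have cont: "continuous_on UNIV cis" by (intro continuous_intros)
  have [measurable]: "cis \<in> borel_measurable borel"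
    by (rule borel_measurable_continuous_onI[OF cont])
  have "integrable (M n) (\<lambda>w. cis (\<Sum>i\<in>I. \<theta> i * X n w i))" for n
    by (rule M.integrable_const_bound[where B=1]) auto
  moreover have "integrable M' (\<lambda>w. cis (\<Sum>i\<in>I. \<theta> i * Y w i))"
    by (rule M'.integrable_const_bound[where B=1]) auto
  ultimately show ?case
    using char[of \<theta>] by (auto intro!: tendsto_intros)
next
  case (add f g)
  then show ?case by (auto intro!: tendsto_intros)
qed

text \<open>The map \<open>x \<mapsto> c * arcsin (sin (x / c))\<close> is the identity near 0 and takes values in a bounded interval. Composing
  with it therefore changes \<open>F\<close> only outside a box, and the approximation by Stone--Weierstrass in the variables
  \<open>sin (h i / c)\<close> is uniform on the whole space.\<close>

lemma trig_polys_approximation: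
  fixes F :: "('i::countable \<Rightarrow> real) \<Rightarrow> real"
  assumes I: "finite I" and F: "continuous_on UNIV F" and c: "0 < c" and e: "0 < e"
  obtains g where "(\<lambda>h. complex_of_real (g h)) \<in> trig_polys I"
    "\<And>h. (\<And>i. i \<notin> I \<Longrightarrow> h i = 0) \<Longrightarrow> \<bar>F (\<lambda>i. c * arcsin (sin (h i / c))) - g h\<bar> < e"
proof -
  \<comment> \<open>The compact set of possible sine vectors. Coordinates outside \<open>I\<close>
    are pinned to 0, so the coordinates in \<open>I\<close> alone separate its points.\<close>
  define S :: "('i \<Rightarrow> real) set" where "S = (\<Pi>\<^sub>E i\<in>UNIV. if i \<in> I then {-1..1} else {0})"
  \<comment> \<open>The algebra lives on the sine coordinates; membership records that substituting
    the sines yields a trigonometric polynomial in the original variables.\<close>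
  define R where "R = {g. continuous_on S g \<and>
      (\<lambda>h. complex_of_real (g (\<lambda>i. sin (h i / c)))) \<in> trig_polys I}"
  interpret function_ring_on R S
  proof
    have "compactin (product_topology (\<lambda>_. euclidean) UNIV) S"
      unfolding S_def compactin_PiE by (auto simp: compactin_euclidean_iff)
    then show "compact S"
      by (simp add: euclidean_product_topology compactin_euclidean_iff)
  next
    fix x y assume xy: "x \<in> S" "y \<in> S" "x \<noteq> y"
    then obtain i where i: "x i \<noteq> y i" by auto
    have "i \<in> I" using xy i by (auto simp: S_def PiE_iff split: if_splits) (metis)
    moreover have "continuous_on S (\<lambda>x. x i)"
      by (rule continuous_on_subset[OF continuous_on_product_coordinates]) simp
    ultimately have "(\<lambda>x. x i) \<in> R"
      using I by (auto simp: R_def intro!: trig_polys_sin)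
    then show "\<exists>f\<in>R. f x \<noteq> f y" using i by (intro bexI[of _ "\<lambda>x. x i"])
  qed (auto simp: R_def intro!: continuous_intros trig_polys.add trig_polys_mult trig_polys_const)
  \<comment> \<open>\<open>arcsin\<close> is continuous on [-1, 1] only, which is exactly where the
    coordinates of points of \<open>S\<close> lie.\<close>
  have "continuous_on S (\<lambda>s. F (\<lambda>i. c * arcsin (s i)))"
  proof (rule continuous_on_compose2[OF F])
    show "continuous_on S (\<lambda>s i. c * arcsin (s i))"
    proof (rule continuous_on_coordinatewise_then_product)
      fix i
      have "continuous_on S (\<lambda>s. s i)"
        by (rule continuous_on_subset[OF continuous_on_product_coordinates]) simp
      moreover have "\<forall>x\<in>S. - 1 \<le> x i \<and> x i \<le> 1"
      proof
        fix x assume "x \<in> S"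
        then have "x i \<in> (if i \<in> I then {-1..1} else {0})" by (auto simp: S_def PiE_iff)
        then show "- 1 \<le> x i \<and> x i \<le> 1" by (cases "i \<in> I") auto
      qed
      ultimately show "continuous_on S (\<lambda>s. c * arcsin (s i))"
        by (intro continuous_intros) auto
    qed
  qed auto
  from Stone_Weierstrass_basic[OF this e] obtain g where g: "g \<in> R"
    "\<And>s. s \<in> S \<Longrightarrow> \<bar>F (\<lambda>i. c * arcsin (s i)) - g s\<bar> < e" by blast
  show ?thesis
  proof (rule that[of "\<lambda>h. g (\<lambda>i. sin (h i / c))"])
    show "(\<lambda>h. complex_of_real (g (\<lambda>i. sin (h i / c)))) \<in> trig_polys I"
      using g(1) by (simp add: R_def)
    fix h :: "'i \<Rightarrow> real" assume "\<And>i. i \<notin> I \<Longrightarrow> h i = 0"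
    then have "(\<lambda>i. sin (h i / c)) \<in> S" by (auto simp: S_def)
    from g(2)[OF this] show "\<bar>F (\<lambda>i. c * arcsin (sin (h i / c))) - g (\<lambda>i. sin (h i / c))\<bar> < e" .
  qed
qed

text \<open>A continuous surrogate for the tail probability of \<open>\<bar>Y\<bar> > k\<close>;
  being bounded and continuous, it can be passed through weak convergence.\<close>

lemma (in prob_space) tail_expectation_tendsto_0:
  fixes Y :: "'a \<Rightarrow> real"
  assumes [measurable]: "Y \<in> borel_measurable M"
  shows "(\<lambda>k. LINT w|M. min 1 (max 0 (\<bar>Y w\<bar> - real k))) \<longlonglongrightarrow> 0"
proof -
  have "(\<lambda>k. LINT w|M. min 1 (max 0 (\<bar>Y w\<bar> - real k))) \<longlonglongrightarrow> (LINT w|M. 0)"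
  proof (rule integral_dominated_convergence[where w="\<lambda>_. 1"])
    show "AE w in M. (\<lambda>k. min 1 (max 0 (\<bar>Y w\<bar> - real k))) \<longlonglongrightarrow> 0"
    proof (rule AE_I2)
      fix w
      have "eventually (\<lambda>k. \<bar>Y w\<bar> \<le> real k) sequentially"
        using filterlim_real_sequentially by (simp add: filterlim_at_top)
      then have "eventually (\<lambda>k. min 1 (max 0 (\<bar>Y w\<bar> - real k)) = 0) sequentially"
        by eventually_elim auto
      then show "(\<lambda>k. min 1 (max 0 (\<bar>Y w\<bar> - real k))) \<longlonglongrightarrow> 0"
        by (rule tendsto_eventually)
    qed
  qed auto
  then show ?thesis by simp
qed

lemma (in prob_space) expectation_diff_bound:
  fixes f g h :: "'a \<Rightarrow> real"
  assumes int: "integrable M f" "integrable M g" "integrable M h"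
    and le: "\<And>x. \<bar>f x - g x\<bar> \<le> c * h x + d"
  shows "\<bar>expectation f - expectation g\<bar> \<le> c * expectation h + d"
proof -
  have "\<bar>expectation f - expectation g\<bar> = \<bar>expectation (\<lambda>x. f x - g x)\<bar>" using int by simp
  also have "\<dots> \<le> expectation (\<lambda>x. c * h x + d)"
    using int by (intro order_trans[OF integral_abs_bound] integral_mono) (auto intro!: le)
  also have "\<dots> = c * expectation h + d" using int by (simp add: prob_space)
  finally show ?thesis .
qed

text \<open>\<open>F\<close> is replaced by a trigonometric polynomial \<open>g\<close>, which is
  close to \<open>F\<close> on a large box and differs from it by at most 2 * B + \<delta>
  elsewhere. Convergence of the marginals controls the mass outside the box along the sequence.
  Families vanish off \<open>I\<close>, so \<open>F\<close> may be a function on the full product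
  space.\<close>

theorem Levy_continuity_finite_dim:
  fixes X :: "nat \<Rightarrow> 'a \<Rightarrow> 'i::countable \<Rightarrow> real" and Y :: "'b \<Rightarrow> 'i \<Rightarrow> real"
  assumes I: "finite I" and prob: "\<And>n. prob_space (M n)" "prob_space M'"
    and X[measurable]: "\<And>n i. (\<lambda>w. X n w i) \<in> borel_measurable (M n)"
    and Y[measurable]: "\<And>i. (\<lambda>w. Y w i) \<in> borel_measurable M'"
    and zero: "\<And>n w i. i \<notin> I \<Longrightarrow> X n w i = 0" "\<And>w i. i \<notin> I \<Longrightarrow> Y w i = 0"
    and char: "\<And>\<theta>. (\<lambda>n. LINT w|M n. cis (\<Sum>i\<in>I. \<theta> i * X n w i))
      \<longlonglongrightarrow> (LINT w|M'. cis (\<Sum>i\<in>I. \<theta> i * Y w i))"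
    and F: "continuous_on UNIV F" "\<And>h. \<bar>F h\<bar> \<le> (B::real)"
  shows "(\<lambda>n. LINT w|M n. F (X n w)) \<longlonglongrightarrow> (LINT w|M'. F (Y w))"
proof -
  interpret M: prob_space "M n" for n by (rule prob)
  interpret M': prob_space M' by (rule prob)
  have B: "0 \<le> B" using F(2)[of undefined] by linarith
  have [measurable]: "X n \<in> borel_measurable (M n)" "Y \<in> borel_measurable M'" for n
    by (auto intro!: measurable_coordinatewise_then_product)
  have [measurable]: "F \<in> borel_measurable borel"
    by (rule borel_measurable_continuous_onI[OF F(1)])
  \<comment> \<open>\<open>\<phi> k\<close> vanishes on [-k, k] and equals 1 beyond k + 1, so
    \<open>\<psi> k\<close> is at least 1 outside the box of half-width k + 1.\<close>
  define \<phi> :: "nat \<Rightarrow> real \<Rightarrow> real" where "\<phi> k x = min 1 (max 0 (\<bar>x\<bar> - real k))" for k x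
  define \<psi> where "\<psi> k h = (\<Sum>i\<in>I. \<phi> k (h i))" for k and h :: "'i \<Rightarrow> real"
  have \<phi>_cont: "isCont (\<phi> k) x" for k x unfolding \<phi>_def by (intro continuous_intros)
  have [measurable]: "\<phi> k \<in> borel_measurable borel" for k unfolding \<phi>_def by measurable
  have \<phi>01: "0 \<le> \<phi> k x" "\<phi> k x \<le> 1" for k x by (auto simp: \<phi>_def)
  have int\<phi>X: "integrable (M n) (\<lambda>w. \<phi> k (X n w i))" for n k i
    by (rule M.integrable_const_bound[where B=1]) (auto simp: \<phi>01)
  have int\<phi>Y: "integrable M' (\<lambda>w. \<phi> k (Y w i))" for k i
    by (rule M'.integrable_const_bound[where B=1]) (auto simp: \<phi>01)
  have Y0: "(\<lambda>k. LINT w|M'. \<psi> k (Y w)) \<longlonglongrightarrow> 0"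
  proof -
    have "(\<lambda>k. \<Sum>i\<in>I. LINT w|M'. \<phi> k (Y w i)) \<longlonglongrightarrow> (\<Sum>i\<in>I. 0)"
      unfolding \<phi>_def by (intro tendsto_sum M'.tail_expectation_tendsto_0) measurable
    then show ?thesis by (simp add: \<psi>_def int\<phi>Y)
  qed
  \<comment> \<open>tightness of the family, from the one-dimensional continuity theorem for each marginal\<close>
  have marginal: "(\<lambda>n. LINT w|M n. \<phi> k (X n w i)) \<longlonglongrightarrow> (LINT w|M'. \<phi> k (Y w i))"
    if i: "i \<in> I" for k i
  proof -
    define P where "P n = distr (M n) borel (\<lambda>w. X n w i)" for n
    define P' where "P' = distr M' borel (\<lambda>w. Y w i)"
    have rd: "real_distribution (P n)" "real_distribution P'" for n
      unfolding P_def P'_def by (auto intro!: M.real_distribution_distr M'.real_distribution_distr)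
    have conv: "(\<lambda>n. char (P n) t) \<longlonglongrightarrow> char P' t" for t
    proof -
      have "(\<Sum>j\<in>I. (if j = i then t else 0) * h j) = t * h i" for h :: "'i \<Rightarrow> real"
        using i I by (simp add: if_distrib[where f="\<lambda>x. x * _"] cong: if_cong)
      then show ?thesis
        using char[of "\<lambda>j. if j = i then t else 0"]
        by (simp add: char_def P_def P'_def integral_distr cis_conv_exp)
    qed
    have "weak_conv_m P P'"
      by (rule levy_continuity[OF rd conv])
    then have "(\<lambda>n. integral\<^sup>L (P n) (\<phi> k)) \<longlonglongrightarrow> integral\<^sup>L P' (\<phi> k)"
      by (intro weak_conv_imp_integral_bdd_continuous_conv[where B=1] rd \<phi>_cont) (auto simp: \<phi>01)
    then show ?thesis by (simp add: P_def P'_def integral_distr)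
  qed
  have \<psi>X: "(\<lambda>n. LINT w|M n. \<psi> k (X n w)) \<longlonglongrightarrow> (LINT w|M'. \<psi> k (Y w))" for k
    using tendsto_sum[OF marginal[of _ k], of I] by (simp add: \<psi>_def int\<phi>X int\<phi>Y)
  show ?thesis
  proof (rule tendstoI)
    fix e :: real assume e: "0 < e"
    \<comment> \<open>The budget: a truncation error 2 * B * \<delta> + \<delta> for each of the two
      laws and one further \<delta> for the polynomial. The fourth \<delta> leaves room and keeps
      the denominator positive when B = 0.\<close>
    define \<delta> where "\<delta> = e / (4 * B + 4)"
    have \<delta>: "0 < \<delta>" using e B by (simp add: \<delta>_def)
    from order_tendstoD(2)[OF Y0 \<delta>] obtain k where k: "(LINT w|M'. \<psi> k (Y w)) < \<delta>"
      by (auto simp: eventually_sequentially)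
    \<comment> \<open>Chosen so that c * pi / 2 = k + 1: the folding map is then the identity on
      [-(k + 1), k + 1].\<close>
    define c where "c = 2 * (real k + 1) / pi"
    have c: "0 < c" by (simp add: c_def)
    from trig_polys_approximation[OF I F(1) c \<delta>] obtain g where
      g: "(\<lambda>h. complex_of_real (g h)) \<in> trig_polys I" and
      gF: "\<And>h. (\<And>i. i \<notin> I \<Longrightarrow> h i = 0) \<Longrightarrow> \<bar>F (\<lambda>i. c * arcsin (sin (h i / c))) - g h\<bar> < \<delta>"
      by blast
    have bound: "\<bar>F h - g h\<bar> \<le> 2 * B * \<psi> k h + \<delta>" if h: "\<And>i. i \<notin> I \<Longrightarrow> h i = 0" for h
    proof (cases "\<forall>i\<in>I. \<bar>h i\<bar> \<le> real k + 1")
      case True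
      have "c * arcsin (sin (h i / c)) = h i" for i
      proof -
        have "\<bar>h i\<bar> \<le> real k + 1" using True h by (cases "i \<in> I") auto
        then have "\<bar>h i\<bar> / c \<le> (real k + 1) / c"
          using c by (intro divide_right_mono) auto
        also have "\<dots> = pi / 2" by (simp add: c_def divide_simps)
        finally have "\<bar>h i\<bar> / c \<le> pi / 2" .
        then have "\<bar>h i / c\<bar> \<le> pi / 2" using c by (simp add: abs_divide)
        then have "- (pi / 2) \<le> h i / c" "h i / c \<le> pi / 2" by linarith+
        then show ?thesis using c by (simp add: arcsin_sin)
      qed
      then have "\<bar>F h - g h\<bar> < \<delta>" using gF[of h] h by simp
      moreover have "0 \<le> 2 * B * \<psi> k h" using B by (auto simp: \<psi>_def \<phi>01 intro!: mult_nonneg_nonneg sum_nonneg)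
      ultimately show ?thesis by linarith
    next
      case False
      then obtain i where i: "i \<in> I" "\<bar>h i\<bar> > real k + 1" by auto
      \<comment> \<open>Outside the box, \<open>F\<close> at \<open>h\<close> and \<open>F\<close>
        at the folded point differ by at most 2 * B, and \<open>\<psi> k h\<close> is at least
        1.\<close>
      have "1 = \<phi> k (h i)" using i by (simp add: \<phi>_def)
      also have "\<dots> \<le> \<psi> k h" unfolding \<psi>_def using i I by (intro member_le_sum) (auto simp: \<phi>01)
      finally have "2 * B * 1 \<le> 2 * B * \<psi> k h" using B by (intro mult_left_mono) auto
      moreover have "\<bar>F (\<lambda>i. c * arcsin (sin (h i / c))) - g h\<bar> < \<delta>" using gF[of h] h by blast
      ultimately show ?thesis
        using F(2)[of h] F(2)[of "\<lambda>i. c * arcsin (sin (h i / c))"] by linarith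
    qed
    note tp = trig_polys_expectation_tendsto[OF prob X Y char g]
    have gint: "integrable (M n) (\<lambda>w. g (X n w))" "integrable M' (\<lambda>w. g (Y w))" for n
      using tp by (auto simp: complex_of_real_integrable_eq)
    have glim: "(\<lambda>n. LINT w|M n. g (X n w)) \<longlonglongrightarrow> (LINT w|M'. g (Y w))"
      using tp by (simp add: tendsto_of_real_iff)
    have FX: "integrable (M n) (\<lambda>w. F (X n w))" for n
      by (rule M.integrable_const_bound[where B=B]) (auto simp: F)
    have FY: "integrable M' (\<lambda>w. F (Y w))"
      by (rule M'.integrable_const_bound[where B=B]) (auto simp: F)
    have \<psi>int: "integrable (M n) (\<lambda>w. \<psi> k (X n w))" "integrable M' (\<lambda>w. \<psi> k (Y w))" for n
      unfolding \<psi>_def by (auto intro!: Bochner_Integration.integrable_sum int\<phi>X int\<phi>Y)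
    have bX: "\<bar>(LINT w|M n. F (X n w)) - (LINT w|M n. g (X n w))\<bar> \<le> 2 * B * (LINT w|M n. \<psi> k (X n w)) + \<delta>" for n
      by (intro M.expectation_diff_bound FX gint \<psi>int bound zero)
    have bY: "\<bar>(LINT w|M'. F (Y w)) - (LINT w|M'. g (Y w))\<bar> \<le> 2 * B * (LINT w|M'. \<psi> k (Y w)) + \<delta>"
      by (intro M'.expectation_diff_bound FY gint \<psi>int bound zero)
    have "eventually (\<lambda>n. (LINT w|M n. \<psi> k (X n w)) < \<delta>) sequentially"
      by (rule order_tendstoD(2)[OF \<psi>X k])
    moreover have "eventually (\<lambda>n. dist (LINT w|M n. g (X n w)) (LINT w|M'. g (Y w)) < \<delta>) sequentially"
      by (rule tendstoD[OF glim \<delta>])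
    ultimately show "eventually (\<lambda>n. dist (LINT w|M n. F (X n w)) (LINT w|M'. F (Y w)) < e) sequentially"
    proof eventually_elim
      case (elim n)
      have "2 * B * (LINT w|M n. \<psi> k (X n w)) \<le> 2 * B * \<delta>" "2 * B * (LINT w|M'. \<psi> k (Y w)) \<le> 2 * B * \<delta>"
        using elim k B by (auto intro!: mult_left_mono)
      moreover have "(4 * B + 4) * \<delta> = e" using B by (simp add: \<delta>_def)
      then have "4 * B * \<delta> + 4 * \<delta> = e" by (simp add: algebra_simps)
      ultimately show ?case
        using elim bX[of n] bY \<delta> by (simp add: dist_real_def)
    qed
  qed
qed

section \<open>Selection laws\<close>

text \<open>The common finite support turns integrals against these laws into finite sums over a
  fixed set, so that pointwise convergence passes through \<open>bind_pmf\<close>. A general filter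
  is allowed because continuity is later expressed with \<open>at H within UNIV\<close>.\<close>

definition pmf_tendsto :: "('i \<Rightarrow> 'a pmf) \<Rightarrow> 'a pmf \<Rightarrow> 'i filter \<Rightarrow> bool" where
  "pmf_tendsto p p' F \<longleftrightarrow> (\<forall>x. ((\<lambda>i. pmf (p i) x) \<longlongrightarrow> pmf p' x) F) \<and>
     (\<exists>S. finite S \<and> set_pmf p' \<subseteq> S \<and> (\<forall>i. set_pmf (p i) \<subseteq> S))"

lemma pmf_tendsto_const: "finite (set_pmf p) \<Longrightarrow> pmf_tendsto (\<lambda>_. p) p F"
  by (auto simp: pmf_tendsto_def)

text \<open>On the common support the mass function of the composition is a finite sum of products;
  the supports of the second stage are united over that finite set.\<close>

lemma pmf_tendsto_bind:
  assumes p: "pmf_tendsto p p' F" and f: "\<And>x. pmf_tendsto (\<lambda>i. f i x) (f' x) F"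
  shows "pmf_tendsto (\<lambda>i. bind_pmf (p i) (f i)) (bind_pmf p' f') F"
proof -
  from p obtain S where S: "finite S" "set_pmf p' \<subseteq> S" "\<And>i. set_pmf (p i) \<subseteq> S"
    by (auto simp: pmf_tendsto_def)
  from f have "\<forall>x. \<exists>R. finite R \<and> set_pmf (f' x) \<subseteq> R \<and> (\<forall>i. set_pmf (f i x) \<subseteq> R)"
    by (auto simp: pmf_tendsto_def)
  then obtain R where R: "\<And>x. finite (R x)" "\<And>x. set_pmf (f' x) \<subseteq> R x" "\<And>x i. set_pmf (f i x) \<subseteq> R x"
    by metis
  have eq: "pmf (bind_pmf q g) y = (\<Sum>x\<in>S. pmf (g x) y * pmf q x)" if "set_pmf q \<subseteq> S"
    for q and g :: "'b \<Rightarrow> 'c pmf" and y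
    unfolding pmf_bind using S(1) that by (subst integral_measure_pmf_real[of S]) auto
  have "((\<lambda>i. pmf (bind_pmf (p i) (f i)) y) \<longlongrightarrow> pmf (bind_pmf p' f') y) F" for y
    using p f S by (simp add: eq) (auto simp: pmf_tendsto_def intro!: tendsto_intros)
  moreover have "finite (\<Union>x\<in>S. R x)" using S R by auto
  moreover have "set_pmf (bind_pmf p' f') \<subseteq> (\<Union>x\<in>S. R x)" using S(2) R(2) by fastforce
  moreover have "set_pmf (bind_pmf (p i) (f i)) \<subseteq> (\<Union>x\<in>S. R x)" for i using S(3) R(3) by fastforce
  ultimately show ?thesis unfolding pmf_tendsto_def by blast
qed

lemma pmf_tendsto_map: "pmf_tendsto p p' F \<Longrightarrow> pmf_tendsto (\<lambda>i. map_pmf g (p i)) (map_pmf g p') F"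
  unfolding map_pmf_def by (intro pmf_tendsto_bind pmf_tendsto_const) auto

lemma pmf_tendsto_Pi_pmf:
  assumes I: "finite I" and p: "\<And>n. n \<in> I \<Longrightarrow> pmf_tendsto (\<lambda>i. p i n) (p' n) F"
  shows "pmf_tendsto (\<lambda>i. Pi_pmf I d (p i)) (Pi_pmf I d p') F"
proof -
  from p have "\<forall>x\<in>I. \<exists>R. finite R \<and> set_pmf (p' x) \<subseteq> R \<and> (\<forall>i. set_pmf (p i x) \<subseteq> R)"
    by (auto simp: pmf_tendsto_def)
  then obtain R where R: "\<And>x. x \<in> I \<Longrightarrow> finite (R x)" "\<And>x. x \<in> I \<Longrightarrow> set_pmf (p' x) \<subseteq> R x"
      "\<And>x i. x \<in> I \<Longrightarrow> set_pmf (p i x) \<subseteq> R x"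
    by metis
  have "finite (PiE_dflt I d R)" using I R by (intro finite_PiE_dflt) auto
  moreover have "set_pmf (Pi_pmf I d q) \<subseteq> PiE_dflt I d R" if "\<And>x. x \<in> I \<Longrightarrow> set_pmf (q x) \<subseteq> R x" for q
    using I that by (auto simp: set_Pi_pmf PiE_dflt_def)
  moreover have "((\<lambda>i. pmf (Pi_pmf I d (p i)) f) \<longlongrightarrow> pmf (Pi_pmf I d p') f) F" for f
  proof (cases "\<forall>x. x \<notin> I \<longrightarrow> f x = d")
    case True
    with I have "pmf (Pi_pmf I d q) f = (\<Prod>x\<in>I. pmf (q x) (f x))" for q by (simp add: pmf_Pi)
    moreover have "((\<lambda>i. pmf (p i x) y) \<longlongrightarrow> pmf (p' x) y) F" if "x \<in> I" for x y
      using p[OF that] unfolding pmf_tendsto_def by blast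
    ultimately show ?thesis by (simp add: tendsto_prod)
  next
    case False
    then have "pmf (Pi_pmf I d q) f = 0" for q using I by (intro pmf_Pi_outside) auto
    then show ?thesis by simp
  qed
  ultimately show ?thesis
    unfolding pmf_tendsto_def using R(2,3) by (intro conjI allI exI[of _ "PiE_dflt I d R"]) simp_all
qed

lemma pmf_tendsto_measure:
  assumes "pmf_tendsto p p' F"
  shows "((\<lambda>i. measure_pmf.prob (p i) E) \<longlongrightarrow> measure_pmf.prob p' E) F"
proof -
  from assms obtain S where S: "finite S" "set_pmf p' \<subseteq> S" "\<And>i. set_pmf (p i) \<subseteq> S"
    by (auto simp: pmf_tendsto_def)
  have eq: "measure_pmf.prob q E = (\<Sum>x\<in>S \<inter> E. pmf q x)" if "set_pmf q \<subseteq> S" for q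
  proof -
    have "measure_pmf.prob q E = measure_pmf.prob q (S \<inter> E)"
      by (rule measure_prob_cong_0) (use that in \<open>auto simp: set_pmf_iff\<close>)
    then show ?thesis using S(1) by (simp add: measure_measure_pmf_finite)
  qed
  show ?thesis using assms S by (simp add: eq) (auto simp: pmf_tendsto_def intro!: tendsto_sum)
qed

text \<open>The condition under which normalising yields a mass function, so that
  \<open>embed_pmf\<close> in \<open>categorical\<close> has its intended meaning.\<close>

definition weights :: "nat \<Rightarrow> (nat \<Rightarrow> real) \<Rightarrow> bool" where
  "weights N w \<longleftrightarrow> (\<forall>l\<le>N. 0 \<le> w l) \<and> 0 < (\<Sum>l\<le>N. w l)"

lemma weights_pos: "(\<And>l. 0 < w l) \<Longrightarrow> weights N w"
  by (auto simp: weights_def less_imp_le intro!: sum_pos)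

lemma pmf_categorical:
  assumes "weights N w"
  shows "pmf (categorical N w) l = (if l \<le> N then w l / (\<Sum>j\<le>N. w j) else 0)"
  unfolding categorical_def
proof (rule pmf_embed_pmf)
  show "0 \<le> (if l \<le> N then w l / (\<Sum>j\<le>N. w j) else 0)" for l
    using assms by (auto simp: weights_def intro!: divide_nonneg_pos)
  have "(\<integral>\<^sup>+ x. ennreal (if x \<le> N then w x / (\<Sum>j\<le>N. w j) else 0) \<partial>count_space UNIV)
      = (\<Sum>x\<le>N. ennreal (w x / (\<Sum>j\<le>N. w j)))"
    by (subst nn_integral_count_space'[of "{..N}"]) auto
  also have "\<dots> = ennreal (\<Sum>x\<le>N. w x / (\<Sum>j\<le>N. w j))"
    using assms by (intro sum_ennreal) (auto simp: weights_def intro!: divide_nonneg_pos)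
  also have "\<dots> = 1" using assms by (simp add: sum_divide_distrib[symmetric] weights_def)
  finally show "(\<integral>\<^sup>+ x. ennreal (if x \<le> N then w x / (\<Sum>j\<le>N. w j) else 0) \<partial>count_space UNIV) = 1" .
qed

lemma set_categorical: "weights N w \<Longrightarrow> set_pmf (categorical N w) \<subseteq> {..N}"
  by (auto simp: set_pmf_iff pmf_categorical split: if_splits)

lemma pmf_tendsto_categorical:
  assumes "\<And>i. weights N (w i)" "weights N w'" "\<And>l. l \<le> N \<Longrightarrow> ((\<lambda>i. w i l) \<longlongrightarrow> w' l) F"
  shows "pmf_tendsto (\<lambda>i. categorical N (w i)) (categorical N w') F"
  unfolding pmf_tendsto_def
proof (intro conjI allI exI[of _ "{..N}"])
  show "((\<lambda>i. pmf (categorical N (w i)) x) \<longlongrightarrow> pmf (categorical N w') x) F" for x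
    using assms by (auto simp: pmf_categorical weights_def intro!: tendsto_intros)
qed (use assms set_categorical in auto)

text \<open>The factor cancels in the normalisation. This allows weights to be compared up to any
  constant that is independent of the candidate index.\<close>

lemma categorical_scale:
  assumes "c \<noteq> 0" "\<And>l. l \<le> N \<Longrightarrow> w' l = c * w l"
  shows "categorical N w' = categorical N w"
proof -
  have "(\<Sum>j\<le>N. w' j) = c * (\<Sum>j\<le>N. w j)" using assms by (simp add: sum_distrib_left)
  then have "(\<lambda>l. if l \<le> N then w' l / (\<Sum>j\<le>N. w' j) else 0) = (\<lambda>l. if l \<le> N then w l / (\<Sum>j\<le>N. w j) else 0)"
    using assms by auto
  then show ?thesis unfolding categorical_def by simp
qed

lemma sum_atMost_split0: "(\<Sum>l\<le>N. f l) = f 0 + (\<Sum>l=1..N. f (l::nat))" for f :: "nat \<Rightarrow> 'a::comm_monoid_add"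
proof -
  have "{..N} = insert 0 {1..N}" by auto
  then show ?thesis by simp
qed

section \<open>Positivity and continuity of the selection functions\<close>

lemma select_Phi_denominator_pos:
  fixes h :: "nat \<Rightarrow> real"
  assumes "n \<in> {1..N}"
  shows "0 < 1 - min 1 (exp (h n)) + (\<Sum>j=1..N. exp (h j))"
proof -
  have "0 < (\<Sum>j=1..N. exp (h j))"
    using assms by (intro sum_pos) auto
  then show ?thesis using min.cobounded1[of 1 "exp (h n)"] by linarith
qed

lemma weights_select_Psi: "weights N (select_Psi N h)"
proof (rule weights_pos)
  have "0 < 1 + (\<Sum>j=1..N. exp (h j))" by (intro add_pos_nonneg sum_nonneg) auto
  then show "0 < select_Psi N h l" for l by (simp add: select_Psi_def)
qed

text \<open>The total mass is 1 by the choice of the mass at 0, so only the sign of that mass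
  matters. Each denominator is at least the sum of all exponentials, hence the masses at 1, ..., N
  are dominated by those of a normalised exponential law on {1..N}.\<close>

lemma weights_select_Phi: "weights N (select_Phi N h)"
proof -
  define phi where "phi = (\<lambda>n. exp (h n) / (1 - min 1 (exp (h n)) + (\<Sum>j=1..N. exp (h j))))"
  have sel: "select_Phi N h n = (if n = 0 then 1 - (\<Sum>j=1..N. phi j) else phi n)" for n
    by (simp add: select_Phi_def phi_def)
  have "0 \<le> phi n" if "n \<in> {1..N}" for n
    using select_Phi_denominator_pos[OF that, of h] by (simp add: phi_def)
  moreover have "(\<Sum>j=1..N. phi j) \<le> 1"
  proof (cases "N = 0")
    case False
    let ?s = "\<Sum>j=1..N. exp (h j)"
    have s: "0 < ?s" using False by (intro sum_pos) auto
    have "(\<Sum>j=1..N. phi j) \<le> (\<Sum>j=1..N. exp (h j) / ?s)"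
      unfolding phi_def using s by (intro sum_mono divide_left_mono) (auto intro!: mult_pos_pos add_nonneg_pos)
    also have "\<dots> = 1" using s by (simp add: sum_divide_distrib[symmetric])
    finally show ?thesis .
  qed auto
  moreover have "(\<Sum>l\<le>N. select_Phi N h l) = 1" by (simp add: sum_atMost_split0 sel)
  ultimately show ?thesis unfolding weights_def by (auto simp: sel)
qed

lemma weights_select_final: "weights N (select_final forced N h)"
  by (simp add: select_final_def weights_select_Phi weights_select_Psi)

lemma select_final_tendsto:
  assumes h: "\<And>n. ((\<lambda>i. h i n) \<longlongrightarrow> h' n) F" and n: "n \<le> N"
  shows "((\<lambda>i. select_final forced N (h i) n) \<longlongrightarrow> select_final forced N h' n) F"
proof -
  have "1 + (\<Sum>j=1..N. exp (h' j)) \<noteq> 0"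
    by (rule less_imp_neq[symmetric]) (intro add_pos_nonneg sum_nonneg, auto)
  then have "((\<lambda>i. select_Psi N (h i) n) \<longlongrightarrow> select_Psi N h' n) F"
    unfolding select_Psi_def using h by (cases "n = 0") (auto intro!: tendsto_intros)
  moreover have "((\<lambda>i. select_Phi N (h i) n) \<longlongrightarrow> select_Phi N h' n) F"
  proof -
    have phi: "((\<lambda>i. exp (h i n) / (1 - min 1 (exp (h i n)) + (\<Sum>j=1..N. exp (h i j)))) \<longlongrightarrow>
        exp (h' n) / (1 - min 1 (exp (h' n)) + (\<Sum>j=1..N. exp (h' j)))) F" if "n \<in> {1..N}" for n
      using select_Phi_denominator_pos[OF that, of h'] by (intro tendsto_intros tendsto_min h) simp
    show ?thesis
    proof (cases "n = 0")
      case True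
      have "((\<lambda>i. 1 - (\<Sum>n=1..N. exp (h i n) / (1 - min 1 (exp (h i n)) + (\<Sum>j=1..N. exp (h i j))))) \<longlongrightarrow>
          1 - (\<Sum>n=1..N. exp (h' n) / (1 - min 1 (exp (h' n)) + (\<Sum>j=1..N. exp (h' j))))) F"
        by (intro tendsto_diff tendsto_const tendsto_sum phi)
      then show ?thesis by (simp add: select_Phi_def True)
    next
      case False
      with n have "n \<in> {1..N}" by auto
      from phi[OF this] show ?thesis using False by (simp add: select_Phi_def)
    qed
  qed
  ultimately show ?thesis by (simp add: select_final_def)
qed

lemma select_final_cong: "(\<And>n. n \<in> {1..N} \<Longrightarrow> h n = h' n) \<Longrightarrow> n \<le> N \<Longrightarrow> select_final forced N h n = select_final forced N h' n"
  unfolding select_final_def select_Psi_def select_Phi_def Let_def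
  by (auto intro!: arg_cong2[of _ _ _ _ "(/)"] sum.cong)

text \<open>The 1 in the denominator of \<open>select_Psi\<close> is \<open>exp (h 0)\<close>. The
  forced-move function has no such form, which is why final selection is always compared through log
  differences.\<close>

lemma categorical_select_Psi: "h 0 = 0 \<Longrightarrow> categorical N (select_Psi N h) = categorical N (\<lambda>n. exp (h n))"
proof -
  assume h: "h 0 = 0"
  have "0 < 1 + (\<Sum>j=1..N. exp (h j))" by (intro add_pos_nonneg sum_nonneg) auto
  then show ?thesis
    by (intro categorical_scale[of "1 / (1 + (\<Sum>j=1..N. exp (h j)))"]) (auto simp: select_Psi_def h)
qed

text \<open>The arrays that can actually be drawn. The condition ranges over all times because the
  recursion starts from the zero array, so undrawn entries are 0.\<close>

definition ancestors :: "nat \<Rightarrow> (nat \<Rightarrow> nat \<Rightarrow> nat) set" where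
  "ancestors N = {A. \<forall>t. A t 0 = 0 \<and> (\<forall>n. A t n \<le> N)}"

lemma set_ancestor_law:
  assumes "\<And>t A. weights N (p t A)"
  shows "set_pmf (ancestor_law N p t) \<subseteq> ancestors N"
proof (induction t)
  case (Suc t)
  have "a 0 = 0 \<and> a n \<le> N" if "a \<in> set_pmf (Pi_pmf {1..N} 0 (\<lambda>n. categorical N (p (Suc t) A)))" for a n A
    using that set_categorical[OF assms[of "Suc t" A]]
    by (cases "n \<in> {1..N}") (auto simp: set_Pi_pmf PiE_dflt_def)
  with Suc show ?case by (auto simp: ancestors_def)
qed (auto simp: ancestors_def)

lemma set_lineage_law:
  assumes "weights N (q A)" "\<And>t k'. weights N (b t A k')" "A \<in> ancestors N"
  shows "set_pmf (lineage_law T N backward q b A j) \<subseteq> {K. \<forall>t. K t \<le> N}"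
proof (induction j)
  case 0
  show ?case using set_categorical[OF assms(1)] by auto
next
  case (Suc j)
  have "k \<le> N" if "k \<in> set_pmf (if backward then categorical N (b (T - Suc j) A (K (T - j)))
      else return_pmf (A (T - Suc j) (K (T - j))))" for k K
    using that set_categorical[OF assms(2)] assms(3) by (cases backward) (auto simp: ancestors_def)
  note k = this
  show ?case
  proof
    fix L assume "L \<in> set_pmf (lineage_law T N backward q b A (Suc j))"
    then obtain K k where "K \<in> set_pmf (lineage_law T N backward q b A j)" "L = K(T - Suc j := k)"
      "k \<in> set_pmf (if backward then categorical N (b (T - Suc j) A (K (T - j)))
        else return_pmf (A (T - Suc j) (K (T - j))))"
      by (auto simp only: lineage_law.simps set_bind_pmf set_map_pmf)
    with k Suc show "L \<in> {K. \<forall>t. K t \<le> N}" by auto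
  qed
qed

lemma set_selection_law:
  assumes "\<And>t A. weights N (p t A)" "\<And>A. weights N (q A)" "\<And>t A k'. weights N (b t A k')"
  shows "set_pmf (selection_law T N backward p q b) \<subseteq> {K. \<forall>t. K t \<le> N}"
proof -
  have "set_pmf (lineage_law T N backward q b A (T - 1)) \<subseteq> {K. \<forall>t. K t \<le> N}"
    if "A \<in> set_pmf (ancestor_law N p (T - 1))" for A
    using that set_ancestor_law[of N p "T - 1", OF assms(1)] by (intro set_lineage_law assms) auto
  then show ?thesis unfolding selection_law_def set_bind_pmf by (rule UN_least)
qed

section \<open>Congruence and continuity of selection laws\<close>

lemma ancestor_law_cong:
  assumes "\<And>t A. weights N (p t A)"
    and "\<And>t A. t \<in> {1..s} \<Longrightarrow> A \<in> ancestors N \<Longrightarrow> categorical N (p t A) = categorical N (p' t A)"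
  shows "ancestor_law N p s = ancestor_law N p' s"
  using assms(2)
proof (induction s)
  case (Suc s)
  then have "ancestor_law N p s = ancestor_law N p' s" by auto
  then show ?case
    using Suc.prems set_ancestor_law[of N p s, OF assms(1)] by (auto intro!: bind_pmf_cong)
qed simp

lemma lineage_law_cong:
  assumes w: "weights N (q A)" "\<And>t k'. weights N (b t A k')" "A \<in> ancestors N"
    and q: "categorical N (q A) = categorical N (q' A)"
    and b: "\<And>t k'. t \<in> {1..T - 1} \<Longrightarrow> k' \<le> N \<Longrightarrow> categorical N (b t A k') = categorical N (b' t A k')"
    and j: "j \<le> T - 1"
  shows "lineage_law T N backward q b A j = lineage_law T N backward q' b' A j"
  using j
proof (induction j)
  case 0
  then show ?case using q by simp
next
  case (Suc j)
  then have IH: "lineage_law T N backward q b A j = lineage_law T N backward q' b' A j"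
    and t: "T - Suc j \<in> {1..T - 1}" by auto
  have "categorical N (b (T - Suc j) A (K (T - j))) = categorical N (b' (T - Suc j) A (K (T - j)))"
    if "K \<in> set_pmf (lineage_law T N backward q' b' A j)" for K
    using that set_lineage_law[of N q A b T backward j, OF w] IH by (intro b t) auto
  then show ?case unfolding lineage_law.simps IH by (intro bind_pmf_cong refl) (simp only:)
qed

text \<open>Agreement is demanded only at the times drawn and on admissible ancestor arrays:
  log-ratios agree with log-weight differences only for indices up to N and times in {1..T}.\<close>

lemma selection_law_cong:
  assumes "\<And>t A. weights N (p t A)" "\<And>A. weights N (q A)" "\<And>t A k'. weights N (b t A k')"
    and "\<And>t A. t \<in> {1..T - 1} \<Longrightarrow> A \<in> ancestors N \<Longrightarrow> categorical N (p t A) = categorical N (p' t A)"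
    and "\<And>A. A \<in> ancestors N \<Longrightarrow> categorical N (q A) = categorical N (q' A)"
    and "\<And>t A k'. t \<in> {1..T - 1} \<Longrightarrow> A \<in> ancestors N \<Longrightarrow> k' \<le> N \<Longrightarrow>
      categorical N (b t A k') = categorical N (b' t A k')"
  shows "selection_law T N backward p q b = selection_law T N backward p' q' b'"
  unfolding selection_law_def
proof (rule bind_pmf_cong)
  show "ancestor_law N p (T - 1) = ancestor_law N p' (T - 1)"
    using assms by (intro ancestor_law_cong) auto
  fix A assume "A \<in> set_pmf (ancestor_law N p' (T - 1))"
  then have "A \<in> ancestors N"
    using set_ancestor_law[of N p "T - 1", OF assms(1)] \<open>ancestor_law N p (T - 1) = _\<close> by auto
  then show "lineage_law T N backward q b A (T - 1) = lineage_law T N backward q' b' A (T - 1)"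
    using assms by (intro lineage_law_cong) auto
qed

lemma ancestor_law_tendsto:
  assumes "\<And>i t A. weights N (p i t A)" "\<And>t A. weights N (p' t A)"
    and "\<And>t A l. l \<le> N \<Longrightarrow> ((\<lambda>i. p i t A l) \<longlongrightarrow> p' t A l) F"
  shows "pmf_tendsto (\<lambda>i. ancestor_law N (p i) t) (ancestor_law N p' t) F"
  by (induction t)
     (auto intro!: pmf_tendsto_const pmf_tendsto_bind pmf_tendsto_map pmf_tendsto_Pi_pmf
        pmf_tendsto_categorical assms)

lemma lineage_law_tendsto:
  assumes "\<And>i. weights N (q i A)" "weights N (q' A)"
    "\<And>i t k'. weights N (b i t A k')" "\<And>t k'. weights N (b' t A k')"
    and "\<And>k. k \<le> N \<Longrightarrow> ((\<lambda>i. q i A k) \<longlongrightarrow> q' A k) F"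
    and "\<And>t k k'. k \<le> N \<Longrightarrow> ((\<lambda>i. b i t A k' k) \<longlongrightarrow> b' t A k' k) F"
  shows "pmf_tendsto (\<lambda>i. lineage_law T N backward (q i) (b i) A j) (lineage_law T N backward q' b' A j) F"
  by (induction j)
     (auto intro!: pmf_tendsto_const pmf_tendsto_bind pmf_tendsto_map pmf_tendsto_categorical assms)

lemma selection_law_tendsto:
  assumes "\<And>i t A. weights N (p i t A)" "\<And>t A. weights N (p' t A)"
    "\<And>i A. weights N (q i A)" "\<And>A. weights N (q' A)"
    "\<And>i t A k'. weights N (b i t A k')" "\<And>t A k'. weights N (b' t A k')"
    and "\<And>t A l. l \<le> N \<Longrightarrow> ((\<lambda>i. p i t A l) \<longlongrightarrow> p' t A l) F"
    and "\<And>A k. k \<le> N \<Longrightarrow> ((\<lambda>i. q i A k) \<longlongrightarrow> q' A k) F"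
    and "\<And>t A k k'. k \<le> N \<Longrightarrow> ((\<lambda>i. b i t A k' k) \<longlongrightarrow> b' t A k' k) F"
  shows "pmf_tendsto (\<lambda>i. selection_law T N backward (p i) (q i) (b i)) (selection_law T N backward p' q' b') F"
  unfolding selection_law_def
  by (intro pmf_tendsto_bind ancestor_law_tendsto lineage_law_tendsto assms)

text \<open>\<open>H (t, a, l)\<close> is the log-weight at time \<open>t\<close> of particle \<open>l\<close> with ancestor \<open>a\<close>, relative to the pair
  \<open>(0, 0)\<close>. The backward weights involve \<open>m\<^sub>t\<^sub>+\<^sub>1\<close> but not \<open>G\<^sub>t\<^sub>+\<^sub>1\<close>; subtracting the value at \<open>k = 0\<close> cancels
  \<open>G\<^sub>t\<^sub>+\<^sub>1\<close>.\<close>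

definition log_weight_selection ::
  "nat \<Rightarrow> nat \<Rightarrow> bool \<Rightarrow> bool \<Rightarrow> (nat \<times> nat \<times> nat \<Rightarrow> real) \<Rightarrow> (nat \<Rightarrow> nat) pmf" where
  "log_weight_selection T N backward forced H = selection_law T N backward
     (\<lambda>t A l. exp (H (t, A (t - 1) l, l)))
     (\<lambda>A. select_final forced N (\<lambda>n. H (T, A (T - 1) n, n)))
     (\<lambda>t A k' k. exp (H (t, A (t - 1) k, k) + H (t + 1, k, k') - H (t + 1, 0, k')))"

lemma set_log_weight_selection:
  "set_pmf (log_weight_selection T N backward forced H) \<subseteq> {K. \<forall>t. K t \<le> N}"
  unfolding log_weight_selection_def
  by (intro set_selection_law weights_pos weights_select_final) auto

definition selection_prob ::
  "nat \<Rightarrow> nat \<Rightarrow> bool \<Rightarrow> bool \<Rightarrow> nat \<Rightarrow> nat \<Rightarrow> (nat \<times> nat \<times> nat \<Rightarrow> real) \<Rightarrow> real" where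
  "selection_prob T N backward forced s k H =
     measure_pmf.prob (log_weight_selection T N backward forced H) {K. K s = k}"

text \<open>Continuity is with respect to the product topology on functions of all triples. Every
  weight is built from finitely many coordinates by continuous operations, and the draws preserve
  \<open>pmf_tendsto\<close>.\<close>

lemma continuous_on_selection_prob:
  "continuous_on UNIV (selection_prob T N backward forced s k)"
  unfolding continuous_on_def
proof (intro ballI)
  fix H :: "nat \<times> nat \<times> nat \<Rightarrow> real"
  have *: "((\<lambda>H. H i) \<longlongrightarrow> H i) (at H within UNIV)" for i
  proof -
    have "continuous_on UNIV (\<lambda>H :: nat \<times> nat \<times> nat \<Rightarrow> real. H i)" by simp
    then show ?thesis by (simp add: continuous_on_def)
  qed
  show "(selection_prob T N backward forced s k \<longlongrightarrow> selection_prob T N backward forced s k H) (at H within UNIV)"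
    unfolding selection_prob_def log_weight_selection_def
    by (intro pmf_tendsto_measure selection_law_tendsto weights_pos weights_select_final
        select_final_tendsto tendsto_intros *) auto
qed

text \<open>Separates the random index from the rest: only the marginal at time \<open>s\<close>
  matters, and the expectation becomes a finite sum whose coefficients are continuous in
  \<open>H\<close>.\<close>

lemma expectation_selection:
  fixes f :: "nat \<Rightarrow> real"
  shows "measure_pmf.expectation (log_weight_selection T N backward forced H) (\<lambda>K. f (K s))
    = (\<Sum>k\<le>N. selection_prob T N backward forced s k H * f k)"
proof -
  let ?p = "log_weight_selection T N backward forced H"
  have "measure_pmf.expectation ?p (\<lambda>K. f (K s)) = measure_pmf.expectation (map_pmf (\<lambda>K. K s) ?p) f"
    by simp
  also have "\<dots> = (\<Sum>k\<le>N. f k * pmf (map_pmf (\<lambda>K. K s) ?p) k)"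
    using set_log_weight_selection[of T N backward forced H]
    by (intro integral_measure_pmf_real) auto
  also have "\<dots> = (\<Sum>k\<le>N. selection_prob T N backward forced s k H * f k)"
    by (simp add: pmf_map selection_prob_def vimage_def mult.commute)
  finally show ?thesis .
qed

lemma prob_selection_nonzero:
  "measure_pmf.prob (log_weight_selection T N backward forced H) {K. K s \<noteq> 0}
    = (\<Sum>k=1..N. selection_prob T N backward forced s k H)"
proof -
  have "measure_pmf.prob (log_weight_selection T N backward forced H) {K. K s \<noteq> 0}
      = measure_pmf.expectation (log_weight_selection T N backward forced H) (\<lambda>K. if K s = 0 then 0 else 1)"
  proof -
    have "(\<lambda>K. if K s = 0 then 0 else 1) = (indicator {K. K s \<noteq> 0} :: (nat \<Rightarrow> nat) \<Rightarrow> real)"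
      by (auto simp: indicator_def)
    then show ?thesis by simp
  qed
  also have "\<dots> = (\<Sum>k\<le>N. selection_prob T N backward forced s k H * (if k = 0 then 0 else 1))"
    by (rule expectation_selection)
  finally show ?thesis by (simp add: sum_atMost_split0)
qed

section \<open>Gaussian vectors\<close>

lemma borel_measurable_cis [measurable]: "cis \<in> borel_measurable borel"
  by (rule borel_measurable_continuous_onI) (intro continuous_intros)

lemma cis_sum: "finite I \<Longrightarrow> cis (\<Sum>i\<in>I. f i) = (\<Prod>i\<in>I. cis (f i))"
  by (induction I rule: finite_induct) (auto simp: cis_mult[symmetric])

lemma prob_space_std_normal: "prob_space std_normal_distribution"
  by (intro prob_space_normal_density) simp

lemma integral_cis_std_normal:
  "(LINT x|std_normal_distribution. cis (c * x)) = of_real (exp (- c\<^sup>2 / 2))"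
  using char_std_normal_distribution by (simp add: char_def cis_conv_exp fun_eq_iff)

lemma measurable_affine_PiM:
  assumes "finite I"
  shows "(\<lambda>\<xi>. \<lambda>i\<in>I. \<mu> i + (\<Sum>k\<in>I. A i k * \<xi> k))
    \<in> (\<Pi>\<^sub>M k\<in>I. std_normal_distribution) \<rightarrow>\<^sub>M (\<Pi>\<^sub>M i\<in>I. borel)"
proof (rule measurable_restrict)
  fix i assume "i \<in> I"
  have [measurable]: "(\<lambda>\<xi>. \<xi> k) \<in> borel_measurable (\<Pi>\<^sub>M k\<in>I. std_normal_distribution)" if "k \<in> I" for k
    using measurable_component_singleton[OF that, of "\<lambda>_. std_normal_distribution"]
    by (simp cong: measurable_cong_sets)
  show "(\<lambda>\<xi>. \<mu> i + (\<Sum>k\<in>I. A i k * \<xi> k)) \<in> borel_measurable (\<Pi>\<^sub>M k\<in>I. std_normal_distribution)"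
    by measurable
qed

lemma sets_gaussian_law [measurable_cong, simp]: "sets (gaussian_law I \<mu> C) = sets (\<Pi>\<^sub>M i\<in>I. borel)"
  by (simp add: gaussian_law_def Let_def)

lemma prob_space_gaussian_law:
  assumes "finite I"
  shows "prob_space (gaussian_law I \<mu> C)"
  unfolding gaussian_law_def Let_def
  by (intro prob_space.prob_space_distr prob_space_PiM prob_space_std_normal measurable_affine_PiM assms)

text \<open>The matrix picked by \<open>SOME\<close> enters only through its product with its
  transpose, so the value depends on \<open>C\<close> alone. The existence hypothesis guarantees
  that the picked matrix is a root of \<open>C\<close>.\<close>

lemma integral_cis_gaussian_law:
  assumes I: "finite I"
    and ex: "\<exists>A. \<forall>i\<in>I. \<forall>j\<in>I. (\<Sum>k\<in>I. A i k * A j k) = C i j"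
  shows "(LINT g|gaussian_law I \<mu> C. cis (\<Sum>i\<in>I. \<theta> i * g i))
    = cis (\<Sum>i\<in>I. \<theta> i * \<mu> i) * of_real (exp (- (\<Sum>i\<in>I. \<Sum>j\<in>I. \<theta> i * \<theta> j * C i j) / 2))"
proof -
  define A where "A = (SOME A. \<forall>i\<in>I. \<forall>j\<in>I. (\<Sum>k\<in>I. A i k * A j k) = C i j)"
  have A: "(\<Sum>k\<in>I. A i k * A j k) = C i j" if "i \<in> I" "j \<in> I" for i j
    using someI_ex[OF ex] that unfolding A_def by blast
  \<comment> \<open>The coefficient of the independent normal variable \<open>\<xi> k\<close> after
    exchanging the two sums; the squares of these coefficients add up to the quadratic form of
    \<open>C\<close>.\<close>
  define c where "c k = (\<Sum>i\<in>I. \<theta> i * A i k)" for k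
  interpret normal: prob_space std_normal_distribution by (rule prob_space_std_normal)
  have int: "integrable std_normal_distribution (\<lambda>x. cis (r * x))" for r
    by (rule normal.integrable_const_bound[where B=1]) auto
  interpret prod: product_prob_space "\<lambda>_. std_normal_distribution" I
    by (intro product_prob_spaceI prob_space_std_normal)
  have "(LINT g|gaussian_law I \<mu> C. cis (\<Sum>i\<in>I. \<theta> i * g i))
      = (LINT \<xi>|(\<Pi>\<^sub>M k\<in>I. std_normal_distribution).
          cis (\<Sum>i\<in>I. \<theta> i * (\<lambda>i\<in>I. \<mu> i + (\<Sum>k\<in>I. A i k * \<xi> k)) i))"
    unfolding gaussian_law_def Let_def A_def[symmetric]
    using I by (subst integral_distr[OF measurable_affine_PiM]) auto
  also have "\<dots> = (LINT \<xi>|(\<Pi>\<^sub>M k\<in>I. std_normal_distribution).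
          cis (\<Sum>i\<in>I. \<theta> i * \<mu> i) * (\<Prod>k\<in>I. cis (c k * \<xi> k)))"
  proof (rule Bochner_Integration.integral_cong[OF refl])
    fix \<xi> :: "'a \<Rightarrow> real"
    have "(\<Sum>i\<in>I. \<theta> i * (\<lambda>i\<in>I. \<mu> i + (\<Sum>k\<in>I. A i k * \<xi> k)) i)
        = (\<Sum>i\<in>I. \<theta> i * \<mu> i) + (\<Sum>i\<in>I. \<Sum>k\<in>I. \<theta> i * A i k * \<xi> k)"
      by (simp add: distrib_left sum.distrib sum_distrib_left mult.assoc)
    also have "(\<Sum>i\<in>I. \<Sum>k\<in>I. \<theta> i * A i k * \<xi> k) = (\<Sum>k\<in>I. c k * \<xi> k)"
      by (subst sum.swap) (simp add: c_def sum_distrib_right)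
    finally show "cis (\<Sum>i\<in>I. \<theta> i * (\<lambda>i\<in>I. \<mu> i + (\<Sum>k\<in>I. A i k * \<xi> k)) i)
        = cis (\<Sum>i\<in>I. \<theta> i * \<mu> i) * (\<Prod>k\<in>I. cis (c k * \<xi> k))"
      by (simp add: cis_mult[symmetric] cis_sum I)
  qed
  also have "\<dots> = cis (\<Sum>i\<in>I. \<theta> i * \<mu> i) * (\<Prod>k\<in>I. of_real (exp (- (c k)\<^sup>2 / 2)))"
    using I int by (subst integral_mult_right_zero) (subst prod.product_integral_prod, auto simp: integral_cis_std_normal)
  also have "(\<Prod>k\<in>I. of_real (exp (- (c k)\<^sup>2 / 2))) = of_real (exp (- (\<Sum>k\<in>I. (c k)\<^sup>2) / 2))"
    using I by (simp add: of_real_prod[symmetric] exp_sum[symmetric] sum_negf sum_divide_distrib del: of_real_prod)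
  also have "(\<Sum>k\<in>I. (c k)\<^sup>2) = (\<Sum>i\<in>I. \<Sum>j\<in>I. \<theta> i * \<theta> j * C i j)"
  proof -
    have "(\<Sum>k\<in>I. (c k)\<^sup>2) = (\<Sum>k\<in>I. \<Sum>i\<in>I. \<Sum>j\<in>I. \<theta> i * \<theta> j * (A i k * A j k))"
      unfolding c_def power2_eq_square sum_product by (intro sum.cong refl) (simp only: mult_ac)
    also have "\<dots> = (\<Sum>i\<in>I. \<Sum>k\<in>I. \<Sum>j\<in>I. \<theta> i * \<theta> j * (A i k * A j k))"
      by (rule sum.swap)
    also have "\<dots> = (\<Sum>i\<in>I. \<Sum>j\<in>I. \<Sum>k\<in>I. \<theta> i * \<theta> j * (A i k * A j k))"
      by (rule sum.cong[OF refl]) (rule sum.swap)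
    also have "\<dots> = (\<Sum>i\<in>I. \<Sum>j\<in>I. \<theta> i * \<theta> j * C i j)"
      by (intro sum.cong refl) (simp add: sum_distrib_left[symmetric] A)
    finally show ?thesis .
  qed
  finally show ?thesis .
qed

lemma Sigma_cov_root:
  obtains R where "\<And>i j. i \<in> {1..N} \<Longrightarrow> j \<in> {1..N} \<Longrightarrow> (\<Sum>k=1..N. R i k * R j k) = Sigma_cov i j"
proof (cases "N = 0")
  case False
  \<comment> \<open>The root is sought in the form a * I + b * J with J the all-ones matrix. Its
    square is a^2 * I + (2 * a * b + N * b^2) * J, so a^2 = 1/2 and b must solve 2 * a * b + N * b^2
    = 1/2, that is (N * b + a)^2 = a^2 + N / 2.\<close>
  define a :: real where "a = sqrt (1 / 2)"
  define b where "b = (sqrt (a\<^sup>2 + N / 2) - a) / N"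
  define R where "R i k = a * (if i = k then 1 else 0) + b" for i k :: nat
  have a2: "a * a = 1 / 2" by (simp add: a_def)
  have "b * N + a = sqrt (a\<^sup>2 + N / 2)" using False by (simp add: b_def)
  then have "(b * N + a) * (b * N + a) = a * a + N / 2" by (simp add: power2_eq_square)
  then have "N * (2 * a * b + N * (b * b)) = N * (1 / 2)" by (simp add: algebra_simps)
  then have ab: "2 * a * b + N * (b * b) = 1 / 2" using False by (metis mult_cancel_left of_nat_eq_0_iff)
  show ?thesis
  proof (rule that[of R])
    fix i j assume ij: "i \<in> {1..N}" "j \<in> {1..N}"
    have "(\<Sum>k=1..N. R i k * R j k)
        = (\<Sum>k=1..N. (if i = k then a * a * (if j = k then 1 else 0) else 0)
            + (if i = k then a * b else 0) + (if j = k then a * b else 0) + b * b)"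
      by (intro sum.cong) (auto simp: R_def algebra_simps)
    also have "\<dots> = a * a * (if j = i then 1 else 0) + (2 * a * b + N * (b * b))"
      using ij by (simp add: sum.distrib)
    also have "\<dots> = Sigma_cov i j" by (simp add: ab a2 Sigma_cov_def)
    finally show "(\<Sum>k=1..N. R i k * R j k) = Sigma_cov i j" .
  qed
qed auto

text \<open>The lower triangular Cholesky factor. If the leading entry is 0, the determinant
  condition forces the off-diagonal entry to be 0.\<close>

lemma psd_2x2_root:
  fixes s11 s12 s22 :: real
  assumes "0 \<le> s11" "0 \<le> s22" "s12\<^sup>2 \<le> s11 * s22"
  obtains b11 b21 b22 where "b11 * b11 = s11" "b11 * b21 = s12" "b21 * b21 + b22 * b22 = s22"
proof (cases "s11 = 0")
  case True
  with assms show ?thesis by (intro that[of 0 0 "sqrt s22"]) auto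
next
  case False
  then have pos: "0 < s11" using assms by simp
  have "s12\<^sup>2 / s11 \<le> s22" using assms pos by (simp add: field_simps)
  then show ?thesis using pos
    by (intro that[of "sqrt s11" "s12 / sqrt s11" "sqrt (s22 - s12\<^sup>2 / s11)"])
       (auto simp: power2_eq_square)
qed

text \<open>The matrix is a Kronecker product of a 2x2 matrix and \<Sigma>, and the product of a
  root of each is a root of the whole. The 2x2 matrix may be singular, for instance when the W-part
  vanishes at the final time.\<close>

lemma kronecker_Sigma_cov_root:
  fixes C :: "nat + nat \<Rightarrow> nat + nat \<Rightarrow> real"
  assumes s: "0 \<le> s11" "0 \<le> s22" "s12\<^sup>2 \<le> s11 * s22"
    and C: "\<And>i j. C (Inl i) (Inl j) = s11 * Sigma_cov i j" "\<And>i j. C (Inl i) (Inr j) = s12 * Sigma_cov i j"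
      "\<And>i j. C (Inr i) (Inl j) = s12 * Sigma_cov i j" "\<And>i j. C (Inr i) (Inr j) = s22 * Sigma_cov i j"
  shows "\<exists>A. \<forall>i\<in>{1..N} <+> {1..N}. \<forall>j\<in>{1..N} <+> {1..N}.
    (\<Sum>k\<in>{1..N} <+> {1..N}. A i k * A j k) = C i j"
proof -
  obtain R where R: "\<And>i j. i \<in> {1..N} \<Longrightarrow> j \<in> {1..N} \<Longrightarrow> (\<Sum>k=1..N. R i k * R j k) = Sigma_cov i j"
    using Sigma_cov_root[of N] by metis
  obtain b11 b21 b22 where b: "b11 * b11 = s11" "b11 * b21 = s12" "b21 * b21 + b22 * b22 = s22"
    using psd_2x2_root[OF s] by metis
  define A where "A i k = (case (i, k) of (Inl i, Inl k) \<Rightarrow> b11 * R i k | (Inl i, Inr k) \<Rightarrow> 0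
      | (Inr i, Inl k) \<Rightarrow> b21 * R i k | (Inr i, Inr k) \<Rightarrow> b22 * R i k)" for i k :: "nat + nat"
  have scale: "(\<Sum>k=1..N. (c * R i k) * (c' * R j k)) = (c * c') * Sigma_cov i j"
    if "i \<in> {1..N}" "j \<in> {1..N}" for c c' i j
    using R[OF that] by (simp add: sum_distrib_left[symmetric] mult_ac)
  have "(\<Sum>k\<in>{1..N} <+> {1..N}. A i k * A j k) = C i j"
    if ij: "i \<in> {1..N} <+> {1..N}" "j \<in> {1..N} <+> {1..N}" for i j
  proof -
    have split: "(\<Sum>k\<in>{1..N} <+> {1..N}. A i k * A j k)
        = (\<Sum>k=1..N. A i (Inl k) * A j (Inl k)) + (\<Sum>k=1..N. A i (Inr k) * A j (Inr k))"
      by (simp add: sum.Plus)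
    show ?thesis
    proof (cases i; cases j)
      fix i' j' assume ij': "i = Inl i'" "j = Inl j'"
      with ij have "i' \<in> {1..N}" "j' \<in> {1..N}" by auto
      from scale[OF this, of b11 b11] show ?thesis
        unfolding split unfolding ij' C A_def b[symmetric] by simp
    next
      fix i' j' assume ij': "i = Inl i'" "j = Inr j'"
      with ij have "i' \<in> {1..N}" "j' \<in> {1..N}" by auto
      from scale[OF this, of b11 b21] show ?thesis
        unfolding split unfolding ij' C A_def b[symmetric] by simp
    next
      fix i' j' assume ij': "i = Inr i'" "j = Inl j'"
      with ij have "i' \<in> {1..N}" "j' \<in> {1..N}" by auto
      from scale[OF this, of b21 b11] show ?thesis
        unfolding split unfolding ij' C A_def b[symmetric] by (simp add: mult.commute[of b21 b11])
    next
      fix i' j' assume ij': "i = Inr i'" "j = Inr j'"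
      with ij have "i' \<in> {1..N}" "j' \<in> {1..N}" by auto
      from scale[OF this, of b21 b21] scale[OF this, of b22 b22] show ?thesis
        unfolding split unfolding ij' C A_def b[symmetric] by (simp add: distrib_right)
    qed
  qed
  then show ?thesis by blast
qed

section \<open>The bilinear form of \<Sigma> and the moments of one noise vector\<close>

definition Sigma_form :: "nat \<Rightarrow> (nat \<Rightarrow> real) \<Rightarrow> (nat \<Rightarrow> real) \<Rightarrow> real" where
  "Sigma_form N a b = (\<Sum>i=1..N. \<Sum>j=1..N. a i * b j * Sigma_cov i j)"

lemma Sigma_form_scale: "Sigma_form N (\<lambda>n. c * a n) (\<lambda>n. c * a n) = c * c * Sigma_form N a a"
  by (simp add: Sigma_form_def sum_distrib_left mult_ac)

lemma Sigma_form_combination: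
  "Sigma_form N (\<lambda>n. a n * r + b n * s) (\<lambda>n. a n * r + b n * s)
    = Sigma_form N a a * (r * r) + (Sigma_form N a b + Sigma_form N b a) * (r * s) + Sigma_form N b b * (s * s)"
  unfolding Sigma_form_def sum_distrib_right sum.distrib[symmetric]
  by (intro sum.cong refl) (simp add: algebra_simps)

text \<open>The form equals half of the sum of the squares plus half of the square of the
  sum.\<close>

lemma Sigma_form_nonneg: "0 \<le> Sigma_form N c c"
proof -
  have "Sigma_form N c c = (\<Sum>i=1..N. \<Sum>j=1..N. (if i = j then c i * c j / 2 else 0) + c i * c j / 2)"
    unfolding Sigma_form_def by (intro sum.cong refl) (simp add: Sigma_cov_def)
  also have "\<dots> = (\<Sum>i=1..N. c i * c i / 2) + (\<Sum>i=1..N. c i) * (\<Sum>j=1..N. c j) / 2"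
    by (simp add: sum.distrib sum_product sum_divide_distrib)
  also have "0 \<le> \<dots>" by (intro add_nonneg_nonneg sum_nonneg) auto
  finally show ?thesis .
qed

abbreviation noise1 :: "nat \<Rightarrow> (nat \<Rightarrow> real) measure" where
  "noise1 N \<equiv> gaussian_law {1..N} (\<lambda>_. 0) Sigma_cov"

lemma integral_cis_noise1:
  "(LINT g|noise1 N. cis (\<Sum>i=1..N. \<theta> i * g i))
    = of_real (exp (- Sigma_form N \<theta> \<theta> / 2))"
proof -
  obtain R where "\<And>i j. i \<in> {1..N} \<Longrightarrow> j \<in> {1..N} \<Longrightarrow> (\<Sum>k=1..N. R i k * R j k) = Sigma_cov i j"
    using Sigma_cov_root[of N] by metis
  then have "\<exists>A. \<forall>i\<in>{1..N}. \<forall>j\<in>{1..N}. (\<Sum>k=1..N. A i k * A j k) = Sigma_cov i j" by blast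
  from integral_cis_gaussian_law[OF _ this, of "\<lambda>_. 0" \<theta>] show ?thesis by (simp add: Sigma_form_def)
qed

lemma measurable_gaussian_component:
  "n \<in> I \<Longrightarrow> (\<lambda>u. u n) \<in> borel_measurable (gaussian_law I \<mu> C)"
  by measurable

lemma distr_noise1_component:
  assumes n: "n \<in> {1..N}"
  shows "distr (noise1 N) borel (\<lambda>u. u n) = std_normal_distribution"
proof (rule Levy_uniqueness)
  interpret prob_space "noise1 N" by (rule prob_space_gaussian_law) simp
  have meas: "(\<lambda>u. u n) \<in> borel_measurable (noise1 N)" using n by (rule measurable_gaussian_component)
  show "real_distribution (distr (noise1 N) borel (\<lambda>u. u n))"
    by (rule real_distribution_distr) fact
  show "real_distribution std_normal_distribution" by (rule real_dist_normal_dist)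
  show "char (distr (noise1 N) borel (\<lambda>u. u n)) = char std_normal_distribution"
  proof
    fix t
    \<comment> \<open>The test vector t * e_n reads off the marginal; since the diagonal of \<Sigma>
      is 1, the quadratic form becomes t^2.\<close>
    define \<delta> where "\<delta> i = (if i = n then t else 0 :: real)" for i
    have sel: "(\<Sum>i=1..N. \<delta> i * u i) = t * u n" for u :: "nat \<Rightarrow> real"
    proof -
      have "(\<Sum>i=1..N. \<delta> i * u i) = (\<Sum>i=1..N. if i = n then t * u i else 0)"
        by (rule sum.cong) (auto simp: \<delta>_def)
      then show ?thesis using n by simp
    qed
    have "Sigma_form N \<delta> \<delta> = (\<Sum>i=1..N. \<delta> i * (\<Sum>j=1..N. \<delta> j * Sigma_cov i j))"
      by (simp add: Sigma_form_def sum_distrib_left mult.assoc)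
    also have "\<dots> = t\<^sup>2" by (simp only: sel) (simp add: Sigma_cov_def power2_eq_square)
    finally have quad: "Sigma_form N \<delta> \<delta> = t\<^sup>2" .
    have "char (distr (noise1 N) borel (\<lambda>u. u n)) t = (LINT u|noise1 N. cis (t * u n))"
      unfolding char_def by (subst integral_distr[OF meas]) (auto simp: cis_conv_exp)
    also have "\<dots> = of_real (exp (- t\<^sup>2 / 2))"
      using integral_cis_noise1[of N \<delta>] unfolding sel quad .
    finally show "char (distr (noise1 N) borel (\<lambda>u. u n)) t = char std_normal_distribution t"
      unfolding char_std_normal_distribution .
  qed
qed

lemma noise1_transfer:
  fixes f :: "real \<Rightarrow> real"
  assumes n: "n \<in> {1..N}" and [measurable]: "f \<in> borel_measurable borel"
  shows "integrable (noise1 N) (\<lambda>u. f (u n)) \<longleftrightarrow> integrable std_normal_distribution f"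
    and "(LINT u|noise1 N. f (u n)) = (LINT x|std_normal_distribution. f x)"
proof -
  have meas: "(\<lambda>u. u n) \<in> borel_measurable (noise1 N)" using n by (rule measurable_gaussian_component)
  show "integrable (noise1 N) (\<lambda>u. f (u n)) \<longleftrightarrow> integrable std_normal_distribution f"
    unfolding distr_noise1_component[OF n, symmetric]
    by (rule integrable_distr_eq[OF meas, symmetric]) measurable
  show "(LINT u|noise1 N. f (u n)) = (LINT x|std_normal_distribution. f x)"
    unfolding distr_noise1_component[OF n, symmetric]
    by (rule integral_distr[OF meas, symmetric]) measurable
qed

lemma noise1_moments:
  assumes n: "n \<in> {1..N}"
  shows "integrable (noise1 N) (\<lambda>u. (u n) ^ k)" "integrable (noise1 N) (\<lambda>u. \<bar>u n\<bar> ^ k)"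
    "(LINT u|noise1 N. u n) = 0" "(LINT u|noise1 N. (u n)\<^sup>2) = 1"
proof -
  have i: "integrable std_normal_distribution (\<lambda>x. x ^ k)"
    by (subst integrable_density) (auto intro: integrable_std_normal_moment)
  then show 1: "integrable (noise1 N) (\<lambda>u. (u n) ^ k)"
    using noise1_transfer(1)[OF n, of "\<lambda>x. x ^ k"] by simp
  then show "integrable (noise1 N) (\<lambda>u. \<bar>u n\<bar> ^ k)"
    using integrable_abs[OF 1] by (simp add: power_abs)
  show "(LINT u|noise1 N. u n) = 0"
    using noise1_transfer(2)[OF n, of "\<lambda>x. x"] integral_std_normal_distribution_moment_odd[of 1] by simp
  show "(LINT u|noise1 N. (u n)\<^sup>2) = 1"
    using noise1_transfer(2)[OF n, of "\<lambda>x. x\<^sup>2"] std_normal_distribution_even_moments(1)[of 1]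
    by (simp add: fact_numeral)
qed

lemma norm_cis_diff_le: "norm (cis a - cis b) \<le> \<bar>a - b\<bar>"
proof -
  have "cis a - cis b = cis b * (cis (a - b) - 1)"
    by (simp add: right_diff_distrib cis_mult)
  then have "norm (cis a - cis b) = norm (iexp (a - b) - 1)"
    by (simp add: norm_mult cis_conv_exp)
  also have "\<dots> \<le> \<bar>a - b\<bar>"
    using iexp_approx1[of "a - b" 0] by simp
  finally show ?thesis .
qed

section \<open>Taylor expansion\<close>

lemma taylor_linear_bound:
  fixes f f1 :: "real \<Rightarrow> real"
  assumes f: "\<And>u. (f has_real_derivative f1 u) (at u)"
    and L: "\<And>u v. \<bar>f1 u - f1 v\<bar> \<le> L * \<bar>u - v\<bar>"
  shows "\<bar>f (x + p) - f x - f1 x * p\<bar> \<le> L * \<bar>p\<bar>\<^sup>2"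
proof -
  define diff where "diff m u = (if m = 0 then f (x + u) else f1 (x + u))" for m :: nat and u
  have "(diff 0 has_real_derivative diff (Suc 0) u) (at u)" for u
    using f[of "u + x"] unfolding diff_def by (simp add: DERIV_shift add.commute[of x])
  then have deriv: "\<forall>m t. m < 1 \<and> \<bar>t\<bar> \<le> \<bar>p\<bar> \<longrightarrow> (diff m has_real_derivative diff (Suc m) t) (at t)"
    by simp
  have "\<exists>t. \<bar>t\<bar> \<le> \<bar>p\<bar> \<and> f (x + p) = (\<Sum>m<1. diff m 0 / fact m * p ^ m) + diff 1 t / fact 1 * p ^ 1"
    by (rule Maclaurin_bi_le[of diff "\<lambda>u. f (x + u)", OF ext deriv]) (simp add: diff_def)
  then obtain t where t: "\<bar>t\<bar> \<le> \<bar>p\<bar>" "f (x + p) = f x + f1 (x + t) * p"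
    by (auto simp: diff_def)
  have L0: "0 \<le> L" using order_trans[OF abs_ge_zero L[of 1 0]] by simp
  have "\<bar>f (x + p) - f x - f1 x * p\<bar> = \<bar>f1 (x + t) - f1 x\<bar> * \<bar>p\<bar>"
    unfolding t(2) abs_mult[symmetric] by (simp add: algebra_simps)
  also have "\<dots> \<le> (L * \<bar>t\<bar>) * \<bar>p\<bar>" using L[of "x + t" x] by (intro mult_right_mono) auto
  also have "\<dots> \<le> (L * \<bar>p\<bar>) * \<bar>p\<bar>" using t(1) L0 by (intro mult_right_mono mult_left_mono) auto
  finally show ?thesis by (simp add: power2_eq_square mult.assoc)
qed

lemma taylor_quadratic_bound:
  fixes f f1 f2 :: "real \<Rightarrow> real"
  assumes f: "\<And>u. (f has_real_derivative f1 u) (at u)" and f1: "\<And>u. (f1 has_real_derivative f2 u) (at u)"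
    and L: "\<And>u v. \<bar>f2 u - f2 v\<bar> \<le> L * \<bar>u - v\<bar>"
  shows "\<bar>f (x + p) - f x - f1 x * p - f2 x * p\<^sup>2 / 2\<bar> \<le> L * \<bar>p\<bar> ^ 3"
proof -
  define diff where "diff m u = (if m = 0 then f (x + u) else if m = 1 then f1 (x + u) else f2 (x + u))"
    for m :: nat and u
  have deriv: "(diff m has_real_derivative diff (Suc m) u) (at u)" if "m < 2" for u m
  proof -
    have "((\<lambda>u. f (x + u)) has_real_derivative f1 (x + u)) (at u)"
      "((\<lambda>u. f1 (x + u)) has_real_derivative f2 (x + u)) (at u)"
      using f[of "u + x"] f1[of "u + x"] by (simp_all add: DERIV_shift add.commute[of x])
    with that show ?thesis unfolding diff_def by (cases m) auto
  qed
  have "\<exists>t. \<bar>t\<bar> \<le> \<bar>p\<bar> \<and> f (x + p) = (\<Sum>m<2. diff m 0 / fact m * p ^ m) + diff 2 t / fact 2 * p ^ 2"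
  proof (rule Maclaurin_bi_le[of diff "\<lambda>u. f (x + u)"])
    show "diff 0 = (\<lambda>u. f (x + u))" by (rule ext) (simp add: diff_def)
    show "\<forall>m t. m < 2 \<and> \<bar>t\<bar> \<le> \<bar>p\<bar> \<longrightarrow> (diff m has_real_derivative diff (Suc m) t) (at t)"
      by (intro allI impI deriv) simp
  qed
  then obtain t where t: "\<bar>t\<bar> \<le> \<bar>p\<bar>" "f (x + p) = f x + f1 x * p + f2 (x + t) / 2 * p\<^sup>2"
    by (auto simp: diff_def eval_nat_numeral)
  have L0: "0 \<le> L" using order_trans[OF abs_ge_zero L[of 1 0]] by simp
  have "\<bar>f (x + p) - f x - f1 x * p - f2 x * p\<^sup>2 / 2\<bar> = \<bar>(f2 (x + t) - f2 x) * (p\<^sup>2 / 2)\<bar>"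
    unfolding t(2) by (rule arg_cong[of _ _ abs]) (simp add: algebra_simps diff_divide_distrib)
  also have "\<dots> = \<bar>f2 (x + t) - f2 x\<bar> * (p\<^sup>2 / 2)" by (simp add: abs_mult)
  also have "\<dots> \<le> (L * \<bar>t\<bar>) * (p\<^sup>2 / 2)" using L[of "x + t" x] by (intro mult_right_mono) auto
  also have "\<dots> \<le> (L * \<bar>p\<bar>) * p\<^sup>2" using t(1) L0 by (intro mult_mono mult_left_mono) auto
  finally show ?thesis by (simp add: power3_eq_cube power2_eq_square mult.assoc)
qed

section \<open>Partial derivatives and Taylor expansion in two variables\<close>

locale C2_derivatives =
  fixes w :: "real \<Rightarrow> real \<Rightarrow> real"
  assumes C2: "C2 (\<lambda>(x, y). w x y)"
begin

abbreviation "w1 \<equiv> deriv_fst w"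
abbreviation "w2 \<equiv> deriv_snd w"
abbreviation "w11 \<equiv> deriv_fst (deriv_fst w)"
abbreviation "w22 \<equiv> deriv_snd (deriv_snd w)"
abbreviation "w12 \<equiv> deriv_fst (deriv_snd w)"

text \<open>\<open>deriv\<close> is a total operator, so differentiability has to be recovered
  first: the Frechet derivatives given by \<open>C2\<close>, evaluated at (1, 0) and (0, 1),
  identify all partial derivatives. Continuity of the first-order ones serves measurability.\<close>

lemma partial_derivatives:
  "((\<lambda>u. w u y) has_real_derivative w1 x y) (at x)"
  "((\<lambda>v. w x v) has_real_derivative w2 x y) (at y)"
  "((\<lambda>u. w1 u y) has_real_derivative w11 x y) (at x)"
  "((\<lambda>v. w2 x v) has_real_derivative w22 x y) (at y)"
  "((\<lambda>u. w2 u y) has_real_derivative w12 x y) (at x)"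
  "continuous_on UNIV (\<lambda>(x, y). w1 x y)" "continuous_on UNIV (\<lambda>(x, y). w2 x y)"
proof -
  obtain f' f'' where f': "\<And>z. ((\<lambda>(x, y). w x y) has_derivative blinfun_apply (f' z)) (at z)"
    and f'': "\<And>z. (f' has_derivative blinfun_apply (f'' z)) (at z)"
    using C2 unfolding C2_def by blast
  have chain: "((\<lambda>u. g (p u)) has_real_derivative D e) (at t)"
    if "(g has_derivative D) (at (p t))" "(p has_derivative (\<lambda>h. h *\<^sub>R e)) (at t)"
    for g :: "real \<times> real \<Rightarrow> real" and D p e t
  proof -
    have "linear D" using that(1) by (rule has_derivative_linear)
    then have "(\<lambda>h. D (h *\<^sub>R e)) = (\<lambda>h. D e * h)" by (simp add: fun_eq_iff linear_scale)
    then show ?thesis using has_derivative_compose[OF that(2,1)] by (simp add: has_field_derivative_def)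
  qed
  have fst_gen: "((\<lambda>u. g (u, y)) has_real_derivative D (1, 0)) (at x)"
    and snd_gen: "((\<lambda>v. g (x, v)) has_real_derivative D (0, 1)) (at y)"
    if "(g has_derivative D) (at (x, y))" for g :: "real \<times> real \<Rightarrow> real" and D x y
    using that by (auto intro!: chain derivative_eq_intros)
  have d1: "((\<lambda>u. w u y) has_real_derivative f' (x, y) (1, 0)) (at x)" for x y
    using fst_gen[OF f'[of "(x, y)"]] by simp
  have d2: "((\<lambda>v. w x v) has_real_derivative f' (x, y) (0, 1)) (at y)" for x y
    using snd_gen[OF f'[of "(x, y)"]] by simp
  have w1: "w1 x y = f' (x, y) (1, 0)" for x y unfolding deriv_fst_def by (rule DERIV_imp_deriv[OF d1])
  have w2: "w2 x y = f' (x, y) (0, 1)" for x y unfolding deriv_snd_def by (rule DERIV_imp_deriv[OF d2])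
  show "((\<lambda>u. w u y) has_real_derivative w1 x y) (at x)" "((\<lambda>v. w x v) has_real_derivative w2 x y) (at y)"
    unfolding w1 w2 by (rule d1 d2)+
  have dd: "((\<lambda>z. f' z h) has_derivative (\<lambda>k. f'' z k h)) (at z)" for z h
    by (rule bounded_linear.has_derivative[OF blinfun.bounded_linear_left f''])
  have c: "continuous_on UNIV (\<lambda>z. f' z h)" for h
    using dd by (meson continuous_at_imp_continuous_on has_derivative_continuous)
  show "continuous_on UNIV (\<lambda>(x, y). w1 x y)" "continuous_on UNIV (\<lambda>(x, y). w2 x y)"
    using c[of "(1, 0)"] c[of "(0, 1)"] by (simp_all add: w1 w2 case_prod_unfold)
  have "((\<lambda>u. f' (u, y) (1, 0)) has_real_derivative f'' (x, y) (1, 0) (1, 0)) (at x)"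
    using fst_gen[OF dd] .
  then show "((\<lambda>u. w1 u y) has_real_derivative w11 x y) (at x)"
    unfolding deriv_fst_def[of "deriv_fst w"] w1 by (simp add: DERIV_imp_deriv)
  have "((\<lambda>u. f' (x, u) (0, 1)) has_real_derivative f'' (x, y) (0, 1) (0, 1)) (at y)"
    using snd_gen[OF dd] .
  then show "((\<lambda>u. w2 x u) has_real_derivative w22 x y) (at y)"
    unfolding deriv_snd_def[of "deriv_snd w"] w2 by (simp add: DERIV_imp_deriv)
  have "((\<lambda>u. f' (u, y) (0, 1)) has_real_derivative f'' (x, y) (1, 0) (0, 1)) (at x)"
    using fst_gen[OF dd] .
  then show "((\<lambda>u. w2 u y) has_real_derivative w12 x y) (at x)"
    unfolding deriv_fst_def[of "deriv_snd w"] w2 by (simp add: DERIV_imp_deriv)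
qed

text \<open>The increment is split into a move in x at fixed y and a move in y at x + p, so
  one-variable expansions suffice and each Lipschitz bound is used in one variable at a
  time.\<close>

lemma taylor_bound:
  assumes "lipschitz_bounded w11" "lipschitz_bounded w22" "lipschitz_bounded w12"
  obtains C where "0 \<le> C" "\<And>x y p q. \<bar>w (x + p) (y + q) - w x y - w1 x y * p - w2 x y * q
      - w11 x y * p\<^sup>2 / 2 - w22 x y * q\<^sup>2 / 2 - w12 x y * p * q\<bar> \<le> C * (\<bar>p\<bar> ^ 3 + \<bar>q\<bar> ^ 3)"
proof -
  have lip: "\<exists>L\<ge>0. (\<forall>x y x'. \<bar>f x y - f x' y\<bar> \<le> L * \<bar>x - x'\<bar>) \<and> (\<forall>x y y'. \<bar>f x y - f x y'\<bar> \<le> L * \<bar>y - y'\<bar>)"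
    if "lipschitz_bounded f" for f
  proof -
    from that obtain L where L: "L-lipschitz_on UNIV (\<lambda>(x, y). f x y)" by (auto simp: lipschitz_bounded_def)
    have "\<bar>f x y - f x' y\<bar> \<le> L * \<bar>x - x'\<bar>" for x y x'
      using lipschitz_onD[OF L, of "(x, y)" "(x', y)"] by (simp add: dist_Pair_Pair dist_real_def)
    moreover have "\<bar>f x y - f x y'\<bar> \<le> L * \<bar>y - y'\<bar>" for x y y'
      using lipschitz_onD[OF L, of "(x, y)" "(x, y')"] by (simp add: dist_Pair_Pair dist_real_def)
    ultimately show ?thesis using lipschitz_on_nonneg[OF L] by blast
  qed
  obtain L1 where L1: "0 \<le> L1" "\<And>x y x'. \<bar>w11 x y - w11 x' y\<bar> \<le> L1 * \<bar>x - x'\<bar>"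
    using lip[OF assms(1)] by blast
  obtain L2 where L2: "0 \<le> L2" "\<And>x y x'. \<bar>w22 x y - w22 x' y\<bar> \<le> L2 * \<bar>x - x'\<bar>"
    "\<And>x y y'. \<bar>w22 x y - w22 x y'\<bar> \<le> L2 * \<bar>y - y'\<bar>"
    using lip[OF assms(2)] by blast
  obtain L3 where L3: "0 \<le> L3" "\<And>x y x'. \<bar>w12 x y - w12 x' y\<bar> \<le> L3 * \<bar>x - x'\<bar>"
    using lip[OF assms(3)] by blast
  \<comment> \<open>One share for each remainder below: L1 for \<open>e1\<close>, L2 for both
    \<open>e2\<close> and \<open>e4\<close>, L3 for \<open>e3\<close>.\<close>
  define C where "C = L1 + 2 * L2 + L3"
  show ?thesis
  proof (rule that[of C])
    show "0 \<le> C" using L1 L2 L3 by (simp add: C_def)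
    fix x y p q :: real
    let ?R = "w (x + p) (y + q) - w x y - w1 x y * p - w2 x y * q - w11 x y * p\<^sup>2 / 2 - w22 x y * q\<^sup>2 / 2 - w12 x y * p * q"
    let ?S = "\<bar>p\<bar> ^ 3 + \<bar>q\<bar> ^ 3"
    define e1 where "e1 = w (x + p) y - w x y - w1 x y * p - w11 x y * p\<^sup>2 / 2"
    define e2 where "e2 = w (x + p) (y + q) - w (x + p) y - w2 (x + p) y * q - w22 (x + p) y * q\<^sup>2 / 2"
    \<comment> \<open>\<open>e3\<close> and \<open>e4\<close> carry the derivatives in y back from x
      + p to x; \<open>e3\<close> is second order in p and gets multiplied by q, \<open>e4\<close>
      is first order in p and gets multiplied by q^2.\<close>
    define e3 where "e3 = w2 (x + p) y - w2 x y - w12 x y * p"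
    define e4 where "e4 = w22 (x + p) y - w22 x y"
    have m: "\<bar>p\<bar>\<^sup>2 * \<bar>q\<bar> \<le> ?S" "\<bar>p\<bar> * \<bar>q\<bar>\<^sup>2 \<le> ?S"
    proof -
      have *: "a\<^sup>2 * b \<le> a ^ 3 + b ^ 3" if "0 \<le> a" "0 \<le> b" for a b :: real
      proof (cases "a \<le> b")
        case True
        have "a\<^sup>2 * b \<le> b\<^sup>2 * b" using that True by (intro mult_right_mono power_mono) auto
        then show ?thesis using that by (simp add: power2_eq_square power3_eq_cube add_increasing)
      next
        case False
        then have "a\<^sup>2 * b \<le> a\<^sup>2 * a" using that by (intro mult_left_mono) auto
        then show ?thesis using that by (simp add: power2_eq_square power3_eq_cube add_increasing2)
      qed
      show "\<bar>p\<bar>\<^sup>2 * \<bar>q\<bar> \<le> ?S" by (rule *) auto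
      show "\<bar>p\<bar> * \<bar>q\<bar>\<^sup>2 \<le> ?S" using *[of "\<bar>q\<bar>" "\<bar>p\<bar>"] by (simp add: mult.commute add.commute)
    qed
    have b1: "\<bar>e1\<bar> \<le> L1 * ?S"
    proof -
      have "\<bar>e1\<bar> \<le> L1 * \<bar>p\<bar> ^ 3"
        unfolding e1_def by (rule taylor_quadratic_bound[OF partial_derivatives(1,3)]) (rule L1)
      also have "\<dots> \<le> L1 * ?S" using L1 by (intro mult_left_mono) auto
      finally show ?thesis .
    qed
    have b2: "\<bar>e2\<bar> \<le> L2 * ?S"
    proof -
      have "\<bar>e2\<bar> \<le> L2 * \<bar>q\<bar> ^ 3"
        unfolding e2_def by (rule taylor_quadratic_bound[OF partial_derivatives(2,4)]) (rule L2)
      also have "\<dots> \<le> L2 * ?S" using L2 by (intro mult_left_mono) auto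
      finally show ?thesis .
    qed
    have b3: "\<bar>e3 * q\<bar> \<le> L3 * ?S"
    proof -
      have "\<bar>e3\<bar> \<le> L3 * \<bar>p\<bar>\<^sup>2"
        unfolding e3_def by (rule taylor_linear_bound[OF partial_derivatives(5)]) (rule L3)
      then have "\<bar>e3 * q\<bar> \<le> (L3 * \<bar>p\<bar>\<^sup>2) * \<bar>q\<bar>" unfolding abs_mult by (intro mult_right_mono) auto
      also have "\<dots> = L3 * (\<bar>p\<bar>\<^sup>2 * \<bar>q\<bar>)" by simp
      also have "\<dots> \<le> L3 * ?S" using L3 m by (intro mult_left_mono)
      finally show ?thesis .
    qed
    have b4: "\<bar>e4 * q\<^sup>2 / 2\<bar> \<le> L2 * ?S"
    proof -
      have "\<bar>e4\<bar> \<le> L2 * \<bar>p\<bar>" unfolding e4_def using L2(2)[of "x + p" y x] by simp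
      then have "\<bar>e4\<bar> * \<bar>q\<bar>\<^sup>2 \<le> (L2 * \<bar>p\<bar>) * \<bar>q\<bar>\<^sup>2" by (intro mult_right_mono) auto
      also have "\<dots> = L2 * (\<bar>p\<bar> * \<bar>q\<bar>\<^sup>2)" by simp
      also have "\<dots> \<le> L2 * ?S" using L2 m by (intro mult_left_mono)
      finally have "\<bar>e4\<bar> * q\<^sup>2 \<le> L2 * ?S" by simp
      moreover have "\<bar>e4 * q\<^sup>2 / 2\<bar> = \<bar>e4\<bar> * q\<^sup>2 / 2" by (simp add: abs_mult)
      moreover have "0 \<le> \<bar>e4\<bar> * q\<^sup>2" by simp
      ultimately show ?thesis by linarith
    qed
    have "?R = e1 + e2 + e3 * q + e4 * q\<^sup>2 / 2"
      by (simp add: e1_def e2_def e3_def e4_def field_simps)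
    moreover have "\<bar>e1 + e2 + e3 * q + e4 * q\<^sup>2 / 2\<bar> \<le> L1 * ?S + L2 * ?S + L3 * ?S + L2 * ?S"
      using b1 b2 b3 b4 by (intro order_trans[OF abs_triangle_ineq] add_mono)
    ultimately show "\<bar>?R\<bar> \<le> C * ?S"
      by (simp add: C_def distrib_right)
  qed
qed

end

lemma (in C2_derivatives) continuous_w: "continuous_on UNIV (\<lambda>(x, y). w x y)"
  using C2 unfolding C2_def by (meson continuous_at_imp_continuous_on has_derivative_continuous)

lemma lipschitz_bounded_continuous: "lipschitz_bounded f \<Longrightarrow> continuous_on UNIV (\<lambda>(x, y). f x y)"
  by (auto simp: lipschitz_bounded_def intro: lipschitz_on_continuous_on)

lemma lipschitz_bounded_bound: "lipschitz_bounded f \<Longrightarrow> \<exists>B. \<forall>x y. \<bar>f x y\<bar> \<le> B"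
  unfolding lipschitz_bounded_def bounded_iff by (auto simp: image_iff)

section \<open>Selection in terms of log-weight ratios\<close>

declare One_nat_def [simp del]

locale csmc_model =
  fixes T N :: nat
    and ell :: "nat \<Rightarrow> real"
    and m1 :: "real \<Rightarrow> real"
    and m :: "nat \<Rightarrow> real \<Rightarrow> real \<Rightarrow> real"
    and G :: "nat \<Rightarrow> real \<Rightarrow> real"
  assumes T: "1 \<le> T"
    and ell_pos: "\<And>t. t \<in> {1..T} \<Longrightarrow> 0 < ell t"
    and init: "\<And>x y. m 1 x y = m1 y"
    and m_pos: "\<And>t x y. t \<in> {1..T} \<Longrightarrow> 0 < m t x y"
    and G_pos: "\<And>t x. t \<in> {1..T} \<Longrightarrow> 0 < G t x"
    and target_prob: "prob_space (target T m G)"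
    and w_C2: "\<And>t. t \<in> {1..T} \<Longrightarrow> C2 (\<lambda>(x, y). log_weight T m G t x y)"
    and w_snd_snd: "\<And>t. t \<in> {1..T} \<Longrightarrow> lipschitz_bounded (deriv_snd (deriv_snd (log_weight T m G t)))"
    and w_fst_fst: "\<And>t. t \<in> {1..T} \<Longrightarrow> lipschitz_bounded (deriv_fst (deriv_fst (log_weight T m G (t + 1))))"
    and w_fst_snd: "\<And>t. t \<in> {1..T} \<Longrightarrow> lipschitz_bounded (deriv_fst (deriv_snd (log_weight T m G (t + 1))))"
    and w_snd_moment: "\<And>t. t \<in> {1..T} \<Longrightarrow>
          integrable (target T m G) (\<lambda>x. \<bar>deriv_snd (log_weight T m G t) (x (t - 1)) (x t)\<bar> ^ 4)"
    and w_fst_moment: "\<And>t. t \<in> {1..T} \<Longrightarrow>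
          integrable (target T m G) (\<lambda>x. \<bar>deriv_fst (log_weight T m G (t + 1)) (x t) (x (t + 1))\<bar> ^ 4)"
begin

abbreviation "w \<equiv> log_weight T m G"
abbreviation "\<pi> \<equiv> target T m G"

definition indices :: "(nat \<times> nat \<times> nat) set" where
  "indices = {1..T} \<times> {..N} \<times> {..N}"

lemma finite_indices [simp]: "finite indices" by (simp add: indices_def)

text \<open>The value 0 off the finite index set makes the family admissible for the
  finite-dimensional continuity theorem.\<close>

definition log_ratio :: "nat \<Rightarrow> (nat \<Rightarrow> nat \<Rightarrow> nat \<Rightarrow> real) \<Rightarrow> nat \<times> nat \<times> nat \<Rightarrow> real" where
  "log_ratio D z = (\<lambda>(t, a, l). if (t, a, l) \<in> indices
     then (\<Sum>d=1..D. w t (z (t - 1) a d) (z t l d)) - (\<Sum>d=1..D. w t (z (t - 1) 0 d) (z t 0 d)) else 0)"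

lemma particle_weight_eq:
  assumes t: "t \<in> {1..T}"
  shows "particle_weight D m G z t A l = exp (\<Sum>d=1..D. w t (z (t - 1) (A (t - 1) l) d) (z t l d))"
proof -
  have "m t x y * G t y = exp (w t x y)" for x y
    using t m_pos[OF t] G_pos[OF t] by (auto simp: log_weight_def exp_add)
  then show ?thesis
    unfolding particle_weight_def mutation_prod_def potential_prod_def
    by (simp add: exp_sum prod.distrib[symmetric])
qed

lemma mutation_prod_eq:
  assumes t: "t \<in> {1..T}"
  shows "mutation_prod D m t x y = exp ((\<Sum>d=1..D. w t (x d) (y d)) - (\<Sum>d=1..D. ln (G t (y d))))"
proof -
  have "m t (x d) (y d) = exp (w t (x d) (y d) - ln (G t (y d)))" for d
    using t m_pos[OF t, of "x d" "y d"] by (auto simp: log_weight_def)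
  then show ?thesis unfolding mutation_prod_def by (simp add: exp_sum sum_subtractf[symmetric])
qed

text \<open>Each sampling weight is the exponential of log-ratios times a constant free of the
  candidate index. Final selection is not treated by scaling weights, since the forced move is not
  scale invariant; there the log differences coincide exactly because
  \<open>A (T - 1) 0 = 0\<close>.\<close>

lemma csmc_selection_eq:
  "csmc_selection T D N backward forced m G z = log_weight_selection T N backward forced (log_ratio D z)"
  unfolding csmc_selection_def log_weight_selection_def
proof (rule selection_law_cong[symmetric])
  define e where "e t a l = (\<Sum>d=1..D. w t (z (t - 1) a d) (z t l d))" for t a l
  have ratio: "log_ratio D z (t, a, l) = e t a l - e t 0 0" if "t \<in> {1..T}" "a \<le> N" "l \<le> N" for t a l
    using that by (simp add: log_ratio_def e_def indices_def)
  have pw: "particle_weight D m G z t A l = exp (e t (A (t - 1) l) l)" if "t \<in> {1..T}" for t A l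
    using particle_weight_eq[OF that] by (simp add: e_def)
  show "categorical N (\<lambda>l. exp (log_ratio D z (t, A (t - 1) l, l))) = categorical N (particle_weight D m G z t A)"
    if "t \<in> {1..T - 1}" "A \<in> ancestors N" for t A
  proof (rule categorical_scale[of "exp (- e t 0 0)"])
    fix l assume "l \<le> N"
    moreover have "A (t - 1) l \<le> N" "t \<in> {1..T}" using that by (auto simp: ancestors_def)
    ultimately show "exp (log_ratio D z (t, A (t - 1) l, l)) = exp (- e t 0 0) * particle_weight D m G z t A l"
      by (simp add: ratio pw exp_add[symmetric])
  qed simp
  show "categorical N (select_final forced N (\<lambda>n. log_ratio D z (T, A (T - 1) n, n)))
      = categorical N (select_final forced N
          (\<lambda>n. ln (particle_weight D m G z T A n) - ln (particle_weight D m G z T A 0)))"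
    if A: "A \<in> ancestors N" for A
  proof (rule categorical_scale[of 1])
    have TT: "T \<in> {1..T}" using T by simp
    have *: "log_ratio D z (T, A (T - 1) n, n) = ln (particle_weight D m G z T A n) - ln (particle_weight D m G z T A 0)"
      if "n \<in> {1..N}" for n
      using that A TT by (simp add: ratio pw ancestors_def)
    fix l assume "l \<le> N"
    then show "select_final forced N (\<lambda>n. log_ratio D z (T, A (T - 1) n, n)) l = 1 * select_final forced N
          (\<lambda>n. ln (particle_weight D m G z T A n) - ln (particle_weight D m G z T A 0)) l"
      unfolding mult_1 by (intro select_final_cong *)
  qed simp
  show "categorical N (\<lambda>k. exp (log_ratio D z (t, A (t - 1) k, k) + log_ratio D z (t + 1, k, k') - log_ratio D z (t + 1, 0, k')))
      = categorical N (\<lambda>k. particle_weight D m G z t A k * mutation_prod D m (t + 1) (z t k) (z (t + 1) k'))"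
    if t: "t \<in> {1..T - 1}" and A: "A \<in> ancestors N" and k': "k' \<le> N" for t A k'
  \<comment> \<open>The constant may depend on the index k' already chosen at t + 1: it collects the
    reference value at t, the subtracted ratio at t + 1, and the potential at t + 1 that occurs in
    \<open>w (t + 1)\<close> but not in the backward weight.\<close>
  proof (rule categorical_scale[of "exp (- (e t 0 0 + e (t + 1) 0 k' - (\<Sum>d=1..D. ln (G (t + 1) (z (t + 1) k' d)))))"])
    fix k assume k: "k \<le> N"
    have t': "t \<in> {1..T}" "t + 1 \<in> {1..T}" using t by auto
    have "mutation_prod D m (t + 1) (z t k) (z (t + 1) k')
        = exp (e (t + 1) k k' - (\<Sum>d=1..D. ln (G (t + 1) (z (t + 1) k' d))))"
      using mutation_prod_eq[OF t'(2)] by (simp add: e_def)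
    with k k' t' A show "exp (log_ratio D z (t, A (t - 1) k, k) + log_ratio D z (t + 1, k, k') - log_ratio D z (t + 1, 0, k'))
      = exp (- (e t 0 0 + e (t + 1) 0 k' - (\<Sum>d=1..D. ln (G (t + 1) (z (t + 1) k' d)))))
        * (particle_weight D m G z t A k * mutation_prod D m (t + 1) (z t k) (z (t + 1) k'))"
      by (simp add: ratio pw ancestors_def exp_add[symmetric])
  qed simp
qed (auto intro: weights_pos weights_select_final)

definition limit_log_ratio :: "(nat \<Rightarrow> nat + nat \<Rightarrow> real) \<Rightarrow> nat \<times> nat \<times> nat \<Rightarrow> real" where
  "limit_log_ratio g = (\<lambda>(t, a, l). if (t, a, l) \<in> indices then limit_V g t l + limit_W g (t - 1) a else 0)"

text \<open>In the backward weight the term V_(t+1)^k' cancels in the difference and W_t^0 = 0,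
  leaving V_t^k + W_t^k + W_(t-1)^a. So the limiting backward weights no longer depend on
  k'.\<close>

lemma limit_selection_eq:
  "limit_selection T N backward forced g = log_weight_selection T N backward forced (limit_log_ratio g)"
  unfolding limit_selection_def log_weight_selection_def Let_def
proof (rule selection_law_cong[symmetric])
  define H where "H = limit_log_ratio g"
  have H: "H (t, a, l) = limit_V g t l + limit_W g (t - 1) a" if "t \<in> {1..T}" "a \<le> N" "l \<le> N" for t a l
    using that by (simp add: H_def limit_log_ratio_def indices_def)
  have V0: "limit_V g t 0 = 0" "limit_W g t 0 = 0" for t by (auto simp: limit_V_def limit_W_def)
  show "categorical N (\<lambda>l. exp (H (t, A (t - 1) l, l))) = categorical N
      (select_Psi N (\<lambda>n. limit_V g t n + limit_W g (t - 1) (A (t - 1) n)))"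
    if "t \<in> {1..T - 1}" and A: "A \<in> ancestors N" for t A
  proof -
    have "t \<in> {1..T}" using that by auto
    with A show ?thesis
      by (subst categorical_select_Psi) (auto intro!: categorical_scale[of 1] simp: V0 H ancestors_def)
  qed
  show "categorical N (select_final forced N (\<lambda>n. H (T, A (T - 1) n, n)))
      = categorical N (select_final forced N (\<lambda>n. limit_V g T n + limit_W g (T - 1) (A (T - 1) n)))"
    if A: "A \<in> ancestors N" for A
  proof (rule categorical_scale[of 1])
    have TT: "T \<in> {1..T}" using T by simp
    fix l assume "l \<le> N"
    then show "select_final forced N (\<lambda>n. H (T, A (T - 1) n, n)) l
      = 1 * select_final forced N (\<lambda>n. limit_V g T n + limit_W g (T - 1) (A (T - 1) n)) l"
      unfolding mult_1 by (intro select_final_cong) (use A TT in \<open>auto simp: H ancestors_def\<close>)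
  qed simp
  show "categorical N (\<lambda>k. exp (H (t, A (t - 1) k, k) + H (t + 1, k, k') - H (t + 1, 0, k')))
      = categorical N (select_Psi N (\<lambda>n. limit_V g t n + limit_W g t n + limit_W g (t - 1) (A (t - 1) n)))"
    if t: "t \<in> {1..T - 1}" and A: "A \<in> ancestors N" and k': "k' \<le> N" for t A k'
  proof -
    have "t \<in> {1..T}" "t + 1 \<in> {1..T}" using t by auto
    with A k' show ?thesis
      by (subst categorical_select_Psi) (auto intro!: categorical_scale[of 1] simp: V0 H ancestors_def algebra_simps)
  qed
qed (auto intro: weights_pos weights_select_final)

section \<open>Linear functionals of the log-ratios, regrouped by time\<close>

definition coeff_V :: "(nat \<times> nat \<times> nat \<Rightarrow> real) \<Rightarrow> nat \<Rightarrow> nat \<Rightarrow> real" where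
  "coeff_V \<theta> t n = (\<Sum>a\<le>N. \<theta> (t, a, n))"

definition coeff_W :: "(nat \<times> nat \<times> nat \<Rightarrow> real) \<Rightarrow> nat \<Rightarrow> nat \<Rightarrow> real" where
  "coeff_W \<theta> t n = (if t + 1 \<le> T then \<Sum>l\<le>N. \<theta> (t + 1, n, l) else 0)"

text \<open>V_t and W_t are driven by the same noise but sit in ratios at times t and t + 1.
  Collecting them under one t makes the blocks independent.\<close>

lemma sum_indices_V_W:
  assumes "\<And>t. V t 0 = 0" "\<And>t. W t 0 = 0" "\<And>n. W 0 n = 0"
  shows "(\<Sum>(t, a, l)\<in>indices. \<theta> (t, a, l) * (V t l + W (t - 1) a))
    = (\<Sum>t=1..T. \<Sum>n=1..N. coeff_V \<theta> t n * V t n + coeff_W \<theta> t n * W t n)"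
proof -
  have "(\<Sum>(t, a, l)\<in>indices. \<theta> (t, a, l) * (V t l + W (t - 1) a))
      = (\<Sum>t=1..T. \<Sum>a\<le>N. \<Sum>l\<le>N. \<theta> (t, a, l) * (V t l + W (t - 1) a))"
    unfolding indices_def by (simp add: sum.cartesian_product[symmetric])
  also have "\<dots> = (\<Sum>t=1..T. \<Sum>a\<le>N. \<Sum>l\<le>N. \<theta> (t, a, l) * V t l)
      + (\<Sum>t=1..T. \<Sum>a\<le>N. \<Sum>l\<le>N. \<theta> (t, a, l) * W (t - 1) a)"
    by (simp add: distrib_left sum.distrib)
  also have "(\<Sum>t=1..T. \<Sum>a\<le>N. \<Sum>l\<le>N. \<theta> (t, a, l) * V t l) = (\<Sum>t=1..T. \<Sum>n=1..N. coeff_V \<theta> t n * V t n)"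
  proof (rule sum.cong[OF refl])
    fix t
    have "(\<Sum>a\<le>N. \<Sum>l\<le>N. \<theta> (t, a, l) * V t l) = (\<Sum>l\<le>N. coeff_V \<theta> t l * V t l)"
      by (subst sum.swap) (simp add: coeff_V_def sum_distrib_right)
    then show "(\<Sum>a\<le>N. \<Sum>l\<le>N. \<theta> (t, a, l) * V t l) = (\<Sum>n=1..N. coeff_V \<theta> t n * V t n)"
      by (simp add: sum_atMost_split0 assms)
  qed
  also have "(\<Sum>t=1..T. \<Sum>a\<le>N. \<Sum>l\<le>N. \<theta> (t, a, l) * W (t - 1) a)
      = (\<Sum>t=1..T. \<Sum>n=1..N. coeff_W \<theta> t n * W t n)"
  proof -
    define g where "g t = (\<Sum>n=1..N. (\<Sum>l\<le>N. \<theta> (t + 1, n, l)) * W t n)" for t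
    have "(\<Sum>a\<le>N. \<Sum>l\<le>N. \<theta> (t, a, l) * W (t - 1) a) = g (t - 1)" if "t \<in> {1..T}" for t
    proof -
      have "(\<Sum>a\<le>N. \<Sum>l\<le>N. \<theta> (t, a, l) * W (t - 1) a) = (\<Sum>a\<le>N. (\<Sum>l\<le>N. \<theta> (t, a, l)) * W (t - 1) a)"
        by (simp only: sum_distrib_right)
      also have "\<dots> = (\<Sum>a=1..N. (\<Sum>l\<le>N. \<theta> (t, a, l)) * W (t - 1) a)"
        by (subst sum_atMost_split0) (simp add: assms)
      finally show ?thesis using that by (simp add: g_def)
    qed
    \<comment> \<open>Shift by one: the term at time 0 drops because W_0 = 0, and a term at T is
      added back with coefficient 0.\<close>
    then have "(\<Sum>t=1..T. \<Sum>a\<le>N. \<Sum>l\<le>N. \<theta> (t, a, l) * W (t - 1) a) = (\<Sum>t=1..T. g (t - 1))"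
      by (intro sum.cong) auto
    also have "\<dots> = (\<Sum>t\<in>{0..T-1}. g t)"
      using T by (intro sum.reindex_bij_witness[of _ Suc "\<lambda>t. t - 1"]) auto
    also have "\<dots> = (\<Sum>t\<in>{1..T-1}. g t)"
      using assms(3) by (intro sum.mono_neutral_right) (auto simp: g_def not_le)
    also have "\<dots> = (\<Sum>t=1..T. \<Sum>n=1..N. coeff_W \<theta> t n * W t n)"
    proof (rule sum.mono_neutral_cong_left)
      have "coeff_W \<theta> t n = 0" if "t \<in> {1..T} - {1..T-1}" for t n
      proof -
        have "\<not> t + 1 \<le> T" using that by auto
        then show ?thesis by (simp add: coeff_W_def)
      qed
      then show "\<forall>t\<in>{1..T} - {1..T-1}. (\<Sum>n=1..N. coeff_W \<theta> t n * W t n) = 0" by simp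
      show "g t = (\<Sum>n=1..N. coeff_W \<theta> t n * W t n)" if "t \<in> {1..T-1}" for t
      proof -
        have "t + 1 \<le> T" using that by auto
        then show ?thesis by (simp add: g_def coeff_W_def)
      qed
    qed auto
    finally show ?thesis .
  qed
  finally show ?thesis by (simp add: sum.distrib)
qed

end

section \<open>Averages over independent coordinates\<close>

type_synonym sample = "(nat \<Rightarrow> nat \<Rightarrow> real) \<times> (nat \<times> nat \<Rightarrow> nat \<Rightarrow> real)"

lemma pair_prob_integral_mult:
  fixes f :: "'a \<Rightarrow> 'c::{real_normed_field, banach, second_countable_topology}" and g :: "'b \<Rightarrow> 'c"
  assumes P: "prob_space P" "prob_space Q" and f: "integrable P f" and g: "integrable Q g"
  shows "integrable (P \<Otimes>\<^sub>M Q) (\<lambda>(x, y). f x * g y)"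
    and "(\<integral>(x, y). f x * g y \<partial>(P \<Otimes>\<^sub>M Q)) = (\<integral>x. f x \<partial>P) * (\<integral>y. g y \<partial>Q)"
proof -
  interpret P: prob_space P by fact
  interpret Q: prob_space Q by fact
  interpret pair_sigma_finite P Q ..
  have [measurable]: "f \<in> borel_measurable P" "g \<in> borel_measurable Q" using f g by auto
  show 1: "integrable (P \<Otimes>\<^sub>M Q) (\<lambda>(x, y). f x * g y)"
  proof (rule Fubini_integrable)
    show "integrable P (\<lambda>x. \<integral>y. norm (case (x, y) of (x, y) \<Rightarrow> f x * g y) \<partial>Q)"
      using f by (simp add: norm_mult integrable_norm)
    show "AE x in P. integrable Q (\<lambda>y. case (x, y) of (x, y) \<Rightarrow> f x * g y)"
      using g by simp
  qed measurable
  show "(\<integral>(x, y). f x * g y \<partial>(P \<Otimes>\<^sub>M Q)) = (\<integral>x. f x \<partial>P) * (\<integral>y. g y \<partial>Q)"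
    using integral_fst'[OF 1] by simp
qed

context csmc_model
begin

interpretation target: prob_space \<pi> by (rule target_prob)
interpretation noise: prob_space "noise1 N" by (rule prob_space_gaussian_law) simp

section \<open>Product expectations over coordinates and a quantitative law of large numbers\<close>

lemma prob_space_noise_law: "prob_space (noise_law T D N)"
  unfolding noise_law_def by (intro prob_space_PiM prob_space_gaussian_law) simp

lemma prob_space_target_prod: "prob_space (target_prod T D m G)"
  unfolding target_prod_def by (intro prob_space_PiM target_prob)

definition \<Omega> :: "nat \<Rightarrow> sample measure" where
  "\<Omega> D = target_prod T D m G \<Otimes>\<^sub>M noise_law T D N"

lemma prob_space_\<Omega>: "prob_space (\<Omega> D)"
  unfolding \<Omega>_def by (intro prob_space_pair prob_space_target_prod prob_space_noise_law)

lemma expectation_product: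
  fixes \<alpha> :: "nat \<Rightarrow> (nat \<Rightarrow> real) \<Rightarrow> real" and \<beta> :: "nat \<times> nat \<Rightarrow> (nat \<Rightarrow> real) \<Rightarrow> real"
  assumes \<alpha>: "\<And>d. d \<in> {1..D} \<Longrightarrow> integrable \<pi> (\<alpha> d)"
    and \<beta>: "\<And>i. i \<in> {1..T} \<times> {1..D} \<Longrightarrow> integrable (noise1 N) (\<beta> i)"
  shows "integrable (\<Omega> D) (\<lambda>(x, u). (\<Prod>d=1..D. \<alpha> d (x d)) * (\<Prod>i\<in>{1..T} \<times> {1..D}. \<beta> i (u i)))" (is ?int)
    and "(\<integral>(x, u). (\<Prod>d=1..D. \<alpha> d (x d)) * (\<Prod>i\<in>{1..T} \<times> {1..D}. \<beta> i (u i)) \<partial>\<Omega> D)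
      = (\<Prod>d=1..D. \<integral>x. \<alpha> d x \<partial>\<pi>) * (\<Prod>i\<in>{1..T} \<times> {1..D}. \<integral>u. \<beta> i u \<partial>noise1 N)" (is ?val)
proof -
  interpret A: product_sigma_finite "\<lambda>_::nat. \<pi>" ..
  interpret B: product_sigma_finite "\<lambda>_::nat \<times> nat. noise1 N" ..
  have a: "integrable (target_prod T D m G) (\<lambda>x. \<Prod>d=1..D. \<alpha> d (x d))"
    "(\<integral>x. (\<Prod>d=1..D. \<alpha> d (x d)) \<partial>target_prod T D m G) = (\<Prod>d=1..D. \<integral>x. \<alpha> d x \<partial>\<pi>)"
    unfolding target_prod_def using \<alpha>
    by (auto intro!: A.product_integrable_prod A.product_integral_prod)
  have b: "integrable (noise_law T D N) (\<lambda>u. \<Prod>i\<in>{1..T} \<times> {1..D}. \<beta> i (u i))"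
    "(\<integral>u. (\<Prod>i\<in>{1..T} \<times> {1..D}. \<beta> i (u i)) \<partial>noise_law T D N)
      = (\<Prod>i\<in>{1..T} \<times> {1..D}. \<integral>u. \<beta> i u \<partial>noise1 N)"
    unfolding noise_law_def using \<beta>
    by (auto intro!: B.product_integrable_prod B.product_integral_prod)
  note ab = pair_prob_integral_mult[OF prob_space_target_prod prob_space_noise_law a(1) b(1)]
  show ?int
    unfolding \<Omega>_def by (rule ab(1))
  show ?val
    unfolding \<Omega>_def ab(2) a(2) b(2) ..
qed

text \<open>The contribution of one coordinate to an average. The product form lets all moments
  factor over the state and the noises at the different times.\<close>

definition coordinate_fun ::
  "((nat \<Rightarrow> real) \<Rightarrow> real) \<Rightarrow> (nat \<Rightarrow> (nat \<Rightarrow> real) \<Rightarrow> real) \<Rightarrow> nat \<Rightarrow>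
    sample \<Rightarrow> real" where
  "coordinate_fun h f d z = h (fst z d) * (\<Prod>t=1..T. f t (snd z (t, d)))"

lemma prod_coordinate:
  fixes F :: "nat \<times> nat \<Rightarrow> real"
  assumes "d \<in> {1..D}"
  shows "(\<Prod>i\<in>{1..T} \<times> {1..D}. if snd i = d then F i else 1) = (\<Prod>t=1..T. F (t, d))"
proof -
  have "(\<Prod>i\<in>{1..T} \<times> {1..D}. if snd i = d then F i else 1) = (\<Prod>t=1..T. \<Prod>e=1..D. if e = d then F (t, e) else 1)"
    by (subst prod.cartesian_product) (auto intro!: prod.cong)
  then show ?thesis using assms by simp
qed

lemma coordinate_fun_moment1:
  assumes d: "d \<in> {1..D}" and h: "integrable \<pi> h" and f: "\<And>t. t \<in> {1..T} \<Longrightarrow> integrable (noise1 N) (f t)"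
  shows "integrable (\<Omega> D) (coordinate_fun h f d)"
    and "(\<integral>z. coordinate_fun h f d z \<partial>\<Omega> D) = (\<integral>x. h x \<partial>\<pi>) * (\<Prod>t=1..T. \<integral>u. f t u \<partial>noise1 N)" (is ?val)
proof -
  define \<alpha> where "\<alpha> e x = (if e = d then h x else 1)" for e and x :: "nat \<Rightarrow> real"
  define \<beta> where "\<beta> i u = (if snd i = d then f (fst i) u else 1)" for i :: "nat \<times> nat" and u :: "nat \<Rightarrow> real"
  have \<alpha>: "integrable \<pi> (\<alpha> e)" for e using h by (cases "e = d") (auto simp: \<alpha>_def[abs_def])
  have \<beta>: "integrable (noise1 N) (\<beta> i)" if "i \<in> {1..T} \<times> {1..D}" for i
    using f[of "fst i"] that by (cases "snd i = d") (auto simp: \<beta>_def[abs_def])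
  have eq: "(\<lambda>(x, u). (\<Prod>d=1..D. \<alpha> d (x d)) * (\<Prod>i\<in>{1..T} \<times> {1..D}. \<beta> i (u i))) = coordinate_fun h f d"
    using d prod_coordinate[OF d] by (auto simp: \<alpha>_def \<beta>_def coordinate_fun_def fun_eq_iff)
  have va: "(\<integral>x. \<alpha> e x \<partial>\<pi>) = (if e = d then \<integral>x. h x \<partial>\<pi> else 1)" for e
    by (cases "e = d") (simp_all add: \<alpha>_def target.prob_space)
  have vb: "(\<integral>u. \<beta> i u \<partial>noise1 N) = (if snd i = d then \<integral>u. f (fst i) u \<partial>noise1 N else 1)" for i
    by (cases "snd i = d") (simp_all add: \<beta>_def noise.prob_space)
  note main = expectation_product[of D \<alpha> \<beta>, OF \<alpha> \<beta>, unfolded eq va vb]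
  show "integrable (\<Omega> D) (coordinate_fun h f d)" using main(1) .
  show ?val
    using main(2) d prod_coordinate[OF d] by simp
qed

lemma coordinate_fun_moment2:
  assumes d: "d \<in> {1..D}" "e \<in> {1..D}" and de: "d \<noteq> e"
    and h: "integrable \<pi> h" and f: "\<And>t. t \<in> {1..T} \<Longrightarrow> integrable (noise1 N) (f t)"
  shows "integrable (\<Omega> D) (\<lambda>z. coordinate_fun h f d z * coordinate_fun h f e z)"
    and "(\<integral>z. coordinate_fun h f d z * coordinate_fun h f e z \<partial>\<Omega> D)
      = ((\<integral>x. h x \<partial>\<pi>) * (\<Prod>t=1..T. \<integral>u. f t u \<partial>noise1 N))\<^sup>2" (is ?val)
proof -
  \<comment> \<open>All factors belonging to coordinates other than \<open>d\<close> and
    \<open>e\<close> are set to 1, so one product formula yields the mixed moment.\<close>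
  define \<alpha> where "\<alpha> c x = (if c = d then h x else 1) * (if c = e then h x else 1)" for c and x :: "nat \<Rightarrow> real"
  define \<beta> where "\<beta> i u = (if snd i = d then f (fst i) u else 1) * (if snd i = e then f (fst i) u else 1)"
    for i :: "nat \<times> nat" and u :: "nat \<Rightarrow> real"
  have \<alpha>: "integrable \<pi> (\<alpha> c)" for c using h de by (cases "c = d"; cases "c = e") (auto simp: \<alpha>_def[abs_def])
  have \<beta>: "integrable (noise1 N) (\<beta> i)" if "i \<in> {1..T} \<times> {1..D}" for i
    using f[of "fst i"] that de by (cases "snd i = d"; cases "snd i = e") (auto simp: \<beta>_def[abs_def])
  have eq: "(\<lambda>(x, u). (\<Prod>d=1..D. \<alpha> d (x d)) * (\<Prod>i\<in>{1..T} \<times> {1..D}. \<beta> i (u i)))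
      = (\<lambda>z. coordinate_fun h f d z * coordinate_fun h f e z)"
    using d prod_coordinate[OF d(1)] prod_coordinate[OF d(2)]
    by (auto simp: \<alpha>_def \<beta>_def coordinate_fun_def fun_eq_iff prod.distrib)
  have va: "(\<integral>x. \<alpha> c x \<partial>\<pi>) = (if c = d then \<integral>x. h x \<partial>\<pi> else 1) * (if c = e then \<integral>x. h x \<partial>\<pi> else 1)" for c
    using de by (cases "c = d"; cases "c = e") (simp_all add: \<alpha>_def target.prob_space)
  have vb: "(\<integral>u. \<beta> i u \<partial>noise1 N) = (if snd i = d then \<integral>u. f (fst i) u \<partial>noise1 N else 1)
      * (if snd i = e then \<integral>u. f (fst i) u \<partial>noise1 N else 1)" for i
    using de by (cases "snd i = d"; cases "snd i = e") (simp_all add: \<beta>_def noise.prob_space)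
  note main = expectation_product[of D \<alpha> \<beta>, OF \<alpha> \<beta>, unfolded eq va vb]
  show "integrable (\<Omega> D) (\<lambda>z. coordinate_fun h f d z * coordinate_fun h f e z)" using main(1) .
  show ?val
    using main(2) d prod_coordinate[OF d(1)] prod_coordinate[OF d(2)]
    by (simp add: prod.distrib power2_eq_square)
qed

text \<open>Independence across coordinates bounds the variance of the average by \<sigma> / D. The
  inequality |s| \<le> 1 / (2 * r) + r * s^2 / 2 with r = sqrt D balances the two terms and converts
  this into an L1 rate.\<close>

lemma coordinate_average_bound:
  assumes h: "integrable \<pi> h" "integrable \<pi> (\<lambda>x. (h x)\<^sup>2)"
    and f: "\<And>t. t \<in> {1..T} \<Longrightarrow> integrable (noise1 N) (f t)"
      "\<And>t. t \<in> {1..T} \<Longrightarrow> integrable (noise1 N) (\<lambda>u. (f t u)\<^sup>2)"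
    and D: "1 \<le> D"
  defines "\<mu> \<equiv> (\<integral>x. h x \<partial>\<pi>) * (\<Prod>t=1..T. \<integral>u. f t u \<partial>noise1 N)"
    and "\<sigma> \<equiv> (\<integral>x. (h x)\<^sup>2 \<partial>\<pi>) * (\<Prod>t=1..T. \<integral>u. (f t u)\<^sup>2 \<partial>noise1 N)"
  shows "(\<integral>z. \<bar>(\<Sum>d=1..D. coordinate_fun h f d z) / D - \<mu>\<bar> \<partial>\<Omega> D) \<le> (1 + \<sigma>) / (2 * sqrt D)"
proof -
  interpret \<Omega>: prob_space "\<Omega> D" by (rule prob_space_\<Omega>)
  define Y where "Y = coordinate_fun h f"
  have Y1: "integrable (\<Omega> D) (Y d)" "(\<integral>z. Y d z \<partial>\<Omega> D) = \<mu>" if "d \<in> {1..D}" for d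
    unfolding Y_def \<mu>_def using coordinate_fun_moment1[OF that h(1) f(1)] by auto
  have "coordinate_fun h f d z * coordinate_fun h f d z = coordinate_fun (\<lambda>x. (h x)\<^sup>2) (\<lambda>t u. (f t u)\<^sup>2) d z" for d z
    by (simp add: coordinate_fun_def power2_eq_square prod.distrib)
  then have Y2: "integrable (\<Omega> D) (\<lambda>z. Y d z * Y e z)"
    "(\<integral>z. Y d z * Y e z \<partial>\<Omega> D) = (if d = e then \<sigma> - \<mu>\<^sup>2 else 0) + \<mu>\<^sup>2"
    if "d \<in> {1..D}" "e \<in> {1..D}" for d e
    unfolding Y_def \<mu>_def \<sigma>_def
    using coordinate_fun_moment2[OF that _ h(1) f(1)] coordinate_fun_moment1[OF that(1) h(2) f(2)]
    by (cases "d = e"; auto)+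
  define S where "S z = (\<Sum>d=1..D. Y d z) / D - \<mu>" for z
  have sq: "(S z)\<^sup>2 = (\<Sum>d=1..D. \<Sum>e=1..D. Y d z * Y e z) / D\<^sup>2 - 2 * \<mu> / D * (\<Sum>d=1..D. Y d z) + \<mu>\<^sup>2" for z
    unfolding S_def sum_product[symmetric] using D by (simp add: power2_eq_square field_simps)
  have Sint: "integrable (\<Omega> D) S" unfolding S_def[abs_def]
    by (intro Bochner_Integration.integrable_diff integrable_divide_zero Bochner_Integration.integrable_sum
        \<Omega>.integrable_const Y1)
  have S2int: "integrable (\<Omega> D) (\<lambda>z. (S z)\<^sup>2)" unfolding sq
    by (intro Bochner_Integration.integrable_add Bochner_Integration.integrable_diff integrable_divide_zero
        integrable_mult_right Bochner_Integration.integrable_sum \<Omega>.integrable_const Y1 Y2(1))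
  have "(\<integral>z. (S z)\<^sup>2 \<partial>\<Omega> D) = (\<Sum>d=1..D. \<Sum>e=1..D. (if d = e then \<sigma> - \<mu>\<^sup>2 else 0) + \<mu>\<^sup>2) / D\<^sup>2
      - 2 * \<mu> / D * (\<Sum>d=1..D. \<mu>) + \<mu>\<^sup>2"
  proof -
    have A: "integrable (\<Omega> D) (\<lambda>z. \<Sum>d=1..D. \<Sum>e=1..D. Y d z * Y e z)"
      "(\<integral>z. (\<Sum>d=1..D. \<Sum>e=1..D. Y d z * Y e z) \<partial>\<Omega> D)
        = (\<Sum>d=1..D. \<Sum>e=1..D. (if d = e then \<sigma> - \<mu>\<^sup>2 else 0) + \<mu>\<^sup>2)"
      by (auto intro!: Bochner_Integration.integrable_sum Y2(1) sum.cong Y2(2)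
          simp: Bochner_Integration.integral_sum Y2(1) simp del: atLeastAtMost_iff)
    have B: "integrable (\<Omega> D) (\<lambda>z. \<Sum>d=1..D. Y d z)"
      "(\<integral>z. (\<Sum>d=1..D. Y d z) \<partial>\<Omega> D) = (\<Sum>d=1..D. \<mu>)"
      by (auto intro!: Bochner_Integration.integrable_sum Y1(1) sum.cong Y1(2)
          simp: Bochner_Integration.integral_sum Y1(1) simp del: atLeastAtMost_iff sum_constant)
    show ?thesis
      unfolding sq
      by (subst Bochner_Integration.integral_add, intro Bochner_Integration.integrable_diff integrable_divide_zero
            integrable_mult_right A B, simp, subst Bochner_Integration.integral_diff,
          intro integrable_divide_zero A, intro integrable_mult_right B)
         (simp add: A(2) B(2) \<Omega>.prob_space del: sum_constant)
  qed
  also have "\<dots> = (\<sigma> - \<mu>\<^sup>2) / D"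
    using D by (simp add: sum.distrib power2_eq_square field_simps)
  also have "\<dots> \<le> \<sigma> / D" by (simp add: divide_right_mono)
  finally have var: "(\<integral>z. (S z)\<^sup>2 \<partial>\<Omega> D) \<le> \<sigma> / D" .
  have sD: "0 < sqrt D" "sqrt D * sqrt D = D" using D by auto
  have pt: "\<bar>S z\<bar> \<le> 1 / (2 * sqrt D) + sqrt D / 2 * (S z)\<^sup>2" for z
  proof -
    have "0 \<le> (1 - sqrt D * \<bar>S z\<bar>)\<^sup>2" by simp
    then have "2 * (sqrt D * \<bar>S z\<bar>) \<le> 1 + (sqrt D * sqrt D) * (S z)\<^sup>2"
      by (simp add: power2_eq_square algebra_simps)
    then have "2 * (sqrt D * \<bar>S z\<bar>) / (2 * sqrt D) \<le> (1 + (sqrt D * sqrt D) * (S z)\<^sup>2) / (2 * sqrt D)"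
      using sD by (intro divide_right_mono) auto
    then show ?thesis using sD(1) by (simp add: add_divide_distrib del: real_sqrt_mult_self)
  qed
  have "(\<integral>z. \<bar>S z\<bar> \<partial>\<Omega> D) \<le> (\<integral>z. 1 / (2 * sqrt D) + sqrt D / 2 * (S z)\<^sup>2 \<partial>\<Omega> D)"
    using Sint S2int by (intro integral_mono pt) auto
  also have "\<dots> = 1 / (2 * sqrt D) + sqrt D / 2 * (\<integral>z. (S z)\<^sup>2 \<partial>\<Omega> D)"
    using S2int by (simp add: \<Omega>.prob_space)
  also have "\<dots> \<le> 1 / (2 * sqrt D) + sqrt D / 2 * (\<sigma> / D)"
    using var sD by (intro add_left_mono mult_left_mono) auto
  also have "sqrt D / 2 * (\<sigma> / D) = \<sigma> / (2 * sqrt D)"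
    using sD by (simp add: field_simps)
  finally show ?thesis by (simp add: S_def Y_def add_divide_distrib)
qed

lemma coordinate_average_integrable:
  assumes "integrable \<pi> h" "\<And>t. t \<in> {1..T} \<Longrightarrow> integrable (noise1 N) (f t)"
  shows "integrable (\<Omega> D) (\<lambda>z. (\<Sum>d=1..D. coordinate_fun h f d z) / D - c)"
proof -
  interpret \<Omega>: prob_space "\<Omega> D" by (rule prob_space_\<Omega>)
  show ?thesis
    by (intro Bochner_Integration.integrable_diff integrable_divide_zero Bochner_Integration.integrable_sum
        \<Omega>.integrable_const coordinate_fun_moment1(1) assms)
qed

theorem coordinate_average_tendsto:
  assumes "integrable \<pi> h" "integrable \<pi> (\<lambda>x. (h x)\<^sup>2)"
    and "\<And>t. t \<in> {1..T} \<Longrightarrow> integrable (noise1 N) (f t)"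
      "\<And>t. t \<in> {1..T} \<Longrightarrow> integrable (noise1 N) (\<lambda>u. (f t u)\<^sup>2)"
    and \<mu>: "\<mu> = (\<integral>x. h x \<partial>\<pi>) * (\<Prod>t=1..T. \<integral>u. f t u \<partial>noise1 N)"
  shows "(\<lambda>D. \<integral>z. \<bar>(\<Sum>d=1..D. coordinate_fun h f d z) / D - \<mu>\<bar> \<partial>\<Omega> D) \<longlonglongrightarrow> 0"
proof -
  define \<sigma> where "\<sigma> = (\<integral>x. (h x)\<^sup>2 \<partial>\<pi>) * (\<Prod>t=1..T. \<integral>u. (f t u)\<^sup>2 \<partial>noise1 N)"
  have lim: "(\<lambda>D. (1 + \<sigma>) / (2 * sqrt (real D))) \<longlonglongrightarrow> 0"
    by (intro tendsto_divide_0[OF tendsto_const] filterlim_at_top_imp_at_infinity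
        filterlim_tendsto_pos_mult_at_top[OF tendsto_const]
        filterlim_compose[OF sqrt_at_top filterlim_real_sequentially]) simp
  have le: "eventually (\<lambda>D. (\<integral>z. \<bar>(\<Sum>d=1..D. coordinate_fun h f d z) / D - \<mu>\<bar> \<partial>\<Omega> D)
      \<le> (1 + \<sigma>) / (2 * sqrt (real D))) sequentially"
    using eventually_ge_at_top[of 1]
    by eventually_elim (use coordinate_average_bound[OF assms(1-4)] in \<open>simp add: \<mu> \<sigma>_def\<close>)
  show ?thesis
    by (rule tendsto_sandwich[OF _ le tendsto_const lim]) simp
qed

text \<open>Convergence to 0 in L1 along probability spaces that change with D. Requiring
  integrability from D = 1 on allows division by D throughout.\<close>

definition L1_null :: "(nat \<Rightarrow> sample \<Rightarrow> real) \<Rightarrow> bool" where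
  "L1_null f \<longleftrightarrow> (\<forall>D\<ge>1. integrable (\<Omega> D) (f D)) \<and> (\<lambda>D. \<integral>z. \<bar>f D z\<bar> \<partial>\<Omega> D) \<longlonglongrightarrow> 0"

lemma L1_null_integral_tendsto: "L1_null f \<Longrightarrow> (\<lambda>D. \<integral>z. f D z \<partial>\<Omega> D) \<longlonglongrightarrow> 0"
  unfolding L1_null_def
  by (elim conjE Lim_null_comparison[rotated]) (auto intro!: always_eventually integral_abs_bound)

lemma L1_null_bound:
  assumes g: "L1_null g" and f: "\<And>D. f D \<in> borel_measurable (\<Omega> D)"
    and fg: "\<And>D z. 1 \<le> D \<Longrightarrow> \<bar>f D z\<bar> \<le> g D z"
  shows "L1_null f"
proof -
  have int: "integrable (\<Omega> D) (f D)" if "1 \<le> D" for D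
  proof (rule Bochner_Integration.integrable_bound)
    show "integrable (\<Omega> D) (g D)" using g that by (simp add: L1_null_def)
    show "AE z in \<Omega> D. norm (f D z) \<le> norm (g D z)"
      using fg[OF that] by (intro AE_I2) (auto intro: order_trans[OF _ abs_ge_self])
  qed (rule f)
  have le: "eventually (\<lambda>D. (\<integral>z. \<bar>f D z\<bar> \<partial>\<Omega> D) \<le> (\<integral>z. \<bar>g D z\<bar> \<partial>\<Omega> D)) sequentially"
    using eventually_ge_at_top[of 1]
  proof eventually_elim
    case (elim D)
    have "integrable (\<Omega> D) (g D)" using g elim by (simp add: L1_null_def)
    then show ?case
      using int[OF elim] fg[OF elim] by (intro integral_mono) (auto intro: order_trans[OF _ abs_ge_self])
  qed
  have "(\<lambda>D. \<integral>z. \<bar>f D z\<bar> \<partial>\<Omega> D) \<longlonglongrightarrow> 0"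
    by (rule tendsto_sandwich[OF _ le tendsto_const]) (use g in \<open>simp_all add: L1_null_def\<close>)
  with int show ?thesis by (simp add: L1_null_def)
qed

lemma L1_null_zero: "L1_null (\<lambda>_ _. 0)" by (simp add: L1_null_def)

lemma L1_null_abs: "L1_null f \<Longrightarrow> L1_null (\<lambda>D z. \<bar>f D z\<bar>)"
  by (simp add: L1_null_def)

lemma L1_null_mult:
  assumes "L1_null f" "r \<longlonglongrightarrow> c"
  shows "L1_null (\<lambda>D z. r D * f D z)"
proof -
  have "(\<lambda>D. \<bar>r D\<bar> * (\<integral>z. \<bar>f D z\<bar> \<partial>\<Omega> D)) \<longlonglongrightarrow> \<bar>c\<bar> * 0"
    using assms by (intro tendsto_intros) (simp_all add: L1_null_def)
  then show ?thesis using assms by (simp add: L1_null_def abs_mult)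
qed

lemmas L1_null_cmult = L1_null_mult[OF _ tendsto_const]

lemma L1_null_deterministic:
  assumes "r \<longlonglongrightarrow> 0"
  shows "L1_null (\<lambda>D z. r D)"
proof -
  interpret \<Omega>: prob_space "\<Omega> D" for D by (rule prob_space_\<Omega>)
  show ?thesis using tendsto_rabs_zero[OF assms] by (simp add: L1_null_def \<Omega>.prob_space)
qed

lemma L1_null_add:
  assumes f: "L1_null f" and g: "L1_null g"
  shows "L1_null (\<lambda>D z. f D z + g D z)"
proof -
  have le: "eventually (\<lambda>D. (\<integral>z. \<bar>f D z + g D z\<bar> \<partial>\<Omega> D)
      \<le> (\<integral>z. \<bar>f D z\<bar> \<partial>\<Omega> D) + (\<integral>z. \<bar>g D z\<bar> \<partial>\<Omega> D)) sequentially"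
    using eventually_ge_at_top[of 1]
  proof eventually_elim
    case (elim D)
    have "integrable (\<Omega> D) (f D)" "integrable (\<Omega> D) (g D)" using f g elim by (simp_all add: L1_null_def)
    note int = this
    have "(\<integral>z. \<bar>f D z + g D z\<bar> \<partial>\<Omega> D) \<le> (\<integral>z. \<bar>f D z\<bar> + \<bar>g D z\<bar> \<partial>\<Omega> D)"
      by (rule integral_mono) (use int in auto)
    then show ?case using int by simp
  qed
  have "(\<lambda>D. (\<integral>z. \<bar>f D z\<bar> \<partial>\<Omega> D) + (\<integral>z. \<bar>g D z\<bar> \<partial>\<Omega> D)) \<longlonglongrightarrow> 0 + 0"
    using f g by (intro tendsto_add) (simp_all add: L1_null_def)
  then have "(\<lambda>D. \<integral>z. \<bar>f D z + g D z\<bar> \<partial>\<Omega> D) \<longlonglongrightarrow> 0"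
    by (intro tendsto_sandwich[OF _ le tendsto_const]) simp_all
  then show ?thesis using f g by (simp add: L1_null_def)
qed

lemma L1_null_sum: "finite I \<Longrightarrow> (\<And>i. i \<in> I \<Longrightarrow> L1_null (f i)) \<Longrightarrow> L1_null (\<lambda>D z. \<Sum>i\<in>I. f i D z)"
  by (induction I rule: finite_induct) (auto intro: L1_null_zero L1_null_add)

lemma L1_null_cong:
  assumes "L1_null f" "\<And>D z. 1 \<le> D \<Longrightarrow> f D z = g D z"
  shows "L1_null g"
proof -
  have "eventually (\<lambda>D. (\<integral>z. \<bar>f D z\<bar> \<partial>\<Omega> D) = (\<integral>z. \<bar>g D z\<bar> \<partial>\<Omega> D)) sequentially"
    using eventually_ge_at_top[of 1] by eventually_elim (simp add: assms(2))
  moreover have "integrable (\<Omega> D) (g D)" if "1 \<le> D" for D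
    using assms that by (metis (no_types, lifting) ext L1_null_def)
  ultimately show ?thesis using assms(1) by (auto simp: L1_null_def elim: Lim_transform_eventually)
qed

section \<open>Laws of large numbers in L1\<close>

lemma L1_null_average:
  assumes "integrable \<pi> h" "integrable \<pi> (\<lambda>x. (h x)\<^sup>2)"
    and "\<And>t. t \<in> {1..T} \<Longrightarrow> integrable (noise1 N) (f t)"
      "\<And>t. t \<in> {1..T} \<Longrightarrow> integrable (noise1 N) (\<lambda>u. (f t u)\<^sup>2)"
    and "\<mu> = (\<integral>x. h x \<partial>\<pi>) * (\<Prod>t=1..T. \<integral>u. f t u \<partial>noise1 N)"
  shows "L1_null (\<lambda>D z. (\<Sum>d=1..D. coordinate_fun h f d z) / D - \<mu>)"
  unfolding L1_null_def
  using coordinate_average_integrable[OF assms(1,3)] coordinate_average_tendsto[OF assms] by simp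

lemma L1_null_average_state:
  assumes h: "integrable \<pi> h" "integrable \<pi> (\<lambda>x. (h x)\<^sup>2)"
  shows "L1_null (\<lambda>D z. (\<Sum>d=1..D. h (fst z d)) / D - (\<integral>x. h x \<partial>\<pi>))"
  using L1_null_average[OF h, of "\<lambda>_ _. 1" "\<integral>x. h x \<partial>\<pi>"]
  by (simp add: coordinate_fun_def noise.prob_space)

lemma L1_null_average_single:
  assumes t: "t \<in> {1..T}" and h: "integrable \<pi> h" "integrable \<pi> (\<lambda>x. (h x)\<^sup>2)"
    and g: "integrable (noise1 N) g" "integrable (noise1 N) (\<lambda>u. (g u)\<^sup>2)"
  shows "L1_null (\<lambda>D z. (\<Sum>d=1..D. h (fst z d) * g (snd z (t, d))) / D - (\<integral>x. h x \<partial>\<pi>) * (\<integral>u. g u \<partial>noise1 N))"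
proof -
  define f where "f s = (if s = t then g else (\<lambda>_. 1))" for s
  have c: "coordinate_fun h f d z = h (fst z d) * g (snd z (t, d))" for d z
  proof -
    have "(\<Prod>s=1..T. f s (snd z (s, d))) = (\<Prod>s=1..T. if s = t then g (snd z (t, d)) else 1)"
      by (intro prod.cong) (auto simp: f_def)
    then show ?thesis using t by (simp add: coordinate_fun_def)
  qed
  have i: "(\<integral>u. f s u \<partial>noise1 N) = (if s = t then \<integral>u. g u \<partial>noise1 N else 1)" for s
    by (auto simp: f_def noise.prob_space)
  have "integrable (noise1 N) (f s)" "integrable (noise1 N) (\<lambda>u. (f s u)\<^sup>2)" for s
    using g by (auto simp: f_def)
  from L1_null_average[of h f, OF h this, of "(\<integral>x. h x \<partial>\<pi>) * (\<integral>u. g u \<partial>noise1 N)"] show ?thesis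
    using t by (simp add: c i)
qed

text \<open>Noises at distinct times are independent, so the centred factor \<open>g\<close> makes
  the limiting mean vanish whatever \<open>h\<close> and \<open>g'\<close> are.\<close>

lemma L1_null_average_pair:
  assumes t: "t \<in> {1..T}" "t' \<in> {1..T}" "t \<noteq> t'" and h: "integrable \<pi> h" "integrable \<pi> (\<lambda>x. (h x)\<^sup>2)"
    and g: "integrable (noise1 N) g" "integrable (noise1 N) (\<lambda>u. (g u)\<^sup>2)" "(\<integral>u. g u \<partial>noise1 N) = 0"
    and g': "integrable (noise1 N) g'" "integrable (noise1 N) (\<lambda>u. (g' u)\<^sup>2)"
  shows "L1_null (\<lambda>D z. (\<Sum>d=1..D. h (fst z d) * g (snd z (t, d)) * g' (snd z (t', d))) / D)"
proof -
  define f where "f s = (if s = t then g else if s = t' then g' else (\<lambda>_. 1))" for s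
  have c: "coordinate_fun h f d z = h (fst z d) * g (snd z (t, d)) * g' (snd z (t', d))" for d z
  proof -
    have "(\<Prod>s=1..T. f s (snd z (s, d)))
        = (\<Prod>s=1..T. (if s = t then g (snd z (t, d)) else 1) * (if s = t' then g' (snd z (t', d)) else 1))"
      using t by (intro prod.cong) (auto simp: f_def)
    also have "\<dots> = g (snd z (t, d)) * g' (snd z (t', d))" using t by (simp add: prod.distrib)
    finally show ?thesis by (simp add: coordinate_fun_def)
  qed
  have "(\<integral>u. f t u \<partial>noise1 N) = 0" using g by (simp add: f_def)
  then have zero: "(\<Prod>s=1..T. \<integral>u. f s u \<partial>noise1 N) = 0" using t by (intro prod_zero) auto
  have "integrable (noise1 N) (f s)" "integrable (noise1 N) (\<lambda>u. (f s u)\<^sup>2)" for s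
    using g g' by (auto simp: f_def)
  from L1_null_average[of h f, OF h this, of 0] show ?thesis by (simp add: c zero)
qed

section \<open>Empirical moments of the proposal increments\<close>

definition noise_entry :: "nat \<Rightarrow> (nat \<Rightarrow> real) \<Rightarrow> real" where
  "noise_entry n v = (if n = 0 then 0 else v n)"

lemma noise_entry_moments:
  assumes "n \<le> N"
  shows "integrable (noise1 N) (noise_entry n)" "integrable (noise1 N) (\<lambda>v. (noise_entry n v) ^ k)"
    "integrable (noise1 N) (\<lambda>v. \<bar>noise_entry n v\<bar> ^ k)"
    "(\<integral>v. noise_entry n v \<partial>noise1 N) = 0"
    "(\<integral>v. (noise_entry n v)\<^sup>2 \<partial>noise1 N) = (if n = 0 then 0 else 1)"
proof -
  have "n = 0 \<or> n \<in> {1..N}" using assms by auto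
  then show "integrable (noise1 N) (\<lambda>v. (noise_entry n v) ^ k)" "integrable (noise1 N) (\<lambda>v. \<bar>noise_entry n v\<bar> ^ k)"
    "(\<integral>v. noise_entry n v \<partial>noise1 N) = 0" "(\<integral>v. (noise_entry n v)\<^sup>2 \<partial>noise1 N) = (if n = 0 then 0 else 1)" for k
    by (auto simp: noise_entry_def noise1_moments)
  from this(1)[of 1] show "integrable (noise1 N) (noise_entry n)" by simp
qed

text \<open>The displacement of a particle from the current state. The zeros at n = 0 (the reference
  particle) and at the dummy time 0 allow t - 1 to be used uniformly, including t = 1.\<close>

definition step :: "nat \<Rightarrow> nat \<Rightarrow> nat \<Rightarrow> nat \<Rightarrow> sample \<Rightarrow> real" where
  "step D t n d z = (if t = 0 then 0 else sqrt (ell t / D) * noise_entry n (snd z (t, d)))"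

lemma step_0 [simp]: "step D 0 n d z = 0" "step D t 0 d z = 0"
  by (simp_all add: step_def noise_entry_def)

text \<open>D summands of order D^(-3/2), so the sum is of order D^(-1/2): Taylor remainders of
  third order disappear.\<close>

lemma step_cubic_null:
  assumes t: "t \<le> T" and n: "n \<le> N"
  shows "L1_null (\<lambda>D z. \<Sum>d=1..D. \<bar>step D t n d z\<bar> ^ 3)"
proof (cases "t = 0")
  case True
  then show ?thesis by (simp add: L1_null_zero)
next
  case False
  with t have t': "t \<in> {1..T}" by auto
  define c where "c = (\<integral>v. \<bar>noise_entry n v\<bar> ^ 3 \<partial>noise1 N)"
  define A where "A D z = (\<Sum>d=1..D. 1 * \<bar>noise_entry n (snd z (t, d))\<bar> ^ 3) / real D - c" for D and z :: "sample"
  have "L1_null (\<lambda>D z. (\<Sum>d=1..D. 1 * \<bar>noise_entry n (snd z (t, d))\<bar> ^ 3) / D - (\<integral>x. 1 \<partial>\<pi>) * c)"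
    unfolding c_def
    by (rule L1_null_average_single[OF t'])
       (use noise_entry_moments[OF n] in \<open>simp_all add: power_mult[symmetric]\<close>)
  then have A: "L1_null A" by (simp add: A_def[abs_def] target.prob_space)
  have eq: "(\<Sum>d=1..D. \<bar>step D t n d z\<bar> ^ 3) = ell t * sqrt (ell t / D) * (A D z + c)" if D: "1 \<le> D" for D z
  proof -
    have "\<bar>step D t n d z\<bar> ^ 3 = sqrt (ell t / D) * (ell t / D) * \<bar>noise_entry n (snd z (t, d))\<bar> ^ 3" for d
    proof -
      have r: "sqrt (ell t / D) * sqrt (ell t / D) = ell t / D" "0 \<le> sqrt (ell t / D)"
        using ell_pos[OF t'] by simp_all
      have "\<bar>step D t n d z\<bar> ^ 3 = sqrt (ell t / D) ^ 3 * \<bar>noise_entry n (snd z (t, d))\<bar> ^ 3"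
        using False r(2) by (simp add: step_def abs_mult power_mult_distrib)
      also have "sqrt (ell t / D) ^ 3 = sqrt (ell t / D) * (sqrt (ell t / D) * sqrt (ell t / D))"
        by (simp only: power3_eq_cube mult.assoc)
      finally show ?thesis by (simp only: r(1))
    qed
    then have "(\<Sum>d=1..D. \<bar>step D t n d z\<bar> ^ 3)
        = sqrt (ell t / D) * (ell t / D) * (\<Sum>d=1..D. \<bar>noise_entry n (snd z (t, d))\<bar> ^ 3)"
      by (simp add: sum_distrib_left)
    then show ?thesis using D by (simp add: A_def)
  qed
  have "(\<lambda>D. ell t * sqrt (ell t / real D)) \<longlonglongrightarrow> ell t * sqrt 0"
    by (intro tendsto_intros tendsto_real_sqrt lim_const_over_n)
  then have r: "(\<lambda>D. ell t * sqrt (ell t / real D)) \<longlonglongrightarrow> 0" by simp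
  have "L1_null (\<lambda>D z. ell t * sqrt (ell t / D) * A D z + ell t * sqrt (ell t / D) * c)"
    by (intro L1_null_add L1_null_mult[OF A r] L1_null_deterministic tendsto_mult_left_zero r)
  then show ?thesis by (rule L1_null_cong) (simp only: eq distrib_left)
qed

text \<open>D summands of order 1 / D: an average that does not vanish. Its limit is the source of
  the deterministic means of V and W.\<close>

lemma step_square_null:
  assumes t: "t \<le> T" and n: "n \<le> N"
    and h: "t \<noteq> 0 \<Longrightarrow> integrable \<pi> h" "t \<noteq> 0 \<Longrightarrow> integrable \<pi> (\<lambda>x. (h x)\<^sup>2)"
  shows "L1_null (\<lambda>D z. (\<Sum>d=1..D. h (fst z d) * (step D t n d z)\<^sup>2) - (if n = 0 \<or> t = 0 then 0 else ell t * (\<integral>x. h x \<partial>\<pi>)))"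
proof (cases "t = 0")
  case True
  then show ?thesis by (simp add: L1_null_zero)
next
  case False
  with t have t': "t \<in> {1..T}" by auto
  have "L1_null (\<lambda>D z. (\<Sum>d=1..D. h (fst z d) * (noise_entry n (snd z (t, d)))\<^sup>2) / D
      - (\<integral>x. h x \<partial>\<pi>) * (\<integral>v. (noise_entry n v)\<^sup>2 \<partial>noise1 N))"
    by (rule L1_null_average_single[OF t' h[OF False]])
       (use noise_entry_moments[OF n] in \<open>simp_all add: power_mult[symmetric]\<close>)
  from L1_null_cmult[OF this, of "ell t"] show ?thesis
  proof (rule L1_null_cong)
    fix D :: nat and z assume D: "1 \<le> D"
    have "(step D t n d z)\<^sup>2 = ell t / D * (noise_entry n (snd z (t, d)))\<^sup>2" for d
      using False ell_pos[OF t'] by (simp add: step_def power_mult_distrib)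
    then have "(\<Sum>d=1..D. h (fst z d) * (step D t n d z)\<^sup>2)
        = ell t / D * (\<Sum>d=1..D. h (fst z d) * (noise_entry n (snd z (t, d)))\<^sup>2)"
      by (simp add: sum_distrib_left mult_ac)
    then show "ell t * ((\<Sum>d=1..D. h (fst z d) * (noise_entry n (snd z (t, d)))\<^sup>2) / D
      - (\<integral>x. h x \<partial>\<pi>) * (\<integral>v. (noise_entry n v)\<^sup>2 \<partial>noise1 N))
      = (\<Sum>d=1..D. h (fst z d) * (step D t n d z)\<^sup>2) - (if n = 0 \<or> t = 0 then 0 else ell t * (\<integral>x. h x \<partial>\<pi>))"
      using False noise_entry_moments(5)[OF n] by (simp add: algebra_simps)
  qed
qed

lemma step_cross_null:
  assumes t: "t \<le> T" "t' \<le> T" "t \<noteq> t'" and n: "n \<le> N" "n' \<le> N"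
    and h: "t \<noteq> 0 \<Longrightarrow> t' \<noteq> 0 \<Longrightarrow> integrable \<pi> h" "t \<noteq> 0 \<Longrightarrow> t' \<noteq> 0 \<Longrightarrow> integrable \<pi> (\<lambda>x. (h x)\<^sup>2)"
  shows "L1_null (\<lambda>D z. \<Sum>d=1..D. h (fst z d) * step D t n d z * step D t' n' d z)"
proof (cases "t = 0 \<or> t' = 0")
  case True
  then show ?thesis by (auto simp: L1_null_zero)
next
  case False
  with t have t': "t \<in> {1..T}" "t' \<in> {1..T}" by auto
  have "L1_null (\<lambda>D z. (\<Sum>d=1..D. h (fst z d) * noise_entry n (snd z (t, d)) * noise_entry n' (snd z (t', d))) / D)"
    by (rule L1_null_average_pair[OF t' t(3)])
       (use noise_entry_moments[OF n(1)] noise_entry_moments[OF n(2)] h False in auto)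
  from L1_null_cmult[OF this, of "sqrt (ell t) * sqrt (ell t')"] show ?thesis
  proof (rule L1_null_cong)
    fix D :: nat and z assume D: "1 \<le> D"
    have "h (fst z d) * step D t n d z * step D t' n' d z
        = sqrt (ell t) * sqrt (ell t') * (h (fst z d) * noise_entry n (snd z (t, d)) * noise_entry n' (snd z (t', d))) / D" for d
    proof -
      have "sqrt (ell t / D) * sqrt (ell t' / D) = sqrt (ell t) * sqrt (ell t') / D"
        by (simp add: real_sqrt_divide)
      then show ?thesis using False by (simp add: step_def mult_ac) (simp add: mult.assoc[symmetric])
    qed
    then show "sqrt (ell t) * sqrt (ell t') * ((\<Sum>d=1..D. h (fst z d) * noise_entry n (snd z (t, d)) * noise_entry n' (snd z (t', d))) / D)
      = (\<Sum>d=1..D. h (fst z d) * step D t n d z * step D t' n' d z)"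
      by (simp add: sum_distrib_left sum_divide_distrib)
  qed
qed

section \<open>Expansion of the log-weight ratios\<close>

text \<open>The variable x_t enters two log-weights, as second argument of \<open>w t\<close> and as
  first argument of \<open>w (t + 1)\<close>. The suffixes V and W in this and the following
  definitions refer to these two roles; \<open>hess_VW t\<close> couples x_t with x_(t+1).\<close>

definition score_V :: "nat \<Rightarrow> (nat \<Rightarrow> real) \<Rightarrow> real" where
  "score_V t x = deriv_snd (w t) (x (t - 1)) (x t)"
definition score_W :: "nat \<Rightarrow> (nat \<Rightarrow> real) \<Rightarrow> real" where
  "score_W t x = deriv_fst (w (t + 1)) (x t) (x (t + 1))"
definition hess_V :: "nat \<Rightarrow> (nat \<Rightarrow> real) \<Rightarrow> real" where
  "hess_V t x = deriv_snd (deriv_snd (w t)) (x (t - 1)) (x t)"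
definition hess_W :: "nat \<Rightarrow> (nat \<Rightarrow> real) \<Rightarrow> real" where
  "hess_W t x = deriv_fst (deriv_fst (w (t + 1))) (x t) (x (t + 1))"
definition hess_VW :: "nat \<Rightarrow> (nat \<Rightarrow> real) \<Rightarrow> real" where
  "hess_VW t x = deriv_fst (deriv_snd (w (t + 1))) (x t) (x (t + 1))"

lemma w_beyond: "T < t \<Longrightarrow> w t = (\<lambda>_ _. 0)"
  by (simp add: log_weight_def fun_eq_iff)

lemma w_initial: "w 1 x y = w 1 x' y"
  by (simp add: log_weight_def init[of x] init[of x'])

lemma derivatives_initial:
  "deriv_fst (w 1) x y = 0" "deriv_snd (w 1) x y = deriv_snd (w 1) x' y"
  "deriv_fst (deriv_fst (w 1)) x y = 0" "deriv_snd (deriv_snd (w 1)) x y = deriv_snd (deriv_snd (w 1)) x' y"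
  "deriv_fst (deriv_snd (w 1)) x y = 0"
proof -
  obtain f where f: "w 1 = (\<lambda>_. f)"
  proof
    show "w 1 = (\<lambda>_. w 1 0)" using w_initial by blast
  qed
  show "deriv_fst (w 1) x y = 0" "deriv_snd (w 1) x y = deriv_snd (w 1) x' y"
    "deriv_fst (deriv_fst (w 1)) x y = 0" "deriv_snd (deriv_snd (w 1)) x y = deriv_snd (deriv_snd (w 1)) x' y"
    "deriv_fst (deriv_snd (w 1)) x y = 0"
    by (simp_all add: f deriv_fst_def deriv_snd_def)
qed

lemma C2_derivatives_w: "t \<in> {1..T} \<Longrightarrow> C2_derivatives (w t)"
  by unfold_locales (rule w_C2)

text \<open>The hypotheses bound derivatives in the first argument for \<open>w (t + 1)\<close>
  only. For \<open>w 1\<close> these derivatives vanish, as its first argument is a dummy.\<close>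

lemma lipschitz_bounded_hess:
  assumes "t \<in> {1..T}"
  shows "lipschitz_bounded (deriv_fst (deriv_fst (w t)))" "lipschitz_bounded (deriv_snd (deriv_snd (w t)))"
    "lipschitz_bounded (deriv_fst (deriv_snd (w t)))"
proof -
  show "lipschitz_bounded (deriv_snd (deriv_snd (w t)))" by (rule w_snd_snd[OF assms])
  have zero: "lipschitz_bounded (\<lambda>_ _. 0)"
    unfolding lipschitz_bounded_def by (auto intro!: exI[of _ 0] lipschitz_onI)
  have "lipschitz_bounded (deriv_fst (deriv_fst (w t))) \<and> lipschitz_bounded (deriv_fst (deriv_snd (w t)))"
  proof (cases "t = 1")
    case True
    have "deriv_fst (deriv_fst (w 1)) = (\<lambda>_ _. 0)" "deriv_fst (deriv_snd (w 1)) = (\<lambda>_ _. 0)"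
      using derivatives_initial by (simp_all add: fun_eq_iff)
    with zero show ?thesis unfolding True by simp
  next
    case False
    with assms have "t - 1 \<in> {1..T}" "t - 1 + 1 = t" by auto
    then show ?thesis using w_fst_fst[of "t - 1"] w_fst_snd[of "t - 1"] by simp
  qed
  then show "lipschitz_bounded (deriv_fst (deriv_fst (w t)))" "lipschitz_bounded (deriv_fst (deriv_snd (w t)))"
    by auto
qed

section \<open>Measurability of scores, increments and log-ratios\<close>

lemma sets_target: "sets \<pi> = sets (\<Pi>\<^sub>M t\<in>{1..T}. borel)"
  unfolding target_def by (simp cong: sets_PiM_cong)

lemma measurable_target_component: "t \<in> {1..T} \<Longrightarrow> (\<lambda>x. x t) \<in> borel_measurable \<pi>"
  unfolding measurable_cong_sets[OF sets_target refl] by (rule measurable_component_singleton)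

text \<open>For t = 1 the first argument is the dummy coordinate at time 0, which is not a component
  of the space; independence of it replaces measurability of \<open>A\<close>.\<close>

lemma measurable_consecutive:
  fixes g :: "real \<Rightarrow> real \<Rightarrow> real"
  assumes g: "continuous_on UNIV (\<lambda>(x, y). g x y)" and t: "t \<in> {1..T}"
    and init: "\<And>x x' y. t = 1 \<Longrightarrow> g x y = g x' y"
    and A: "t \<noteq> 1 \<Longrightarrow> A \<in> borel_measurable M" and B: "B \<in> borel_measurable M"
  shows "(\<lambda>z. g (A z) (B z)) \<in> borel_measurable M"
proof -
  have *: "(\<lambda>z. g (A' z) (B z)) \<in> borel_measurable M" if "A' \<in> borel_measurable M" for A'
  proof -
    have "(\<lambda>(x, y). g x y) \<in> borel_measurable (borel \<Otimes>\<^sub>M borel)"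
      unfolding borel_prod by (rule borel_measurable_continuous_onI[OF g])
    from measurable_compose[OF measurable_Pair[OF that B] this] show ?thesis by simp
  qed
  show ?thesis
  proof (cases "t = 1")
    case True
    have "(\<lambda>z. g (A z) (B z)) = (\<lambda>z. g 0 (B z))" using init[OF True] by blast
    then show ?thesis using *[of "\<lambda>_. 0"] by simp
  next
    case False
    then show ?thesis using * A by blast
  qed
qed

lemma measurable_target_consecutive:
  fixes g :: "real \<Rightarrow> real \<Rightarrow> real"
  assumes "continuous_on UNIV (\<lambda>(x, y). g x y)" "t \<in> {1..T}" "\<And>x x' y. t = 1 \<Longrightarrow> g x y = g x' y"
  shows "(\<lambda>x. g (x (t - 1)) (x t)) \<in> borel_measurable \<pi>"
proof (rule measurable_consecutive[where A="\<lambda>x. x (t - 1)" and B="\<lambda>x. x t", OF assms(1,2)])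
  show "g x y = g x' y" if "t = 1" for x x' y using assms(3)[OF that] .
  show "(\<lambda>x. x (t - 1)) \<in> borel_measurable \<pi>" if "t \<noteq> 1"
    using that assms(2) by (intro measurable_target_component) auto
  show "(\<lambda>x. x t) \<in> borel_measurable \<pi>" by (rule measurable_target_component[OF assms(2)])
qed

lemma measurable_scores:
  assumes t: "t \<in> {1..T}"
  shows "score_V t \<in> borel_measurable \<pi>" "hess_V t \<in> borel_measurable \<pi>"
    "score_W t \<in> borel_measurable \<pi>" "hess_W t \<in> borel_measurable \<pi>" "hess_VW t \<in> borel_measurable \<pi>"
proof -
  interpret C2_derivatives "w t" by (rule C2_derivatives_w[OF t])
  show "score_V t \<in> borel_measurable \<pi>"
    unfolding score_V_def[abs_def]
    by (rule measurable_target_consecutive[OF partial_derivatives(7) t]) (use derivatives_initial in blast)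
  show "hess_V t \<in> borel_measurable \<pi>"
    unfolding hess_V_def[abs_def]
    by (rule measurable_target_consecutive[OF lipschitz_bounded_continuous[OF w_snd_snd[OF t]] t])
       (use derivatives_initial in blast)
  have "score_W t \<in> borel_measurable \<pi> \<and> hess_W t \<in> borel_measurable \<pi> \<and> hess_VW t \<in> borel_measurable \<pi>"
  proof (cases "t = T")
    case True
    then show ?thesis
      unfolding score_W_def[abs_def] hess_W_def[abs_def] hess_VW_def[abs_def]
      by (simp add: w_beyond deriv_fst_def deriv_snd_def)
  next
    case False
    with t have t1: "t + 1 \<in> {1..T}" "t + 1 \<noteq> 1" by auto
    interpret S: C2_derivatives "w (t + 1)" by (rule C2_derivatives_w[OF t1(1)])
    show ?thesis
      unfolding score_W_def[abs_def] hess_W_def[abs_def] hess_VW_def[abs_def]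
      using measurable_target_consecutive[OF S.partial_derivatives(6) t1(1)]
        measurable_target_consecutive[OF lipschitz_bounded_continuous[OF w_fst_fst[OF t]] t1(1)]
        measurable_target_consecutive[OF lipschitz_bounded_continuous[OF w_fst_snd[OF t]] t1(1)] t1(2)
      by simp
  qed
  then show "score_W t \<in> borel_measurable \<pi>" "hess_W t \<in> borel_measurable \<pi>" "hess_VW t \<in> borel_measurable \<pi>"
    by auto
qed

lemma hess_integrable:
  assumes t: "t \<in> {1..T}"
  shows "integrable \<pi> (hess_V t)" "integrable \<pi> (\<lambda>x. (hess_V t x)\<^sup>2)"
    "integrable \<pi> (hess_W t)" "integrable \<pi> (\<lambda>x. (hess_W t x)\<^sup>2)"
    "integrable \<pi> (hess_VW t)" "integrable \<pi> (\<lambda>x. (hess_VW t x)\<^sup>2)"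
proof -
  have *: "integrable \<pi> (\<lambda>x. g (a x) (b x) ^ k)"
    if g: "lipschitz_bounded g" and [measurable]: "(\<lambda>x. g (a x) (b x)) \<in> borel_measurable \<pi>"
    for g :: "real \<Rightarrow> real \<Rightarrow> real" and a b and k :: nat
  proof -
    obtain B where B: "\<And>x y. \<bar>g x y\<bar> \<le> B" using lipschitz_bounded_bound[OF g] by blast
    show ?thesis
      by (rule target.integrable_const_bound[where B = "B ^ k"])
         (use B in \<open>auto simp: power_abs intro!: power_mono\<close>)
  qed
  note 1 = *[OF w_snd_snd[OF t] measurable_scores(2)[OF t, unfolded hess_V_def[abs_def]], folded hess_V_def]
  note 2 = *[OF w_fst_fst[OF t] measurable_scores(4)[OF t, unfolded hess_W_def[abs_def]], folded hess_W_def]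
  note 3 = *[OF w_fst_snd[OF t] measurable_scores(5)[OF t, unfolded hess_VW_def[abs_def]], folded hess_VW_def]
  show "integrable \<pi> (hess_V t)" "integrable \<pi> (\<lambda>x. (hess_V t x)\<^sup>2)"
    "integrable \<pi> (hess_W t)" "integrable \<pi> (\<lambda>x. (hess_W t x)\<^sup>2)"
    "integrable \<pi> (hess_VW t)" "integrable \<pi> (\<lambda>x. (hess_VW t x)\<^sup>2)"
    using 1[of 1] 1[of 2] 2[of 1] 2[of 2] 3[of 1] 3[of 2] by simp_all
qed

lemma measurable_state: "d \<in> {1..D} \<Longrightarrow> (\<lambda>z. fst z d) \<in> \<Omega> D \<rightarrow>\<^sub>M \<pi>"
  unfolding \<Omega>_def target_prod_def by measurable

lemma measurable_noise: "d \<in> {1..D} \<Longrightarrow> t \<in> {1..T} \<Longrightarrow> (\<lambda>z. snd z (t, d)) \<in> \<Omega> D \<rightarrow>\<^sub>M noise1 N"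
  unfolding \<Omega>_def noise_law_def
  by (rule measurable_compose[OF measurable_snd measurable_component_singleton]) simp

lemma measurable_step:
  assumes "d \<in> {1..D}" "t \<le> T" "n \<le> N"
  shows "step D t n d \<in> borel_measurable (\<Omega> D)"
proof (cases "t = 0 \<or> n = 0")
  case True
  then have "step D t n d = (\<lambda>_. 0)" by (auto simp: fun_eq_iff)
  then show ?thesis by simp
next
  case False
  with assms have t: "t \<in> {1..T}" "n \<in> {1..N}" by auto
  have "(\<lambda>z. snd z (t, d) n) \<in> borel_measurable (\<Omega> D)"
    by (rule measurable_compose[OF measurable_noise[OF assms(1) t(1)] measurable_gaussian_component[OF t(2)]])
  then show ?thesis using False by (simp add: step_def[abs_def] noise_entry_def)
qed

text \<open>On the space of \<open>\<Omega> D\<close> the dummy coordinate at time 0 is \<open>undefined\<close>; it is replaced by 0.\<close>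

definition state :: "sample \<Rightarrow> nat \<Rightarrow> nat \<Rightarrow> real" where
  "state z d t = (if t = 0 then 0 else fst z d t)"

lemma measurable_state_component:
  assumes "d \<in> {1..D}" "t \<le> T"
  shows "(\<lambda>z. state z d t) \<in> borel_measurable (\<Omega> D)"
proof (cases "t = 0")
  case False
  then show ?thesis
    using measurable_compose[OF measurable_state[OF assms(1)] measurable_target_component[of t]] assms(2)
    by (simp add: state_def)
qed (simp add: state_def)

definition H :: "nat \<Rightarrow> sample \<Rightarrow> nat \<times> nat \<times> nat \<Rightarrow> real" where
  "H D z = log_ratio D (particles D ell (fst z) (snd z))"

lemma H_eq:
  assumes i: "(t, a, l) \<in> indices"
  shows "H D z (t, a, l) = (\<Sum>d=1..D. w t (state z d (t - 1) + step D (t - 1) a d z) (state z d t + step D t l d z)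
    - w t (state z d (t - 1)) (state z d t))"
proof -
  have t: "t \<in> {1..T}" using i by (simp add: indices_def)
  have p: "particles D ell (fst z) (snd z) s n d = state z d s + step D s n d z" if "s \<noteq> 0" for s n d
    using that by (simp add: particles_def state_def step_def noise_entry_def)
  \<comment> \<open>At t = 1 the dummy particle at time 0 differs from its normalised version, but
    \<open>w 1\<close> ignores it.\<close>
  have "w t (particles D ell (fst z) (snd z) (t - 1) n d) y = w t (state z d (t - 1) + step D (t - 1) n d z) y" for n d y
  proof (cases "t = 1")
    case True
    then show ?thesis using w_initial by blast
  next
    case False
    with t have "t - 1 \<noteq> 0" by auto
    then show ?thesis by (simp add: p)
  qed
  then show ?thesis
    using i t unfolding H_def log_ratio_def by (simp add: p sum_subtractf)
qed

lemma measurable_H: "(\<lambda>z. H D z i) \<in> borel_measurable (\<Omega> D)"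
proof (cases "i \<in> indices")
  case True
  obtain t a l where i: "i = (t, a, l)" using prod_cases3 by blast
  with True have ind: "(t, a, l) \<in> indices" "t \<in> {1..T}" "a \<le> N" "l \<le> N" by (auto simp: indices_def)
  interpret C2_derivatives "w t" by (rule C2_derivatives_w[OF ind(2)])
  have w: "(\<lambda>z. w t (A z) (B z)) \<in> borel_measurable (\<Omega> D)"
    if "A \<in> borel_measurable (\<Omega> D)" "B \<in> borel_measurable (\<Omega> D)" for A B
    by (rule measurable_consecutive[OF continuous_w ind(2)]) (use that w_initial in blast)+
  have "t \<le> T" "t - 1 \<le> T" using ind by auto
  then show ?thesis
    unfolding i H_eq[OF ind(1)]
    using ind(3,4)
    by (intro borel_measurable_sum borel_measurable_diff w borel_measurable_add measurable_step measurable_state_component)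
       auto
next
  case False
  then show ?thesis by (cases i) (simp add: H_def log_ratio_def)
qed

section \<open>First-order approximation with deterministic means\<close>

definition mean_V :: "nat \<Rightarrow> nat \<Rightarrow> real" where
  "mean_V t n = (if n = 0 \<or> t = 0 then 0 else ell t * (\<integral>x. hess_V t x \<partial>\<pi>)) / 2"
definition mean_W :: "nat \<Rightarrow> nat \<Rightarrow> real" where
  "mean_W t n = (if n = 0 \<or> t = 0 then 0 else ell t * (\<integral>x. hess_W t x \<partial>\<pi>)) / 2"

definition V_approx where
  "V_approx D z t n = (\<Sum>d=1..D. score_V t (fst z d) * step D t n d z) + mean_V t n"
definition W_approx where
  "W_approx D z t n = (\<Sum>d=1..D. score_W t (fst z d) * step D t n d z) + mean_W t n"

lemma measurable_approx:
  assumes t: "t \<le> T" and n: "n \<le> N"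
  shows "(\<lambda>z. V_approx D z t n) \<in> borel_measurable (\<Omega> D)" "(\<lambda>z. W_approx D z t n) \<in> borel_measurable (\<Omega> D)"
proof -
  have "(\<lambda>z. V_approx D z t n) \<in> borel_measurable (\<Omega> D) \<and> (\<lambda>z. W_approx D z t n) \<in> borel_measurable (\<Omega> D)"
  proof (cases "t = 0")
    case True
    then show ?thesis by (simp add: V_approx_def W_approx_def)
  next
    case False
    with t have t': "t \<in> {1..T}" by auto
    show ?thesis
      unfolding V_approx_def W_approx_def
      using measurable_compose[OF measurable_state measurable_scores(1)[OF t']]
        measurable_compose[OF measurable_state measurable_scores(3)[OF t']] measurable_step[OF _ t n]
      by (auto intro!: borel_measurable_sum borel_measurable_times borel_measurable_add)
  qed
  then show "(\<lambda>z. V_approx D z t n) \<in> borel_measurable (\<Omega> D)" "(\<lambda>z. W_approx D z t n) \<in> borel_measurable (\<Omega> D)"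
    by auto
qed

text \<open>The error consists of the cubic Taylor remainder, the fluctuations of the two pure
  second-order sums about their limits, and the mixed second-order sum, whose limit is 0 because the
  noises at t - 1 and t are independent. The factor 1 / 2 in the means is that of the Taylor
  expansion.\<close>

theorem H_approx:
  assumes i: "(t, a, l) \<in> indices"
  shows "L1_null (\<lambda>D z. H D z (t, a, l) - (V_approx D z t l + W_approx D z (t - 1) a))"
proof -
  have t: "t \<in> {1..T}" "a \<le> N" "l \<le> N" using i by (auto simp: indices_def)
  then have tT: "t \<le> T" "t - 1 \<le> T" "t - 1 \<noteq> t" and t1: "t - 1 + 1 = t" by auto
  have t1T: "t - 1 \<in> {1..T}" if "t - 1 \<noteq> 0" using that t by auto
  interpret C2_derivatives "w t" by (rule C2_derivatives_w[OF t(1)])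
  obtain C where C: "0 \<le> C" "\<And>x y p q. \<bar>w t (x + p) (y + q) - w t x y - w1 x y * p - w2 x y * q
      - w11 x y * p\<^sup>2 / 2 - w22 x y * q\<^sup>2 / 2 - w12 x y * p * q\<bar> \<le> C * (\<bar>p\<bar> ^ 3 + \<bar>q\<bar> ^ 3)"
    using taylor_bound[OF lipschitz_bounded_hess[OF t(1)]] by blast
  define P where "P D d z = step D (t - 1) a d z" for D d z
  define Q where "Q D d z = step D t l d z" for D d z
  define e1 where "e1 D z = (\<Sum>d=1..D. hess_V t (fst z d) * (Q D d z)\<^sup>2) - (if l = 0 \<or> t = 0 then 0 else ell t * (\<integral>x. hess_V t x \<partial>\<pi>))" for D z
  define e2 where "e2 D z = (\<Sum>d=1..D. hess_W (t - 1) (fst z d) * (P D d z)\<^sup>2)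
      - (if a = 0 \<or> t - 1 = 0 then 0 else ell (t - 1) * (\<integral>x. hess_W (t - 1) x \<partial>\<pi>))" for D z
  define e3 where "e3 D z = (\<Sum>d=1..D. hess_VW (t - 1) (fst z d) * P D d z * Q D d z)" for D z
  define r where "r D z = (\<Sum>d=1..D. \<bar>P D d z\<bar> ^ 3) + (\<Sum>d=1..D. \<bar>Q D d z\<bar> ^ 3)" for D z
  have e1: "L1_null e1" unfolding e1_def[abs_def] Q_def
    by (rule step_square_null) (use t hess_integrable in auto)
  have e2: "L1_null e2" unfolding e2_def[abs_def] P_def
    by (rule step_square_null[OF tT(2) t(2)]) (use t1T hess_integrable in auto)
  have e3: "L1_null e3" unfolding e3_def[abs_def] P_def Q_def
    by (rule step_cross_null[OF tT(2,1,3) t(2,3)]) (use t1T hess_integrable in auto)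
  have r: "L1_null r" unfolding r_def[abs_def] P_def Q_def
    using t tT by (intro L1_null_add step_cubic_null)
  have null: "L1_null (\<lambda>D z. C * r D z + (1 / 2 * \<bar>e1 D z\<bar> + (1 / 2 * \<bar>e2 D z\<bar> + \<bar>e3 D z\<bar>)))"
    by (intro L1_null_add L1_null_cmult L1_null_abs e1 e2 e3 r)
  \<comment> \<open>Replacing the normalised dummy coordinate by the original one is harmless: at t
    = 1 none of these derivatives depends on it.\<close>
  have score: "w1 (state z d (t - 1)) (state z d t) = score_W (t - 1) (fst z d)"
    "w2 (state z d (t - 1)) (state z d t) = score_V t (fst z d)"
    "w11 (state z d (t - 1)) (state z d t) = hess_W (t - 1) (fst z d)"
    "w22 (state z d (t - 1)) (state z d t) = hess_V t (fst z d)"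
    "w12 (state z d (t - 1)) (state z d t) = hess_VW (t - 1) (fst z d)" for z d
  proof -
    have "g (state z d (t - 1)) (state z d t) = g (fst z d (t - 1)) (fst z d t)"
      if "\<And>x x' y. t = 1 \<Longrightarrow> g x y = g x' y" for g :: "real \<Rightarrow> real \<Rightarrow> real"
    proof (cases "t = 1")
      case True
      then show ?thesis using that[OF True, of "state z d (t - 1)" _ "fst z d (t - 1)"] by (simp add: state_def)
    next
      case False
      with t have "t - 1 \<noteq> 0" "t \<noteq> 0" by auto
      then show ?thesis by (simp add: state_def)
    qed
    note * = this
    show "w1 (state z d (t - 1)) (state z d t) = score_W (t - 1) (fst z d)"
      "w2 (state z d (t - 1)) (state z d t) = score_V t (fst z d)"
      "w11 (state z d (t - 1)) (state z d t) = hess_W (t - 1) (fst z d)"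
      "w22 (state z d (t - 1)) (state z d t) = hess_V t (fst z d)"
      "w12 (state z d (t - 1)) (state z d t) = hess_VW (t - 1) (fst z d)"
      unfolding score_W_def score_V_def hess_W_def hess_V_def hess_VW_def t1
      by (rule *; use derivatives_initial in metis)+
  qed
  show ?thesis
  proof (rule L1_null_bound[OF null])
    show "(\<lambda>z. H D z (t, a, l) - (V_approx D z t l + W_approx D z (t - 1) a)) \<in> borel_measurable (\<Omega> D)" for D
      by (intro borel_measurable_diff borel_measurable_add measurable_H measurable_approx tT t)
    fix D z
    define R where "R d = w t (state z d (t - 1) + P D d z) (state z d t + Q D d z) - w t (state z d (t - 1)) (state z d t)
        - score_W (t - 1) (fst z d) * P D d z - score_V t (fst z d) * Q D d z
        - hess_W (t - 1) (fst z d) * (P D d z)\<^sup>2 / 2 - hess_V t (fst z d) * (Q D d z)\<^sup>2 / 2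
        - hess_VW (t - 1) (fst z d) * P D d z * Q D d z" for d
    have R: "\<bar>R d\<bar> \<le> C * (\<bar>P D d z\<bar> ^ 3 + \<bar>Q D d z\<bar> ^ 3)" for d
      using C(2)[of "state z d (t - 1)" "P D d z" "state z d t" "Q D d z"] unfolding R_def score .
    have "\<bar>\<Sum>d=1..D. R d\<bar> \<le> (\<Sum>d=1..D. C * (\<bar>P D d z\<bar> ^ 3 + \<bar>Q D d z\<bar> ^ 3))"
      by (intro order_trans[OF sum_abs] sum_mono R)
    also have "\<dots> = C * r D z" by (simp add: r_def sum_distrib_left sum.distrib distrib_left)
    finally have SR: "\<bar>\<Sum>d=1..D. R d\<bar> \<le> C * r D z" .
    have "(\<Sum>d=1..D. R d) = H D z (t, a, l)
        - (\<Sum>d=1..D. score_W (t - 1) (fst z d) * P D d z) - (\<Sum>d=1..D. score_V t (fst z d) * Q D d z)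
        - (\<Sum>d=1..D. hess_W (t - 1) (fst z d) * (P D d z)\<^sup>2) / 2
        - (\<Sum>d=1..D. hess_V t (fst z d) * (Q D d z)\<^sup>2) / 2 - e3 D z"
      unfolding R_def H_eq[OF i] e3_def P_def Q_def by (simp add: sum_subtractf sum_divide_distrib)
    then have "H D z (t, a, l) - (V_approx D z t l + W_approx D z (t - 1) a)
        = (\<Sum>d=1..D. R d) + (1 / 2 * e1 D z + (1 / 2 * e2 D z + e3 D z))"
      unfolding V_approx_def W_approx_def mean_V_def mean_W_def e1_def e2_def
      unfolding P_def[symmetric] Q_def[symmetric] by (simp add: field_simps)
    also have "\<bar>\<dots>\<bar> \<le> \<bar>\<Sum>d=1..D. R d\<bar> + (\<bar>1 / 2 * e1 D z\<bar> + (\<bar>1 / 2 * e2 D z\<bar> + \<bar>e3 D z\<bar>))"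
      by (intro order_trans[OF abs_triangle_ineq] add_mono order_refl)
    also have "\<dots> \<le> C * r D z + (1 / 2 * \<bar>e1 D z\<bar> + (1 / 2 * \<bar>e2 D z\<bar> + \<bar>e3 D z\<bar>))"
      using SR by (simp add: abs_mult)
    finally show "\<bar>H D z (t, a, l) - (V_approx D z t l + W_approx D z (t - 1) a)\<bar>
        \<le> C * r D z + (1 / 2 * \<bar>e1 D z\<bar> + (1 / 2 * \<bar>e2 D z\<bar> + \<bar>e3 D z\<bar>))" .
  qed
qed

end

section \<open>Convergence of the characteristic functions\<close>

lemma exp_minus_lipschitz:
  fixes a b :: real
  assumes "0 \<le> a" "0 \<le> b"
  shows "\<bar>exp (- a) - exp (- b)\<bar> \<le> \<bar>a - b\<bar>"
proof -
  have *: "exp (- a) - exp (- b) \<le> b - a" if "0 \<le> a" "a \<le> b" for a b :: real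
  proof -
    have "exp (- a) - exp (- b) = exp (- a) * (1 - exp (- (b - a)))"
      by (simp add: right_diff_distrib exp_add[symmetric])
    also have "\<dots> \<le> 1 * (1 - exp (- (b - a)))"
      using that by (intro mult_right_mono) auto
    also have "\<dots> \<le> b - a"
      unfolding mult_1_left using exp_ge_add_one_self[of "- (b - a)"] by linarith
    finally show ?thesis .
  qed
  show ?thesis
    using *[of a b] *[of b a] assms by (cases "a \<le> b") (auto simp: abs_if)
qed

context csmc_model
begin

interpretation target: prob_space \<pi> by (rule target_prob)

interpretation noise: prob_space "noise1 N" by (rule prob_space_gaussian_law) simp

section \<open>Square integrability and second moments of the scores\<close>

definition L2 :: "((nat \<Rightarrow> real) \<Rightarrow> real) \<Rightarrow> bool" where
  "L2 f \<longleftrightarrow> f \<in> borel_measurable \<pi> \<and> integrable \<pi> (\<lambda>x. (f x)\<^sup>2)"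

lemma L2_integrable: "L2 f \<Longrightarrow> integrable \<pi> f"
proof -
  assume f: "L2 f"
  show "integrable \<pi> f"
  proof (rule Bochner_Integration.integrable_bound)
    show "integrable \<pi> (\<lambda>x. 1 + (f x)\<^sup>2)" using f by (simp add: L2_def)
    show "AE x in \<pi>. norm (f x) \<le> norm (1 + (f x)\<^sup>2)"
    proof (rule AE_I2)
      fix x
      have "0 \<le> (\<bar>f x\<bar> - 1)\<^sup>2" by simp
      then have "2 * \<bar>f x\<bar> \<le> 1 + (f x)\<^sup>2" by (simp add: power2_diff)
      then show "norm (f x) \<le> norm (1 + (f x)\<^sup>2)" by simp
    qed
  qed (use f in \<open>simp add: L2_def\<close>)
qed

lemma L2_cmult: "L2 f \<Longrightarrow> L2 (\<lambda>x. c * f x)"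
  by (auto simp: L2_def power_mult_distrib intro: borel_measurable_times)

lemma L2_add:
  assumes "L2 f" "L2 g"
  shows "L2 (\<lambda>x. f x + g x)"
  unfolding L2_def
proof
  have [measurable]: "f \<in> borel_measurable \<pi>" "g \<in> borel_measurable \<pi>" using assms by (auto simp: L2_def)
  show "(\<lambda>x. f x + g x) \<in> borel_measurable \<pi>" by measurable
  show "integrable \<pi> (\<lambda>x. (f x + g x)\<^sup>2)"
  proof (rule Bochner_Integration.integrable_bound)
    show "integrable \<pi> (\<lambda>x. 2 * (f x)\<^sup>2 + 2 * (g x)\<^sup>2)" using assms by (simp add: L2_def)
    show "AE x in \<pi>. norm ((f x + g x)\<^sup>2) \<le> norm (2 * (f x)\<^sup>2 + 2 * (g x)\<^sup>2)"
    proof (rule AE_I2)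
      fix x
      have "0 \<le> (f x - g x)\<^sup>2" by simp
      then have "(f x + g x)\<^sup>2 \<le> 2 * (f x)\<^sup>2 + 2 * (g x)\<^sup>2" by (simp add: power2_diff power2_sum)
      then show "norm ((f x + g x)\<^sup>2) \<le> norm (2 * (f x)\<^sup>2 + 2 * (g x)\<^sup>2)" by simp
    qed
  qed measurable
qed

lemma L2_sum: "finite I \<Longrightarrow> (\<And>i. i \<in> I \<Longrightarrow> L2 (f i)) \<Longrightarrow> L2 (\<lambda>x. \<Sum>i\<in>I. f i x)"
proof (induction I rule: finite_induct)
  case empty
  show ?case by (simp add: L2_def)
next
  case (insert i I)
  then show ?case by (simp add: L2_add)
qed

text \<open>Fourth moments of the scores are exactly second moments of their squares; the mixed
  product follows from a * b \<le> a^2 + b^2 applied to the two squared scores.\<close>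

lemma L2_scores:
  assumes t: "t \<in> {1..T}"
  shows "L2 (\<lambda>x. score_V t x * score_V t x)" "L2 (\<lambda>x. score_V t x * score_W t x)" "L2 (\<lambda>x. score_W t x * score_W t x)"
proof -
  note [measurable] = measurable_scores(1,3)[OF t]
  have p4: "(a * a)\<^sup>2 = \<bar>a\<bar> ^ 4" for a :: real
    by (simp add: power2_eq_square power4_eq_xxxx)
  have V4: "integrable \<pi> (\<lambda>x. (score_V t x * score_V t x)\<^sup>2)"
    unfolding p4 using w_snd_moment[OF t] by (simp add: score_V_def)
  have W4: "integrable \<pi> (\<lambda>x. (score_W t x * score_W t x)\<^sup>2)"
    unfolding p4 using w_fst_moment[OF t] by (simp add: score_W_def)
  show "L2 (\<lambda>x. score_V t x * score_V t x)" "L2 (\<lambda>x. score_W t x * score_W t x)"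
    using V4 W4 by (simp_all add: L2_def)
  have "integrable \<pi> (\<lambda>x. (score_V t x * score_W t x)\<^sup>2)"
  proof (rule Bochner_Integration.integrable_bound[OF Bochner_Integration.integrable_add[OF V4 W4]])
    show "AE x in \<pi>. norm ((score_V t x * score_W t x)\<^sup>2)
        \<le> norm ((score_V t x * score_V t x)\<^sup>2 + (score_W t x * score_W t x)\<^sup>2)"
    proof (rule AE_I2)
      fix x
      define a b where "a = (score_V t x)\<^sup>2" and "b = (score_W t x)\<^sup>2"
      have "0 \<le> a" "0 \<le> b" by (simp_all add: a_def b_def)
      then have ab: "0 \<le> a * b" by simp
      have "0 \<le> (a - b)\<^sup>2" by simp
      then have "2 * (a * b) \<le> a\<^sup>2 + b\<^sup>2" by (simp add: power2_diff)
      with ab have "a * b \<le> a\<^sup>2 + b\<^sup>2" by linarith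
      then show "norm ((score_V t x * score_W t x)\<^sup>2)
          \<le> norm ((score_V t x * score_V t x)\<^sup>2 + (score_W t x * score_W t x)\<^sup>2)"
        by (simp add: a_def b_def power_mult_distrib power2_eq_square[symmetric])
    qed
  qed measurable
  then show "L2 (\<lambda>x. score_V t x * score_W t x)" by (simp add: L2_def)
qed

definition second_VV where "second_VV t = (\<integral>x. score_V t x * score_V t x \<partial>\<pi>)"
definition second_VW where "second_VW t = (\<integral>x. score_V t x * score_W t x \<partial>\<pi>)"
definition second_WW where "second_WW t = (\<integral>x. score_W t x * score_W t x \<partial>\<pi>)"

text \<open>The second moment of \<open>score_V t + r * score_W t\<close> is a nonnegative quadratic
  polynomial in r. The resulting inequality makes the limiting covariance positive semidefinite, so
  its root exists.\<close>

lemma second_cauchy_schwarz: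
  assumes t: "t \<in> {1..T}"
  shows "0 \<le> second_VV t" "0 \<le> second_WW t" "(second_VW t)\<^sup>2 \<le> second_VV t * second_WW t"
proof -
  show nonneg: "0 \<le> second_VV t" "0 \<le> second_WW t"
    unfolding second_VV_def second_WW_def by (auto intro: integral_nonneg_AE)
  have quad: "0 \<le> second_VV t + 2 * r * second_VW t + r\<^sup>2 * second_WW t" for r
  proof -
    note int = L2_integrable[OF L2_scores(1)[OF t]] L2_integrable[OF L2_scores(2)[OF t]] L2_integrable[OF L2_scores(3)[OF t]]
    have "0 \<le> (\<integral>x. (score_V t x + r * score_W t x)\<^sup>2 \<partial>\<pi>)" by simp
    also have "\<dots> = (\<integral>x. score_V t x * score_V t x + 2 * r * (score_V t x * score_W t x) + r\<^sup>2 * (score_W t x * score_W t x) \<partial>\<pi>)"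
      by (simp add: power2_eq_square algebra_simps)
    also have "\<dots> = second_VV t + 2 * r * second_VW t + r\<^sup>2 * second_WW t"
      using int by (simp add: second_VV_def second_VW_def second_WW_def)
    finally show ?thesis .
  qed
  show "(second_VW t)\<^sup>2 \<le> second_VV t * second_WW t"
  proof (cases "second_WW t = 0")
    case True
    have "second_VW t = 0"
    proof (rule ccontr)
      assume nz: "second_VW t \<noteq> 0"
      \<comment> \<open>With a vanishing leading coefficient the polynomial is affine; this r would
        give it the value -1.\<close>
      have "2 * (- (second_VV t + 1) / (2 * second_VW t)) * second_VW t = - (second_VV t + 1)"
        using nz by simp
      then show False using quad[of "- (second_VV t + 1) / (2 * second_VW t)"] True by simp
    qed
    then show ?thesis using True by simp
  next
    case False
    then have pos: "0 < second_WW t" using nonneg by simp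
    \<comment> \<open>The minimiser of the polynomial in r.\<close>
    have "second_VV t + 2 * (- second_VW t / second_WW t) * second_VW t + (- second_VW t / second_WW t)\<^sup>2 * second_WW t
        = second_VV t - (second_VW t)\<^sup>2 / second_WW t"
      using pos by (simp add: power2_eq_square field_simps)
    then have "(second_VW t)\<^sup>2 / second_WW t \<le> second_VV t" using quad[of "- second_VW t / second_WW t"] by simp
    then show ?thesis using pos by (simp add: field_simps)
  qed
qed

text \<open>Up to the factor sqrt (ell t / D), the coefficient with which the noise of particle n at
  time t enters the functional \<theta>, given the state x of one coordinate.\<close>

definition direction :: "(nat \<times> nat \<times> nat \<Rightarrow> real) \<Rightarrow> nat \<Rightarrow> (nat \<Rightarrow> real) \<Rightarrow> nat \<Rightarrow> real" where
  "direction \<theta> t x n = coeff_V \<theta> t n * score_V t x + coeff_W \<theta> t n * score_W t x"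

text \<open>The contribution of one coordinate to the conditional variance of the functional
  \<theta> given the state, before the factor 1 / D.\<close>

definition quad_form :: "(nat \<times> nat \<times> nat \<Rightarrow> real) \<Rightarrow> (nat \<Rightarrow> real) \<Rightarrow> real" where
  "quad_form \<theta> x = (\<Sum>t=1..T. ell t * Sigma_form N (direction \<theta> t x) (direction \<theta> t x))"

definition mean_form :: "(nat \<times> nat \<times> nat \<Rightarrow> real) \<Rightarrow> real" where
  "mean_form \<theta> = (\<Sum>t=1..T. \<Sum>n=1..N. coeff_V \<theta> t n * mean_V t n + coeff_W \<theta> t n * mean_W t n)"

lemma quad_form_nonneg: "0 \<le> quad_form \<theta> x"
  unfolding quad_form_def
  by (intro sum_nonneg mult_nonneg_nonneg Sigma_form_nonneg) (simp add: ell_pos less_imp_le)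

lemma quad_form_expand:
  "quad_form \<theta> x = (\<Sum>t=1..T. ell t * (Sigma_form N (coeff_V \<theta> t) (coeff_V \<theta> t) * (score_V t x * score_V t x)
    + (Sigma_form N (coeff_V \<theta> t) (coeff_W \<theta> t) + Sigma_form N (coeff_W \<theta> t) (coeff_V \<theta> t)) * (score_V t x * score_W t x)
    + Sigma_form N (coeff_W \<theta> t) (coeff_W \<theta> t) * (score_W t x * score_W t x)))"
  unfolding quad_form_def direction_def[abs_def] Sigma_form_combination ..

lemma L2_quad_form: "L2 (quad_form \<theta>)"
  unfolding quad_form_expand[abs_def]
  by (intro L2_sum L2_cmult L2_add L2_scores) auto

lemma integral_quad_form:
  "(\<integral>x. quad_form \<theta> x \<partial>\<pi>) = (\<Sum>t=1..T. ell t * (Sigma_form N (coeff_V \<theta> t) (coeff_V \<theta> t) * second_VV t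
    + (Sigma_form N (coeff_V \<theta> t) (coeff_W \<theta> t) + Sigma_form N (coeff_W \<theta> t) (coeff_V \<theta> t)) * second_VW t
    + Sigma_form N (coeff_W \<theta> t) (coeff_W \<theta> t) * second_WW t))"
proof -
  have "integrable \<pi> (\<lambda>x. c1 * (score_V t x * score_V t x) + c2 * (score_V t x * score_W t x) + c3 * (score_W t x * score_W t x))"
    "(\<integral>x. c1 * (score_V t x * score_V t x) + c2 * (score_V t x * score_W t x) + c3 * (score_W t x * score_W t x) \<partial>\<pi>)
      = c1 * second_VV t + c2 * second_VW t + c3 * second_WW t" if "t \<in> {1..T}" for t c1 c2 c3
    using L2_scores[OF that, THEN L2_integrable] by (simp_all add: second_VV_def second_VW_def second_WW_def)
  note int = this
  show ?thesis
    unfolding quad_form_expand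
    by (subst Bochner_Integration.integral_sum, intro integrable_mult_right int)
       (auto intro!: sum.cong simp: int simp del: atLeastAtMost_iff)
qed

lemma integral_cis_noise_law:
  fixes c :: "nat \<times> nat \<Rightarrow> nat \<Rightarrow> real"
  shows "(\<integral>u. cis (\<Sum>i\<in>{1..T} \<times> {1..D}. \<Sum>n=1..N. c i n * u i n) \<partial>noise_law T D N)
    = of_real (exp (- (\<Sum>i\<in>{1..T} \<times> {1..D}. Sigma_form N (c i) (c i)) / 2))"
proof -
  have m: "(\<lambda>v. cis (\<Sum>n=1..N. c i n * v n)) \<in> borel_measurable (noise1 N)" for i
    by (rule measurable_compose[OF _ borel_measurable_cis])
       (intro borel_measurable_sum borel_measurable_times borel_measurable_const measurable_gaussian_component)
  have int: "integrable (noise1 N) (\<lambda>v. cis (\<Sum>n=1..N. c i n * v n))" for i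
    by (rule noise.integrable_const_bound[where B=1, OF _ m]) simp
  interpret B: product_sigma_finite "\<lambda>_::nat \<times> nat. noise1 N" ..
  have "(\<integral>u. cis (\<Sum>i\<in>{1..T} \<times> {1..D}. \<Sum>n=1..N. c i n * u i n) \<partial>noise_law T D N)
      = (\<integral>u. (\<Prod>i\<in>{1..T} \<times> {1..D}. cis (\<Sum>n=1..N. c i n * u i n)) \<partial>noise_law T D N)"
    by (simp add: cis_sum)
  also have "\<dots> = (\<Prod>i\<in>{1..T} \<times> {1..D}. \<integral>v. cis (\<Sum>n=1..N. c i n * v n) \<partial>noise1 N)"
    unfolding noise_law_def by (rule B.product_integral_prod) (simp, rule int)
  also have "\<dots> = (\<Prod>i\<in>{1..T} \<times> {1..D}. of_real (exp (- Sigma_form N (c i) (c i) / 2)))"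
    unfolding integral_cis_noise1 ..
  also have "\<dots> = of_real (exp (\<Sum>i\<in>{1..T} \<times> {1..D}. - Sigma_form N (c i) (c i) / 2))"
    by (simp add: exp_sum)
  also have "(\<Sum>i\<in>{1..T} \<times> {1..D}. - Sigma_form N (c i) (c i) / 2)
      = - (\<Sum>i\<in>{1..T} \<times> {1..D}. Sigma_form N (c i) (c i)) / 2"
    by (simp add: sum_negf sum_divide_distrib)
  finally show ?thesis .
qed

section \<open>Characteristic functions of the approximation and of the log-ratios\<close>

definition approx_form where
  "approx_form \<theta> D z = (\<Sum>(t, a, l)\<in>indices. \<theta> (t, a, l) * (V_approx D z t l + W_approx D z (t - 1) a))"

lemma approx_form_eq:
  "approx_form \<theta> D z = mean_form \<theta>
    + (\<Sum>i\<in>{1..T} \<times> {1..D}. \<Sum>n=1..N. sqrt (ell (fst i) / D) * direction \<theta> (fst i) (fst z (snd i)) n * snd z i n)"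
proof -
  have "approx_form \<theta> D z = (\<Sum>t=1..T. \<Sum>n=1..N. coeff_V \<theta> t n * V_approx D z t n + coeff_W \<theta> t n * W_approx D z t n)"
    unfolding approx_form_def by (rule sum_indices_V_W) (simp_all add: V_approx_def W_approx_def mean_V_def mean_W_def)
  also have "\<dots> = (\<Sum>t=1..T. \<Sum>n=1..N. (coeff_V \<theta> t n * mean_V t n + coeff_W \<theta> t n * mean_W t n)
      + (\<Sum>d=1..D. sqrt (ell t / D) * direction \<theta> t (fst z d) n * snd z (t, d) n))"
  proof (intro sum.cong refl)
    fix t n assume "t \<in> {1..T}" "n \<in> {1..N}"
    then have st: "step D t n d z = sqrt (ell t / D) * snd z (t, d) n" for d
      by (auto simp: step_def noise_entry_def)
    show "coeff_V \<theta> t n * V_approx D z t n + coeff_W \<theta> t n * W_approx D z t n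
      = (coeff_V \<theta> t n * mean_V t n + coeff_W \<theta> t n * mean_W t n)
      + (\<Sum>d=1..D. sqrt (ell t / D) * direction \<theta> t (fst z d) n * snd z (t, d) n)"
      unfolding V_approx_def W_approx_def st direction_def
      by (simp add: algebra_simps sum_distrib_left sum.distrib)
  qed
  also have "\<dots> = mean_form \<theta> + (\<Sum>t=1..T. \<Sum>n=1..N. \<Sum>d=1..D. sqrt (ell t / D) * direction \<theta> t (fst z d) n * snd z (t, d) n)"
    by (simp add: sum.distrib mean_form_def)
  also have "(\<Sum>t=1..T. \<Sum>n=1..N. \<Sum>d=1..D. sqrt (ell t / D) * direction \<theta> t (fst z d) n * snd z (t, d) n)
      = (\<Sum>t=1..T. \<Sum>d=1..D. \<Sum>n=1..N. sqrt (ell t / D) * direction \<theta> t (fst z d) n * snd z (t, d) n)"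
    by (rule sum.cong[OF refl]) (rule sum.swap)
  also have "\<dots> = (\<Sum>i\<in>{1..T} \<times> {1..D}. \<Sum>n=1..N. sqrt (ell (fst i) / D) * direction \<theta> (fst i) (fst z (snd i)) n * snd z i n)"
    by (subst sum.cartesian_product) (simp add: case_prod_unfold)
  finally show ?thesis .
qed

lemma measurable_approx_form: "approx_form \<theta> D \<in> borel_measurable (\<Omega> D)"
proof -
  have "(\<lambda>z. case i of (t, a, l) \<Rightarrow> \<theta> (t, a, l) * (V_approx D z t l + W_approx D z (t - 1) a)) \<in> borel_measurable (\<Omega> D)"
    if i: "i \<in> indices" for i
  proof -
    obtain t a l where "i = (t, a, l)" using prod_cases3 by blast
    with i have "i = (t, a, l)" "t \<le> T" "t - 1 \<le> T" "a \<le> N" "l \<le> N" by (auto simp: indices_def)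
    then show ?thesis
      by (simp only: prod.case) (intro borel_measurable_times borel_measurable_add borel_measurable_const measurable_approx)
  qed
  then show ?thesis unfolding approx_form_def[abs_def] by (rule borel_measurable_sum)
qed

definition mean_quad where
  "mean_quad \<theta> D x = (\<Sum>d=1..D. quad_form \<theta> (x d)) / real D"

lemma measurable_mean_quad: "(\<lambda>z. mean_quad \<theta> D (fst z)) \<in> borel_measurable (\<Omega> D)"
proof -
  have "(\<lambda>z. quad_form \<theta> (fst z d)) \<in> borel_measurable (\<Omega> D)" if "d \<in> {1..D}" for d
    by (rule measurable_compose[OF measurable_state[OF that]]) (use L2_quad_form in \<open>simp add: L2_def\<close>)
  then show ?thesis unfolding mean_quad_def by (intro borel_measurable_divide borel_measurable_sum borel_measurable_const)
qed

text \<open>Given the state, the approximation is Gaussian with deterministic mean and with variance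
  equal to the average of \<open>quad_form\<close> over coordinates, so Fubini integrates out the
  noise explicitly.\<close>

lemma char_approx_form:
  "(\<integral>z. cis (approx_form \<theta> D z) \<partial>\<Omega> D)
    = (\<integral>z. cis (mean_form \<theta>) * of_real (exp (- mean_quad \<theta> D (fst z) / 2)) \<partial>\<Omega> D)"
proof -
  interpret P: prob_space "target_prod T D m G" by (rule prob_space_target_prod)
  interpret Q: prob_space "noise_law T D N" by (rule prob_space_noise_law)
  interpret pair_sigma_finite "target_prod T D m G" "noise_law T D N" ..
  interpret \<Omega>: prob_space "\<Omega> D" by (rule prob_space_\<Omega>)
  define F where "F z = cis (approx_form \<theta> D z)" for z
  define K where "K x = cis (mean_form \<theta>) * of_real (exp (- mean_quad \<theta> D x / 2))" for x
  have Fint: "integrable (\<Omega> D) F"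
    unfolding F_def[abs_def]
    by (rule \<Omega>.integrable_const_bound[where B=1, OF _ measurable_compose[OF measurable_approx_form borel_measurable_cis]]) simp
  have mq: "0 \<le> mean_quad \<theta> D x" for x
    by (auto simp: mean_quad_def intro!: divide_nonneg_nonneg sum_nonneg quad_form_nonneg)
  have Kint: "integrable (\<Omega> D) (\<lambda>z. K (fst z))"
  proof (rule \<Omega>.integrable_const_bound[where B=1])
    note [measurable] = measurable_mean_quad
    show "(\<lambda>z. K (fst z)) \<in> borel_measurable (\<Omega> D)" unfolding K_def by measurable
    show "AE z in \<Omega> D. norm (K (fst z)) \<le> 1" using mq by (intro AE_I2) (simp add: K_def norm_mult)
  qed
  have inner: "(\<integral>u. F (x, u) \<partial>noise_law T D N) = K x" for x
  proof -
    let ?c = "\<lambda>i n. sqrt (ell (fst i) / D) * direction \<theta> (fst i) (x (snd i)) n"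
    let ?F = "\<lambda>t d. Sigma_form N (direction \<theta> t (x d)) (direction \<theta> t (x d))"
    have "(\<Sum>i\<in>{1..T} \<times> {1..D}. Sigma_form N (?c i) (?c i))
        = (\<Sum>i\<in>{1..T} \<times> {1..D}. ell (fst i) / D * ?F (fst i) (snd i))"
    proof (rule sum.cong[OF refl])
      fix i :: "nat \<times> nat" assume "i \<in> {1..T} \<times> {1..D}"
      then have "0 \<le> ell (fst i) / D" using ell_pos[of "fst i"] by auto
      then show "Sigma_form N (?c i) (?c i) = ell (fst i) / D * ?F (fst i) (snd i)"
        unfolding Sigma_form_scale by (simp only: real_sqrt_mult_self abs_of_nonneg)
    qed
    also have "\<dots> = (\<Sum>d=1..D. \<Sum>t=1..T. ell t / D * ?F t d)"
      by (subst sum.swap) (simp add: sum.cartesian_product case_prod_unfold)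
    also have "\<dots> = mean_quad \<theta> D x"
      by (simp add: mean_quad_def quad_form_def sum_divide_distrib)
    finally have quad: "(\<Sum>i\<in>{1..T} \<times> {1..D}. Sigma_form N (?c i) (?c i)) = mean_quad \<theta> D x" .
    have "(\<integral>u. F (x, u) \<partial>noise_law T D N)
        = (\<integral>u. cis (mean_form \<theta>) * cis (\<Sum>i\<in>{1..T} \<times> {1..D}. \<Sum>n=1..N. ?c i n * u i n) \<partial>noise_law T D N)"
      unfolding F_def approx_form_eq cis_mult[symmetric] fst_conv snd_conv ..
    also have "\<dots> = K x"
      unfolding integral_mult_right_zero integral_cis_noise_law quad K_def ..
    finally show ?thesis .
  qed
  have "(\<integral>z. F z \<partial>\<Omega> D) = (\<integral>x. \<integral>u. F (x, u) \<partial>noise_law T D N \<partial>target_prod T D m G)"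
    unfolding \<Omega>_def by (rule integral_fst'[symmetric]) (use Fint in \<open>simp add: \<Omega>_def\<close>)
  also have "\<dots> = (\<integral>x. \<integral>u. K (fst (x, u)) \<partial>noise_law T D N \<partial>target_prod T D m G)"
    by (simp add: inner Q.prob_space)
  also have "\<dots> = (\<integral>z. K (fst z) \<partial>\<Omega> D)"
    unfolding \<Omega>_def by (rule integral_fst') (use Kint in \<open>simp add: \<Omega>_def\<close>)
  finally show ?thesis by (simp add: F_def K_def)
qed

text \<open>The only randomness left is the conditional variance. It converges in L1, and x
  \<mapsto> exp (- x / 2) is Lipschitz on nonnegative reals, so the expectation converges.\<close>

lemma char_approx_form_tendsto:
  "(\<lambda>D. \<integral>z. cis (approx_form \<theta> D z) \<partial>\<Omega> D)
    \<longlonglongrightarrow> cis (mean_form \<theta>) * of_real (exp (- (\<integral>x. quad_form \<theta> x \<partial>\<pi>) / 2))"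
proof -
  define Q where "Q = (\<integral>x. quad_form \<theta> x \<partial>\<pi>)"
  have Q: "0 \<le> Q" unfolding Q_def by (simp add: quad_form_nonneg)
  have null: "L1_null (\<lambda>D z. mean_quad \<theta> D (fst z) - Q)"
    unfolding mean_quad_def Q_def using L2_quad_form[of \<theta>] L2_integrable[OF L2_quad_form[of \<theta>]]
    by (intro L1_null_average_state) (auto simp: L2_def)
  have mq: "0 \<le> mean_quad \<theta> D x" for D x
    by (auto simp: mean_quad_def intro!: divide_nonneg_nonneg sum_nonneg quad_form_nonneg)
  have null_exp: "L1_null (\<lambda>D z. exp (- mean_quad \<theta> D (fst z) / 2) - exp (- Q / 2))"
  proof (rule L1_null_bound[OF L1_null_abs[OF null]])
    note [measurable] = measurable_mean_quad
    show "(\<lambda>z. exp (- mean_quad \<theta> D (fst z) / 2) - exp (- Q / 2)) \<in> borel_measurable (\<Omega> D)" for D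
      by measurable
    fix D z
    have "\<bar>exp (- (mean_quad \<theta> D (fst z) / 2)) - exp (- (Q / 2))\<bar> \<le> \<bar>mean_quad \<theta> D (fst z) / 2 - Q / 2\<bar>"
      using mq Q by (intro exp_minus_lipschitz) auto
    also have "\<dots> \<le> \<bar>mean_quad \<theta> D (fst z) - Q\<bar>" by linarith
    finally show "\<bar>exp (- mean_quad \<theta> D (fst z) / 2) - exp (- Q / 2)\<bar> \<le> \<bar>mean_quad \<theta> D (fst z) - Q\<bar>" by simp
  qed
  define r where "r D = (\<integral>z. exp (- mean_quad \<theta> D (fst z) / 2) \<partial>\<Omega> D)" for D
  have "(\<integral>z. exp (- mean_quad \<theta> D (fst z) / 2) - exp (- Q / 2) \<partial>\<Omega> D) = r D - exp (- Q / 2)" for D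
  proof -
    interpret \<Omega>: prob_space "\<Omega> D" by (rule prob_space_\<Omega>)
    note [measurable] = measurable_mean_quad
    have "integrable (\<Omega> D) (\<lambda>z. exp (- mean_quad \<theta> D (fst z) / 2))"
      by (rule \<Omega>.integrable_const_bound[where B=1]) (use mq in auto)
    then show ?thesis by (simp add: r_def \<Omega>.prob_space)
  qed
  with L1_null_integral_tendsto[OF null_exp] have "(\<lambda>D. r D - exp (- Q / 2)) \<longlonglongrightarrow> 0" by simp
  then have "r \<longlonglongrightarrow> exp (- Q / 2)" by (rule LIM_zero_cancel)
  then have "(\<lambda>D. cis (mean_form \<theta>) * of_real (r D)) \<longlonglongrightarrow> cis (mean_form \<theta>) * of_real (exp (- Q / 2))"
    by (intro tendsto_intros)
  then show ?thesis
    unfolding char_approx_form integral_mult_right_zero r_def Q_def integral_complex_of_real .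
qed

text \<open>Since \<open>cis\<close> is 1-Lipschitz, the L1 distance between the functional of the
  log-ratios and its approximation bounds the distance of the characteristic functions.\<close>

lemma char_H_tendsto:
  "(\<lambda>D. \<integral>z. cis (\<Sum>i\<in>indices. \<theta> i * H D z i) \<partial>\<Omega> D)
    \<longlonglongrightarrow> cis (mean_form \<theta>) * of_real (exp (- (\<integral>x. quad_form \<theta> x \<partial>\<pi>) / 2))"
proof -
  define S where "S D z = (\<Sum>i\<in>indices. \<theta> i * H D z i)" for D z
  have "L1_null (\<lambda>D z. \<Sum>i\<in>indices. \<theta> i * (case i of (t, a, l) \<Rightarrow> H D z (t, a, l) - (V_approx D z t l + W_approx D z (t - 1) a)))"
  proof (rule L1_null_sum[OF finite_indices], rule L1_null_cmult)
    fix i assume i: "i \<in> indices"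
    obtain t a l where "i = (t, a, l)" using prod_cases3 by blast
    with H_approx[of t a l] i show "L1_null (\<lambda>D z. case i of (t, a, l) \<Rightarrow> H D z (t, a, l) - (V_approx D z t l + W_approx D z (t - 1) a))"
      by simp
  qed
  then have null: "L1_null (\<lambda>D z. S D z - approx_form \<theta> D z)"
    by (rule L1_null_cong)
       (auto simp: S_def approx_form_def sum_subtractf[symmetric] right_diff_distrib intro!: sum.cong)
  have mS: "S D \<in> borel_measurable (\<Omega> D)" for D
    unfolding S_def by (intro borel_measurable_sum borel_measurable_times borel_measurable_const measurable_H)
  have b: "norm ((\<integral>z. cis (S D z) \<partial>\<Omega> D) - (\<integral>z. cis (approx_form \<theta> D z) \<partial>\<Omega> D))
      \<le> (\<integral>z. \<bar>S D z - approx_form \<theta> D z\<bar> \<partial>\<Omega> D)" if D: "1 \<le> D" for D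
  proof -
    interpret \<Omega>: prob_space "\<Omega> D" by (rule prob_space_\<Omega>)
    have i1: "integrable (\<Omega> D) (\<lambda>z. cis (S D z))"
      by (rule \<Omega>.integrable_const_bound[where B=1, OF _ measurable_compose[OF mS borel_measurable_cis]]) simp
    have i2: "integrable (\<Omega> D) (\<lambda>z. cis (approx_form \<theta> D z))"
      by (rule \<Omega>.integrable_const_bound[where B=1, OF _ measurable_compose[OF measurable_approx_form borel_measurable_cis]]) simp
    have i3: "integrable (\<Omega> D) (\<lambda>z. S D z - approx_form \<theta> D z)" using null D by (simp add: L1_null_def)
    have eq: "(\<integral>z. cis (S D z) \<partial>\<Omega> D) - (\<integral>z. cis (approx_form \<theta> D z) \<partial>\<Omega> D)
        = (\<integral>z. cis (S D z) - cis (approx_form \<theta> D z) \<partial>\<Omega> D)" using i1 i2 by simp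
    have "norm ((\<integral>z. cis (S D z) \<partial>\<Omega> D) - (\<integral>z. cis (approx_form \<theta> D z) \<partial>\<Omega> D))
        \<le> (\<integral>z. norm (cis (S D z) - cis (approx_form \<theta> D z)) \<partial>\<Omega> D)"
      unfolding eq by (rule integral_norm_bound)
    also have "\<dots> \<le> (\<integral>z. \<bar>S D z - approx_form \<theta> D z\<bar> \<partial>\<Omega> D)"
      by (rule integral_mono[OF _ _ norm_cis_diff_le])
         (intro integrable_norm Bochner_Integration.integrable_diff i1 i2 integrable_abs i3)+
    finally show ?thesis .
  qed
  have "(\<lambda>D. (\<integral>z. cis (S D z) \<partial>\<Omega> D) - (\<integral>z. cis (approx_form \<theta> D z) \<partial>\<Omega> D)) \<longlonglongrightarrow> 0"
  proof (rule Lim_null_comparison)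
    show "eventually (\<lambda>D. norm ((\<integral>z. cis (S D z) \<partial>\<Omega> D) - (\<integral>z. cis (approx_form \<theta> D z) \<partial>\<Omega> D))
      \<le> (\<integral>z. \<bar>S D z - approx_form \<theta> D z\<bar> \<partial>\<Omega> D)) sequentially"
      using eventually_ge_at_top[of 1] by eventually_elim (rule b)
    show "(\<lambda>D. \<integral>z. \<bar>S D z - approx_form \<theta> D z\<bar> \<partial>\<Omega> D) \<longlonglongrightarrow> 0" using null by (simp add: L1_null_def)
  qed
  from tendsto_add[OF this char_approx_form_tendsto[of \<theta>]] show ?thesis by (simp add: S_def)
qed

section \<open>Convergence of the expected squared jump distance\<close>

abbreviation "limit_indices \<equiv> {1..N} <+> {1..N}"

lemma limit_mean_eq:
  assumes "t \<in> {1..T}" "n \<in> {1..N}"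
  shows "limit_mean T m G ell t (Inl n) = mean_V t n" "limit_mean T m G ell t (Inr n) = mean_W t n"
  using assms by (auto simp: limit_mean_def mean_V_def mean_W_def hess_V_def[abs_def] hess_W_def[abs_def] Let_def)

lemma limit_cov_eq:
  "limit_cov T m G ell t (Inl i) (Inl j) = ell t * second_VV t * Sigma_cov i j"
  "limit_cov T m G ell t (Inl i) (Inr j) = ell t * second_VW t * Sigma_cov i j"
  "limit_cov T m G ell t (Inr i) (Inl j) = ell t * second_VW t * Sigma_cov i j"
  "limit_cov T m G ell t (Inr i) (Inr j) = ell t * second_WW t * Sigma_cov i j"
  by (simp_all add: limit_cov_def Let_def second_VV_def second_VW_def second_WW_def
      score_V_def score_W_def power2_eq_square)

lemma limit_cov_root:
  assumes t: "t \<in> {1..T}"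
  shows "\<exists>A. \<forall>i\<in>limit_indices. \<forall>j\<in>limit_indices. (\<Sum>k\<in>limit_indices. A i k * A j k) = limit_cov T m G ell t i j"
proof (rule kronecker_Sigma_cov_root[OF _ _ _ limit_cov_eq])
  note cs = second_cauchy_schwarz[OF t]
  have e: "0 \<le> ell t" using ell_pos[OF t] by simp
  show "0 \<le> ell t * second_VV t" "0 \<le> ell t * second_WW t" using cs e by simp_all
  have "(ell t)\<^sup>2 * (second_VW t)\<^sup>2 \<le> (ell t)\<^sup>2 * (second_VV t * second_WW t)"
    using cs(3) by (intro mult_left_mono) auto
  then show "(ell t * second_VW t)\<^sup>2 \<le> ell t * second_VV t * (ell t * second_WW t)"
    by (simp add: power2_eq_square mult_ac)
qed

abbreviation "limit_noise \<equiv> limit_noise_law T N m G ell"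

lemma prob_space_limit_noise: "prob_space limit_noise"
  unfolding limit_noise_law_def by (intro prob_space_PiM prob_space_gaussian_law) simp

lemma measurable_limit_noise:
  assumes "t \<in> {1..T}" "j \<in> limit_indices"
  shows "(\<lambda>g. g t j) \<in> borel_measurable limit_noise"
  unfolding limit_noise_law_def
  by (rule measurable_compose[OF measurable_component_singleton[OF assms(1)] measurable_gaussian_component[OF assms(2)]])

lemma measurable_limit_log_ratio: "(\<lambda>g. limit_log_ratio g i) \<in> borel_measurable limit_noise"
proof (cases "i \<in> indices")
  case True
  obtain t a l where i: "i = (t, a, l)" using prod_cases3 by blast
  with True have ind: "(t, a, l) \<in> indices" "t \<in> {1..T}" "a \<le> N" "l \<le> N" by (auto simp: indices_def)
  have V: "(\<lambda>g. limit_V g t l) \<in> borel_measurable limit_noise"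
  proof (cases "l = 0")
    case False
    then have "Inl l \<in> limit_indices" using ind by auto
    then show ?thesis using False measurable_limit_noise[OF ind(2), of "Inl l"] by (simp add: limit_V_def)
  qed (simp add: limit_V_def)
  have W: "(\<lambda>g. limit_W g (t - 1) a) \<in> borel_measurable limit_noise"
  proof (cases "a = 0 \<or> t - 1 = 0")
    case True
    then have "(\<lambda>g. limit_W g (t - 1) a) = (\<lambda>_. 0)" by (auto simp: limit_W_def fun_eq_iff)
    then show ?thesis by simp
  next
    case False
    then have "t - 1 \<in> {1..T}" "Inr a \<in> limit_indices" using ind by auto
    then show ?thesis using measurable_limit_noise[of "t - 1" "Inr a"] False by (simp add: limit_W_def)
  qed
  show ?thesis using borel_measurable_add[OF V W] ind(1) by (simp add: i limit_log_ratio_def)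
next
  case False
  then show ?thesis by (cases i) (simp add: limit_log_ratio_def)
qed

lemma sum_limit_indices: "(\<Sum>j\<in>limit_indices. f j) = (\<Sum>n=1..N. f (Inl n)) + (\<Sum>n=1..N. f (Inr n))"
  by (simp add: sum.Plus)

text \<open>V_t and W_t share the index t and have covariance in Kronecker form, so the variance at
  time t is ell t times the \<pi>-average of the form in \<open>direction\<close>. Summing over t
  reproduces the exponent found for the algorithm.\<close>

lemma char_limit:
  "(\<integral>g. cis (\<Sum>i\<in>indices. \<theta> i * limit_log_ratio g i) \<partial>limit_noise)
    = cis (mean_form \<theta>) * of_real (exp (- (\<integral>x. quad_form \<theta> x \<partial>\<pi>) / 2))"
proof -
  define \<phi> where "\<phi> t j = (case j of Inl n \<Rightarrow> coeff_V \<theta> t n | Inr n \<Rightarrow> coeff_W \<theta> t n)" for t and j :: "nat + nat"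
  have lin: "(\<Sum>i\<in>indices. \<theta> i * limit_log_ratio g i) = (\<Sum>t=1..T. \<Sum>j\<in>limit_indices. \<phi> t j * g t j)" for g
  proof -
    have "(\<Sum>i\<in>indices. \<theta> i * limit_log_ratio g i)
        = (\<Sum>(t, a, l)\<in>indices. \<theta> (t, a, l) * (limit_V g t l + limit_W g (t - 1) a))"
      by (rule sum.cong) (auto simp: limit_log_ratio_def)
    also have "\<dots> = (\<Sum>t=1..T. \<Sum>n=1..N. coeff_V \<theta> t n * limit_V g t n + coeff_W \<theta> t n * limit_W g t n)"
      by (rule sum_indices_V_W) (simp_all add: limit_V_def limit_W_def)
    also have "\<dots> = (\<Sum>t=1..T. \<Sum>j\<in>limit_indices. \<phi> t j * g t j)"
      unfolding sum_limit_indices sum.distrib[symmetric]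
      by (intro sum.cong refl) (auto simp: \<phi>_def limit_V_def limit_W_def)
    finally show ?thesis .
  qed
  interpret B: product_prob_space "\<lambda>t. gaussian_law limit_indices (limit_mean T m G ell t) (limit_cov T m G ell t)" "{1..T}"
    by (intro product_prob_spaceI prob_space_gaussian_law) simp
  have m: "(\<lambda>v. cis (\<Sum>j\<in>limit_indices. \<phi> t j * v j))
      \<in> borel_measurable (gaussian_law limit_indices (limit_mean T m G ell t) (limit_cov T m G ell t))" for t
    by (rule measurable_compose[OF _ borel_measurable_cis])
       (intro borel_measurable_sum borel_measurable_times borel_measurable_const measurable_gaussian_component)
  have int: "integrable (gaussian_law limit_indices (limit_mean T m G ell t) (limit_cov T m G ell t))
      (\<lambda>v. cis (\<Sum>j\<in>limit_indices. \<phi> t j * v j))" for t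
    by (rule B.M.integrable_const_bound[where B=1, OF _ m]) simp
  define q where "q t = (\<Sum>i\<in>limit_indices. \<Sum>j\<in>limit_indices. \<phi> t i * \<phi> t j * limit_cov T m G ell t i j)" for t
  have "(\<integral>g. cis (\<Sum>i\<in>indices. \<theta> i * limit_log_ratio g i) \<partial>limit_noise)
      = (\<integral>g. (\<Prod>t=1..T. cis (\<Sum>j\<in>limit_indices. \<phi> t j * g t j)) \<partial>limit_noise)"
    unfolding lin by (simp add: cis_sum)
  also have "\<dots> = (\<Prod>t=1..T. \<integral>v. cis (\<Sum>j\<in>limit_indices. \<phi> t j * v j)
      \<partial>gaussian_law limit_indices (limit_mean T m G ell t) (limit_cov T m G ell t))"
    unfolding limit_noise_law_def by (rule B.product_integral_prod) (simp, rule int)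
  also have "\<dots> = (\<Prod>t=1..T. cis (\<Sum>j\<in>limit_indices. \<phi> t j * limit_mean T m G ell t j) * of_real (exp (- q t / 2)))"
    unfolding q_def by (intro prod.cong refl integral_cis_gaussian_law limit_cov_root) auto
  also have "\<dots> = cis (\<Sum>t=1..T. \<Sum>j\<in>limit_indices. \<phi> t j * limit_mean T m G ell t j)
      * of_real (exp (\<Sum>t=1..T. - q t / 2))"
    by (simp add: prod.distrib cis_sum exp_sum)
  also have "(\<Sum>t=1..T. \<Sum>j\<in>limit_indices. \<phi> t j * limit_mean T m G ell t j) = mean_form \<theta>"
    unfolding sum_limit_indices sum.distrib[symmetric] mean_form_def
    by (intro sum.cong refl) (simp add: \<phi>_def limit_mean_eq)
  also have "(\<Sum>t=1..T. - q t / 2) = - (\<integral>x. quad_form \<theta> x \<partial>\<pi>) / 2"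
  proof -
    have "q t = ell t * (Sigma_form N (coeff_V \<theta> t) (coeff_V \<theta> t) * second_VV t
      + (Sigma_form N (coeff_V \<theta> t) (coeff_W \<theta> t) + Sigma_form N (coeff_W \<theta> t) (coeff_V \<theta> t)) * second_VW t
      + Sigma_form N (coeff_W \<theta> t) (coeff_W \<theta> t) * second_WW t)" for t
      unfolding q_def sum_limit_indices Sigma_form_def sum_distrib_left sum_distrib_right sum.distrib[symmetric]
      by (intro sum.cong refl) (simp add: \<phi>_def limit_cov_eq algebra_simps)
    then have "(\<Sum>t=1..T. q t) = (\<integral>x. quad_form \<theta> x \<partial>\<pi>)" unfolding integral_quad_form by simp
    then show ?thesis by (simp add: sum_negf sum_divide_distrib[symmetric])
  qed
  finally show ?thesis .
qed

section \<open>Passage to the limit in the selection probabilities and the jump distance\<close>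

lemma selection_prob_bounds: "0 \<le> selection_prob T N backward forced s k h" "selection_prob T N backward forced s k h \<le> 1"
  by (simp_all add: selection_prob_def)

lemma measurable_selection_prob: "selection_prob T N backward forced s k \<in> borel_measurable borel"
  by (rule borel_measurable_continuous_onI[OF continuous_on_selection_prob])

lemma measurable_selection_prob_H: "(\<lambda>z. selection_prob T N backward forced s k (H D z)) \<in> borel_measurable (\<Omega> D)"
  by (rule measurable_compose[OF _ measurable_selection_prob])
     (rule measurable_coordinatewise_then_product, rule measurable_H)

lemma selection_prob_tendsto:
  "(\<lambda>D. \<integral>z. selection_prob T N backward forced s k (H D z) \<partial>\<Omega> D)
    \<longlonglongrightarrow> (\<integral>g. selection_prob T N backward forced s k (limit_log_ratio g) \<partial>limit_noise)"
proof (rule Levy_continuity_finite_dim[OF finite_indices prob_space_\<Omega> prob_space_limit_noise measurable_H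
      measurable_limit_log_ratio _ _ _ continuous_on_selection_prob])
  show "H D z i = 0" if "i \<notin> indices" for D z i
    using that by (cases i) (simp add: H_def log_ratio_def)
  show "limit_log_ratio g i = 0" if "i \<notin> indices" for g i
    using that by (cases i) (simp add: limit_log_ratio_def)
  show "(\<lambda>D. \<integral>z. cis (\<Sum>i\<in>indices. \<theta> i * H D z i) \<partial>\<Omega> D)
      \<longlonglongrightarrow> (\<integral>g. cis (\<Sum>i\<in>indices. \<theta> i * limit_log_ratio g i) \<partial>limit_noise)" for \<theta>
    unfolding char_limit by (rule char_H_tendsto)
  show "\<bar>selection_prob T N backward forced s k h\<bar> \<le> 1" for h
    using selection_prob_bounds by (simp add: abs_of_nonneg)
qed

lemma limit_acceptance_eq:
  "limit_acceptance T N backward forced m G ell s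
    = (\<Sum>k=1..N. \<integral>g. selection_prob T N backward forced s k (limit_log_ratio g) \<partial>limit_noise)"
proof -
  interpret prob_space limit_noise by (rule prob_space_limit_noise)
  have "(\<lambda>g. selection_prob T N backward forced s k (limit_log_ratio g)) \<in> borel_measurable limit_noise" for k
    by (rule measurable_compose[OF _ measurable_selection_prob])
       (rule measurable_coordinatewise_then_product, rule measurable_limit_log_ratio)
  then have "integrable limit_noise (\<lambda>g. selection_prob T N backward forced s k (limit_log_ratio g))" for k
    by (intro integrable_const_bound[where B=1]) (auto simp: selection_prob_bounds)
  then show ?thesis
    unfolding limit_acceptance_def limit_selection_eq prob_selection_nonzero
    by (intro Bochner_Integration.integral_sum)
qed

text \<open>The index 0 contributes nothing because the reference particle does not move. The factor
  1 is the constant test function in the law of large numbers for squared increments.\<close>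

lemma ESJD_eq:
  assumes s: "s \<in> {1..T}"
  shows "ESJD T D N backward forced m G ell s
    = (\<integral>z. (\<Sum>k=1..N. selection_prob T N backward forced s k (H D z) * (\<Sum>d=1..D. 1 * (step D s k d z)\<^sup>2)) \<partial>\<Omega> D)"
  unfolding ESJD_def \<Omega>_def[symmetric]
proof (rule Bochner_Integration.integral_cong[OF refl])
  fix z :: "sample"
  obtain x u where z: "z = (x, u)" by (cases z)
  define f where "f k = (L2_set (\<lambda>d. particles D ell x u s k d - x d s) {1..D})\<^sup>2" for k
  have f: "f k = (\<Sum>d=1..D. 1 * (step D s k d z)\<^sup>2)" for k
  proof -
    have "particles D ell x u s k d - x d s = step D s k d z" for d
      using s by (simp add: particles_def step_def noise_entry_def z)
    then show ?thesis by (simp add: f_def L2_set_def sum_nonneg)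
  qed
  have "measure_pmf.expectation (csmc_selection T D N backward forced m G (particles D ell x u)) (\<lambda>K. f (K s))
      = (\<Sum>k\<le>N. selection_prob T N backward forced s k (H D z) * f k)"
    unfolding csmc_selection_eq H_def z fst_conv snd_conv by (rule expectation_selection)
  also have "\<dots> = (\<Sum>k=1..N. selection_prob T N backward forced s k (H D z) * f k)"
    by (subst sum_atMost_split0) (simp add: f)
  finally show "(case z of (x, u) \<Rightarrow> let y = particles D ell x u in
      measure_pmf.expectation (csmc_selection T D N backward forced m G y)
        (\<lambda>K. (L2_set (\<lambda>d. y s (K s) d - x d s) {1..D})\<^sup>2))
    = (\<Sum>k=1..N. selection_prob T N backward forced s k (H D z) * (\<Sum>d=1..D. 1 * (step D s k d z)\<^sup>2))"
    by (simp only: z prod.case Let_def f_def[symmetric]) (simp only: f z)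
qed

text \<open>Selection and jump size depend on the same noise. The squared jump is therefore split
  into the constant \<open>ell s\<close> and an L1-null error; a selection probability, being at
  most 1, keeps the error L1-null, and the constant part needs only the convergence of the
  probabilities.\<close>

lemma ESJD_tendsto:
  assumes s: "s \<in> {1..T}"
  shows "(\<lambda>D. ESJD T D N backward forced m G ell s) \<longlonglongrightarrow> ell s * limit_acceptance T N backward forced m G ell s"
proof -
  define p where "p k D z = selection_prob T N backward forced s k (H D z)" for k D z
  define e where "e k D z = (\<Sum>d=1..D. 1 * (step D s k d z)\<^sup>2) - ell s" for k D z
  have e: "L1_null (e k)" if k: "k \<in> {1..N}" for k
  proof -
    have "L1_null (\<lambda>D z. (\<Sum>d=1..D. (\<lambda>_. 1) (fst z d) * (step D s k d z)\<^sup>2)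
        - (if k = 0 \<or> s = 0 then 0 else ell s * (\<integral>x. 1 \<partial>\<pi>)))"
      by (rule step_square_null) (use s k in auto)
    then show ?thesis using s k by (simp add: e_def[abs_def] target.prob_space)
  qed
  have pm: "p k D \<in> borel_measurable (\<Omega> D)" for k D
    unfolding p_def[abs_def] by (rule measurable_selection_prob_H)
  have p01: "0 \<le> p k D z" "p k D z \<le> 1" for k D z
    by (simp_all add: p_def selection_prob_bounds)
  have pe: "L1_null (\<lambda>D z. p k D z * e k D z)" if k: "k \<in> {1..N}" for k
  proof (rule L1_null_bound[OF L1_null_abs[OF e[OF k]]])
    have sm: "(\<lambda>z. \<Sum>d=1..D. 1 * (step D s k d z)\<^sup>2) \<in> borel_measurable (\<Omega> D)" for D
      using s k by (intro borel_measurable_sum borel_measurable_times borel_measurable_power borel_measurable_const measurable_step) auto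
    show "(\<lambda>z. p k D z * e k D z) \<in> borel_measurable (\<Omega> D)" for D
      unfolding e_def using pm sm by (intro borel_measurable_times borel_measurable_diff borel_measurable_const)
    show "\<bar>p k D z * e k D z\<bar> \<le> \<bar>e k D z\<bar>" for D z
      using p01[of k D z] by (simp add: abs_mult mult_left_le_one_le)
  qed
  have ev: "ESJD T D N backward forced m G ell s
      = (\<integral>z. (\<Sum>k=1..N. p k D z * e k D z) \<partial>\<Omega> D) + ell s * (\<Sum>k=1..N. \<integral>z. p k D z \<partial>\<Omega> D)"
    if D: "1 \<le> D" for D
  proof -
    interpret \<Omega>: prob_space "\<Omega> D" by (rule prob_space_\<Omega>)
    have pint: "integrable (\<Omega> D) (p k D)" for k
      by (rule \<Omega>.integrable_const_bound[where B=1, OF _ pm]) (simp add: p01)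
    have peint: "integrable (\<Omega> D) (\<lambda>z. p k D z * e k D z)" if "k \<in> {1..N}" for k
      using pe[OF that] D by (simp add: L1_null_def)
    have "ESJD T D N backward forced m G ell s
        = (\<integral>z. (\<Sum>k=1..N. p k D z * e k D z) + ell s * (\<Sum>k=1..N. p k D z) \<partial>\<Omega> D)"
      unfolding ESJD_eq[OF s]
      by (rule Bochner_Integration.integral_cong[OF refl])
         (simp add: p_def e_def sum_distrib_left sum.distrib[symmetric] algebra_simps)
    also have "\<dots> = (\<integral>z. (\<Sum>k=1..N. p k D z * e k D z) \<partial>\<Omega> D) + (\<integral>z. ell s * (\<Sum>k=1..N. p k D z) \<partial>\<Omega> D)"
      by (intro Bochner_Integration.integral_add integrable_mult_right Bochner_Integration.integrable_sum peint pint)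
    also have "(\<integral>z. ell s * (\<Sum>k=1..N. p k D z) \<partial>\<Omega> D) = ell s * (\<Sum>k=1..N. \<integral>z. p k D z \<partial>\<Omega> D)"
      unfolding integral_mult_right_zero by (subst Bochner_Integration.integral_sum) (rule pint, rule refl)
    finally show ?thesis .
  qed
  have "L1_null (\<lambda>D z. \<Sum>k=1..N. p k D z * e k D z)"
    by (intro L1_null_sum pe) auto
  then have "(\<lambda>D. \<integral>z. (\<Sum>k=1..N. p k D z * e k D z) \<partial>\<Omega> D) \<longlonglongrightarrow> 0"
    by (rule L1_null_integral_tendsto)
  moreover have "(\<lambda>D. ell s * (\<Sum>k=1..N. \<integral>z. p k D z \<partial>\<Omega> D)) \<longlonglongrightarrow> ell s * limit_acceptance T N backward forced m G ell s"
    unfolding p_def limit_acceptance_eq by (intro tendsto_intros selection_prob_tendsto)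
  ultimately have "(\<lambda>D. (\<integral>z. (\<Sum>k=1..N. p k D z * e k D z) \<partial>\<Omega> D) + ell s * (\<Sum>k=1..N. \<integral>z. p k D z \<partial>\<Omega> D))
      \<longlonglongrightarrow> 0 + ell s * limit_acceptance T N backward forced m G ell s"
    by (rule tendsto_add)
  moreover have "eventually (\<lambda>D. (\<integral>z. (\<Sum>k=1..N. p k D z * e k D z) \<partial>\<Omega> D)
      + ell s * (\<Sum>k=1..N. \<integral>z. p k D z \<partial>\<Omega> D) = ESJD T D N backward forced m G ell s) sequentially"
    using eventually_ge_at_top[of 1] by eventually_elim (rule ev[symmetric])
  ultimately show ?thesis unfolding add_0_left by (rule Lim_transform_eventually)
qed

end

theorem proposition4p7:
  fixes T N :: nat
    and ell :: "nat \<Rightarrow> real"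
    and m1 :: "real \<Rightarrow> real"
    and m :: "nat \<Rightarrow> real \<Rightarrow> real \<Rightarrow> real"
    and G :: "nat \<Rightarrow> real \<Rightarrow> real"
    and backward forced :: bool
    and s :: nat
  defines "w \<equiv> log_weight T m G"
  assumes T: "1 \<le> T" and N: "1 \<le> N"
    and ell_pos: "\<And>t. t \<in> {1..T} \<Longrightarrow> 0 < ell t"
    and init: "\<And>x y. m 1 x y = m1 y"
    and m_meas: "\<And>t. t \<in> {1..T} \<Longrightarrow> (\<lambda>(x, y). m t x y) \<in> borel_measurable (borel \<Otimes>\<^sub>M borel)"
    and m_pos: "\<And>t x y. t \<in> {1..T} \<Longrightarrow> 0 < m t x y"
    and m_prob: "\<And>t x. t \<in> {1..T} \<Longrightarrow> (\<integral>\<^sup>+ y. ennreal (m t x y) \<partial>lborel) = 1"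
    and G_meas: "\<And>t. t \<in> {1..T} \<Longrightarrow> G t \<in> borel_measurable borel"
    and G_pos: "\<And>t x. t \<in> {1..T} \<Longrightarrow> 0 < G t x"
    and target_prob: "prob_space (target T m G)"
    and w_C2: "\<And>t. t \<in> {1..T} \<Longrightarrow> C2 (\<lambda>(x, y). w t x y)"
    and w_snd_snd: "\<And>t. t \<in> {1..T} \<Longrightarrow> lipschitz_bounded (deriv_snd (deriv_snd (w t)))"
    and w_fst_fst: "\<And>t. t \<in> {1..T} \<Longrightarrow> lipschitz_bounded (deriv_fst (deriv_fst (w (t + 1))))"
    and w_fst_snd: "\<And>t. t \<in> {1..T} \<Longrightarrow> lipschitz_bounded (deriv_fst (deriv_snd (w (t + 1))))"
    and w_snd_moment: "\<And>t. t \<in> {1..T} \<Longrightarrow>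
          integrable (target T m G) (\<lambda>x. \<bar>deriv_snd (w t) (x (t - 1)) (x t)\<bar> ^ 4)"
    and w_fst_moment: "\<And>t. t \<in> {1..T} \<Longrightarrow>
          integrable (target T m G) (\<lambda>x. \<bar>deriv_fst (w (t + 1)) (x t) (x (t + 1))\<bar> ^ 4)"
    and s: "s \<in> {1..T}"
  shows "(\<lambda>D. \<bar>ESJD T D N backward forced m G ell s
                 - ell s * limit_acceptance T N backward forced m G ell s\<bar>) \<longlonglongrightarrow> 0"
proof -
  interpret csmc_model T N ell m1 m G
    using T ell_pos init m_pos G_pos target_prob w_C2 w_snd_snd w_fst_fst w_fst_snd w_snd_moment w_fst_moment
    unfolding w_def by (rule csmc_model.intro)
  show ?thesis
    using ESJD_tendsto[OF s] by (simp add: LIM_zero tendsto_rabs_zero)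
qed

end
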